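(* Let $\pi\colon G\to H$ be a homomorphism of groups with kernel $N$, and let $R=\bigoplus_{g\in G}R_g$ be a $G$-graded ring with a unit. Consider the functor $$\Theta\colon\mathrm{Mod}^H\text{-}\pi_*(R)\longrightarrow(\mathrm{Mod}^G\text{-}R)^N,\qquad Y\mapsto(\pi^*(Y),\mathrm{Id}),\quad f\mapsto\pi^*(f),$$ where $N$ acts on $\mathrm{Mod}^G\text{-}R$ by the degree-shift action and $\mathrm{Id}_n\colon\pi^*(Y)\to\pi^*(Y)(n^{-1})=\pi^*(Y)$ is the identity for each $n\in N$. Then $\Theta$ is an equivalence if and only if $\pi\colon G\to H$ is surjective. In this case, if in addition $N$ is finite, the equivalence $\Theta$ restricts to an equivalence $$\Theta\colon\mathrm{mod}^H\text{-}\pi_*(R)\stackrel{\sim}\longrightarrow(\mathrm{mod}^G\text{-}R)^N.$$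
   Context: All modules are right modules. $\mathrm{Mod}^G\text{-}R$ is the category of $G$-graded $R$-modules $X=\bigoplus_{g\in G}X_g$ (with $X_gR_{g'}\subseteq X_{gg'}$) and degree-preserving $R$-homomorphisms; $\mathrm{mod}^G\text{-}R$ is its full subcategory of finitely presented graded modules. For $g'\in G$, $X(g')$ is $X$ with grading $X(g')_g=X_{g'g}$. Any subgroup $G'\subseteq G$ acts strictly on $\mathrm{Mod}^G\text{-}R$ (and on $\mathrm{mod}^G\text{-}R$) by $F_{g'}=(g'^{-1})$, $g'\in G'$; this is the degree-shift action. For a strict action (a group homomorphism $g\mapsto F_g$ from a group $G'$ to the automorphism group of a category $\mathcal{C}$), $\mathcal{C}^{G'}$ is the category of pairs $(X,\alpha)$ with $X\in\mathcal{C}$ and isomorphisms $\alpha_g\colon X\to F_g(X)$, $g\in G'$, satisfying $\alpha_{gg'}=F_g(\alpha_{g'})\circ\alpha_g$; morphisms $(X,\alpha)\to(Y,\beta)$ are morphisms $\theta\colon X\to Y$ with $\beta_g\circ\theta=F_g(\theta)\circ\alpha_g$ for all $g\in G'$. $\pi_*(R)$ is the $H$-graded ring equal to $R$ as a ring, with $\pi_*(R)_h=\bigoplus_{g\in\pi^{-1}(h)}R_g$. For an $H$-graded $\pi_*(R)$-module $Y$, $\pi^*(Y)$ is the $G$-graded $R$-module with $\pi^*(Y)_g=Y_{\pi(g)}$ for $g\in G$, where $r\in R_{g'}$ acts on $y\in\pi^*(Y)_g=Y_{\pi(g)}$ by $y.r\in Y_{\pi(gg')}=\pi^*(Y)_{gg'}$;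 on morphisms $\pi^*(f)_g=f_{\pi(g)}$.
   Formalization: The ring R is assumed nonzero (1 ≠ 0); for the zero ring all graded modules vanish, so Θ is always an equivalence and the claim that this forces π to be surjective fails. *)

theory Defs
  imports "HOL-Algebra.Ideal" "HOL-Algebra.Product_Groups" "HOL-Library.Equipollence"
begin

section \<open>Categories, functors and equivalences\<close>

text \<open>Composition and the functor actions on morphisms take the objects involved as arguments,
  so that a morphism need not determine its source and target.
  \<open>Cmp C X Y Z g f\<close> is the composite of \<open>f\<close> from \<open>X\<close> to \<open>Y\<close> with \<open>g\<close> from \<open>Y\<close> to \<open>Z\<close>.\<close>

record ('o, 'a) cat =
  Obj :: "'o set"
  Arr :: "'o \<Rightarrow> 'o \<Rightarrow> 'a set"
  Cmp :: "'o \<Rightarrow> 'o \<Rightarrow> 'o \<Rightarrow> 'a \<Rightarrow> 'a \<Rightarrow> 'a"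
  Ide :: "'o \<Rightarrow> 'a"

record ('o, 'a, 'p, 'b) fctr =
  fob :: "'o \<Rightarrow> 'p"
  far :: "'o \<Rightarrow> 'o \<Rightarrow> 'a \<Rightarrow> 'b"

definition is_category :: "('o, 'a) cat \<Rightarrow> bool" where
  "is_category C \<longleftrightarrow>
     (\<forall>X\<in>Obj C. Ide C X \<in> Arr C X X) \<and>
     (\<forall>X\<in>Obj C. \<forall>Y\<in>Obj C. \<forall>Z\<in>Obj C. \<forall>f\<in>Arr C X Y. \<forall>g\<in>Arr C Y Z.
        Cmp C X Y Z g f \<in> Arr C X Z) \<and>
     (\<forall>X\<in>Obj C. \<forall>Y\<in>Obj C. \<forall>f\<in>Arr C X Y.
        Cmp C X X Y f (Ide C X) = f \<and> Cmp C X Y Y (Ide C Y) f = f) \<and>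
     (\<forall>X\<in>Obj C. \<forall>Y\<in>Obj C. \<forall>Z\<in>Obj C. \<forall>W\<in>Obj C.
        \<forall>f\<in>Arr C X Y. \<forall>g\<in>Arr C Y Z. \<forall>h\<in>Arr C Z W.
        Cmp C X Z W h (Cmp C X Y Z g f) = Cmp C X Y W (Cmp C Y Z W h g) f)"

definition full_subcategory :: "('o, 'a) cat \<Rightarrow> ('o \<Rightarrow> bool) \<Rightarrow> ('o, 'a) cat" where
  "full_subcategory C P = C\<lparr>Obj := {X \<in> Obj C. P X}\<rparr>"

definition is_iso :: "('o, 'a) cat \<Rightarrow> 'o \<Rightarrow> 'o \<Rightarrow> 'a \<Rightarrow> bool" where
  "is_iso C X Y f \<longleftrightarrow> f \<in> Arr C X Y \<and>
     (\<exists>g\<in>Arr C Y X. Cmp C X Y X g f = Ide C X \<and> Cmp C Y X Y f g = Ide C Y)"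

definition is_functor ::
    "('o, 'a) cat \<Rightarrow> ('p, 'b) cat \<Rightarrow> ('o, 'a, 'p, 'b) fctr \<Rightarrow> bool" where
  "is_functor C D F \<longleftrightarrow> is_category C \<and> is_category D \<and>
     (\<forall>X\<in>Obj C. fob F X \<in> Obj D) \<and>
     (\<forall>X\<in>Obj C. \<forall>Y\<in>Obj C. \<forall>f\<in>Arr C X Y. far F X Y f \<in> Arr D (fob F X) (fob F Y)) \<and>
     (\<forall>X\<in>Obj C. far F X X (Ide C X) = Ide D (fob F X)) \<and>
     (\<forall>X\<in>Obj C. \<forall>Y\<in>Obj C. \<forall>Z\<in>Obj C. \<forall>f\<in>Arr C X Y. \<forall>g\<in>Arr C Y Z.
        far F X Z (Cmp C X Y Z g f) =
        Cmp D (fob F X) (fob F Y) (fob F Z) (far F Y Z g) (far F X Y f))"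

definition id_functor :: "('o, 'a, 'o, 'a) fctr" where
  "id_functor = \<lparr>fob = (\<lambda>X. X), far = (\<lambda>X Y f. f)\<rparr>"

definition comp_functor ::
    "('p, 'b, 'q, 'c) fctr \<Rightarrow> ('o, 'a, 'p, 'b) fctr \<Rightarrow> ('o, 'a, 'q, 'c) fctr" where
  "comp_functor K F = \<lparr>fob = (\<lambda>X. fob K (fob F X)),
     far = (\<lambda>X Y f. far K (fob F X) (fob F Y) (far F X Y f))\<rparr>"

definition functor_eq ::
    "('o, 'a) cat \<Rightarrow> ('o, 'a, 'p, 'b) fctr \<Rightarrow> ('o, 'a, 'p, 'b) fctr \<Rightarrow> bool" where
  "functor_eq C F K \<longleftrightarrow> (\<forall>X\<in>Obj C. fob F X = fob K X) \<and>
     (\<forall>X\<in>Obj C. \<forall>Y\<in>Obj C. \<forall>f\<in>Arr C X Y. far F X Y f = far K X Y f)"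

definition naturally_isomorphic ::
    "('o, 'a) cat \<Rightarrow> ('p, 'b) cat \<Rightarrow> ('o, 'a, 'p, 'b) fctr \<Rightarrow> ('o, 'a, 'p, 'b) fctr \<Rightarrow> bool" where
  "naturally_isomorphic C D F K \<longleftrightarrow> (\<exists>\<eta>.
     (\<forall>X\<in>Obj C. is_iso D (fob F X) (fob K X) (\<eta> X)) \<and>
     (\<forall>X\<in>Obj C. \<forall>Y\<in>Obj C. \<forall>f\<in>Arr C X Y.
        Cmp D (fob F X) (fob F Y) (fob K Y) (\<eta> Y) (far F X Y f) =
        Cmp D (fob F X) (fob K X) (fob K Y) (far K X Y f) (\<eta> X)))"

definition is_equivalence ::
    "('o, 'a) cat \<Rightarrow> ('p, 'b) cat \<Rightarrow> ('o, 'a, 'p, 'b) fctr \<Rightarrow> bool" where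
  "is_equivalence C D F \<longleftrightarrow> is_functor C D F \<and>
     (\<exists>K. is_functor D C K \<and>
        naturally_isomorphic C C id_functor (comp_functor K F) \<and>
        naturally_isomorphic D D (comp_functor F K) id_functor)"


section \<open>Strict group actions and equivariant objects\<close>

text \<open>A group homomorphism from \<open>N\<close> to the automorphism group of \<open>C\<close>; each \<open>F n\<close> is an automorphism
  because \<open>F (inv n)\<close> is its inverse.\<close>

definition strict_action ::
    "('n, 'z) monoid_scheme \<Rightarrow> ('o, 'a) cat \<Rightarrow> ('n \<Rightarrow> ('o, 'a, 'o, 'a) fctr) \<Rightarrow> bool" where
  "strict_action N C F \<longleftrightarrow> group N \<and>
     (\<forall>n\<in>carrier N. is_functor C C (F n)) \<and>
     functor_eq C (F \<one>\<^bsub>N\<^esub>) id_functor \<and>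
     (\<forall>n\<in>carrier N. \<forall>m\<in>carrier N. functor_eq C (F (n \<otimes>\<^bsub>N\<^esub> m)) (comp_functor (F n) (F m)))"

definition equivariant_cat ::
    "('n, 'z) monoid_scheme \<Rightarrow> ('o, 'a) cat \<Rightarrow> ('n \<Rightarrow> ('o, 'a, 'o, 'a) fctr) \<Rightarrow>
     ('o \<times> ('n \<Rightarrow> 'a), 'a) cat" where
  "equivariant_cat N C F = \<lparr>
     Obj = {(X, \<alpha>). X \<in> Obj C \<and> \<alpha> \<in> extensional (carrier N) \<and>
       (\<forall>n\<in>carrier N. is_iso C X (fob (F n) X) (\<alpha> n)) \<and>
       (\<forall>n\<in>carrier N. \<forall>m\<in>carrier N.
          \<alpha> (n \<otimes>\<^bsub>N\<^esub> m) =
          Cmp C X (fob (F n) X) (fob (F n) (fob (F m) X))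
            (far (F n) X (fob (F m) X) (\<alpha> m)) (\<alpha> n))},
     Arr = (\<lambda>(X, \<alpha>) (Y, \<beta>). {\<theta> \<in> Arr C X Y. \<forall>n\<in>carrier N.
       Cmp C X Y (fob (F n) Y) (\<beta> n) \<theta> =
       Cmp C X (fob (F n) X) (fob (F n) Y) (far (F n) X Y \<theta>) (\<alpha> n)}),
     Cmp = (\<lambda>X Y Z. Cmp C (fst X) (fst Y) (fst Z)),
     Ide = (\<lambda>X. Ide C (fst X))\<rparr>"


section \<open>Graded rings\<close>

text \<open>An internal grading: every \<open>r\<close> is in exactly one way a finite sum of elements of the
  subgroups \<open>A g\<close>.\<close>

locale graded_ring = group G + ring R
  for G :: "('g, 'z) monoid_scheme" and R :: "('r, 'w) ring_scheme"
    and A :: "'g \<Rightarrow> 'r set" +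
  assumes A_subgroup: "g \<in> carrier G \<Longrightarrow> additive_subgroup (A g) R"
    and A_direct_sum: "r \<in> carrier R \<Longrightarrow>
      \<exists>!c. c \<in> (\<Pi>\<^sub>E g\<in>carrier G. A g) \<and> finite {g \<in> carrier G. c g \<noteq> \<zero>\<^bsub>R\<^esub>} \<and>
           r = (\<Oplus>\<^bsub>R\<^esub>g\<in>{g \<in> carrier G. c g \<noteq> \<zero>\<^bsub>R\<^esub>}. c g)"
    and A_mult: "\<lbrakk>g \<in> carrier G; k \<in> carrier G; r \<in> A g; s \<in> A k\<rbrakk> \<Longrightarrow>
      r \<otimes>\<^bsub>R\<^esub> s \<in> A (g \<otimes>\<^bsub>G\<^esub> k)"

definition pushforward_grading ::
    "('g, 'z) monoid_scheme \<Rightarrow> ('r, 'w) ring_scheme \<Rightarrow> ('g \<Rightarrow> 'r set) \<Rightarrow> ('g \<Rightarrow> 'h) \<Rightarrow> 'h \<Rightarrow> 'r set"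
  where
  "pushforward_grading G R A \<pi> h =
     {\<Oplus>\<^bsub>R\<^esub>g\<in>S. c g | S c. finite S \<and> S \<subseteq> {g \<in> carrier G. \<pi> g = h} \<and> c \<in> (\<Pi> g\<in>S. A g)}"


section \<open>Graded right modules\<close>

text \<open>A graded module \<open>\<Oplus>\<^sub>g X\<^sub>g\<close> is given by its homogeneous components (abelian groups, written
  multiplicatively as everywhere for \<^typ>\<open>'a monoid\<close>) and by the products
  \<open>act X g k x r \<in> X\<^bsub>gk\<^esub>\<close> for \<open>x \<in> X\<^sub>g\<close> and \<open>r \<in> R\<^sub>k\<close>, from which the action of \<open>R\<close> on the direct
  sum is obtained by biadditivity. The carriers of components of different degrees may
  overlap, whence the degree arguments. The data are fixed outside their domain, so that equality
  of graded modules is equality of records.\<close>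

record ('g, 'm, 'r) gmod =
  hc :: "'g \<Rightarrow> 'm monoid"
  act :: "'g \<Rightarrow> 'g \<Rightarrow> 'm \<Rightarrow> 'r \<Rightarrow> 'm"

locale graded_module = graded_ring G R A
  for G :: "('g, 'z) monoid_scheme" and R :: "('r, 'w) ring_scheme"
    and A :: "'g \<Rightarrow> 'r set" and X :: "('g, 'm, 'r) gmod" +
  assumes hc_comm_group: "g \<in> carrier G \<Longrightarrow> comm_group (hc X g)"
    and act_closed: "\<lbrakk>g \<in> carrier G; k \<in> carrier G; x \<in> carrier (hc X g); r \<in> A k\<rbrakk> \<Longrightarrow>
      act X g k x r \<in> carrier (hc X (g \<otimes>\<^bsub>G\<^esub> k))"
    and act_add_left: "\<lbrakk>g \<in> carrier G; k \<in> carrier G; x \<in> carrier (hc X g);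
        y \<in> carrier (hc X g); r \<in> A k\<rbrakk> \<Longrightarrow>
      act X g k (x \<otimes>\<^bsub>hc X g\<^esub> y) r = act X g k x r \<otimes>\<^bsub>hc X (g \<otimes>\<^bsub>G\<^esub> k)\<^esub> act X g k y r"
    and act_add_right: "\<lbrakk>g \<in> carrier G; k \<in> carrier G; x \<in> carrier (hc X g);
        r \<in> A k; s \<in> A k\<rbrakk> \<Longrightarrow>
      act X g k x (r \<oplus>\<^bsub>R\<^esub> s) = act X g k x r \<otimes>\<^bsub>hc X (g \<otimes>\<^bsub>G\<^esub> k)\<^esub> act X g k x s"
    and act_one: "\<lbrakk>g \<in> carrier G; x \<in> carrier (hc X g)\<rbrakk> \<Longrightarrow> act X g \<one>\<^bsub>G\<^esub> x \<one>\<^bsub>R\<^esub> = x"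
    and act_mult: "\<lbrakk>g \<in> carrier G; k \<in> carrier G; l \<in> carrier G; x \<in> carrier (hc X g);
        r \<in> A k; s \<in> A l\<rbrakk> \<Longrightarrow>
      act X (g \<otimes>\<^bsub>G\<^esub> k) l (act X g k x r) s = act X g (k \<otimes>\<^bsub>G\<^esub> l) x (r \<otimes>\<^bsub>R\<^esub> s)"
    and hc_ext: "hc X \<in> extensional (carrier G)"
    and act_ext: "\<not> (g \<in> carrier G \<and> k \<in> carrier G \<and> x \<in> carrier (hc X g) \<and> r \<in> A k) \<Longrightarrow>
      act X g k x r = undefined"

definition gmod_hom ::
    "('g, 'z) monoid_scheme \<Rightarrow> ('g \<Rightarrow> 'r set) \<Rightarrow> ('g, 'm, 'r) gmod \<Rightarrow> ('g, 'n, 'r) gmod \<Rightarrow>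
     ('g \<Rightarrow> 'm \<Rightarrow> 'n) set" where
  "gmod_hom G A X Y =
     {f \<in> (\<Pi>\<^sub>E g\<in>carrier G. hom (hc X g) (hc Y g) \<inter> extensional (carrier (hc X g))).
        \<forall>g\<in>carrier G. \<forall>k\<in>carrier G. \<forall>x\<in>carrier (hc X g). \<forall>r\<in>A k.
          f (g \<otimes>\<^bsub>G\<^esub> k) (act X g k x r) = act Y g k (f g x) r}"

text \<open>\<open>Mod_cat TYPE('m) G R A\<close> is the category of all graded modules whose components are carried by
  subsets of \<open>'m\<close>; the type \<open>'m\<close> plays the role of the universe.\<close>

definition Mod_cat ::
    "'m itself \<Rightarrow> ('g, 'z) monoid_scheme \<Rightarrow> ('r, 'w) ring_scheme \<Rightarrow> ('g \<Rightarrow> 'r set) \<Rightarrow>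
     (('g, 'm, 'r) gmod, 'g \<Rightarrow> 'm \<Rightarrow> 'm) cat" where
  "Mod_cat _ G R A = \<lparr>
     Obj = {X. graded_module G R A X},
     Arr = gmod_hom G A,
     Cmp = (\<lambda>X Y Z f' f. \<lambda>g\<in>carrier G. compose (carrier (hc X g)) (f' g) (f g)),
     Ide = (\<lambda>X. \<lambda>g\<in>carrier G. \<lambda>x\<in>carrier (hc X g). x)\<rparr>"

text \<open>The free graded module \<open>R(d\<^sub>0) \<oplus> \<dots> \<oplus> R(d\<^bsub>n-1\<^esub>)\<close>; its component of degree \<open>g\<close> is
  the product of the groups \<open>R\<^bsub>d\<^sub>i g\<^esub>\<close>.\<close>

definition free_gmod ::
    "('g, 'z) monoid_scheme \<Rightarrow> ('r, 'w) ring_scheme \<Rightarrow> ('g \<Rightarrow> 'r set) \<Rightarrow> nat \<Rightarrow> (nat \<Rightarrow> 'g) \<Rightarrow>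
     ('g, nat \<Rightarrow> 'r, 'r) gmod" where
  "free_gmod G R A n d = \<lparr>
     hc = (\<lambda>g\<in>carrier G. product_group {..<n}
             (\<lambda>i. (add_monoid R)\<lparr>carrier := A (d i \<otimes>\<^bsub>G\<^esub> g)\<rparr>)),
     act = (\<lambda>g k v r.
       if g \<in> carrier G \<and> k \<in> carrier G \<and> v \<in> (\<Pi>\<^sub>E i\<in>{..<n}. A (d i \<otimes>\<^bsub>G\<^esub> g)) \<and> r \<in> A k
       then (\<lambda>i\<in>{..<n}. v i \<otimes>\<^bsub>R\<^esub> r) else undefined)\<rparr>"

text \<open>Existence of an exact sequence \<open>F\<^sub>1 \<rightarrow> F\<^sub>0 \<rightarrow> X \<rightarrow> 0\<close> of graded modules with \<open>F\<^sub>0\<close>, \<open>F\<^sub>1\<close> free of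
  finite rank.\<close>

definition finitely_presented ::
    "('g, 'z) monoid_scheme \<Rightarrow> ('r, 'w) ring_scheme \<Rightarrow> ('g \<Rightarrow> 'r set) \<Rightarrow> ('g, 'm, 'r) gmod \<Rightarrow> bool"
  where
  "finitely_presented G R A X \<longleftrightarrow>
     (\<exists>n d m e p q. d \<in> {..<n} \<rightarrow> carrier G \<and> e \<in> {..<m} \<rightarrow> carrier G \<and>
        p \<in> gmod_hom G A (free_gmod G R A n d) X \<and>
        q \<in> gmod_hom G A (free_gmod G R A m e) (free_gmod G R A n d) \<and>
        (\<forall>g\<in>carrier G. p g ` carrier (hc (free_gmod G R A n d) g) = carrier (hc X g)) \<and>
        (\<forall>g\<in>carrier G. q g ` carrier (hc (free_gmod G R A m e) g) =
           kernel (hc (free_gmod G R A n d) g) (hc X g) (p g)))"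

definition mod_cat ::
    "'m itself \<Rightarrow> ('g, 'z) monoid_scheme \<Rightarrow> ('r, 'w) ring_scheme \<Rightarrow> ('g \<Rightarrow> 'r set) \<Rightarrow>
     (('g, 'm, 'r) gmod, 'g \<Rightarrow> 'm \<Rightarrow> 'm) cat" where
  "mod_cat U G R A = full_subcategory (Mod_cat U G R A) (finitely_presented G R A)"


section \<open>Degree shift and restriction along a group homomorphism\<close>

definition shift :: "('g, 'z) monoid_scheme \<Rightarrow> 'g \<Rightarrow> ('g, 'm, 'r) gmod \<Rightarrow> ('g, 'm, 'r) gmod" where
  "shift G d X = \<lparr>
     hc = (\<lambda>g\<in>carrier G. hc X (d \<otimes>\<^bsub>G\<^esub> g)),
     act = (\<lambda>g k x r. if g \<in> carrier G then act X (d \<otimes>\<^bsub>G\<^esub> g) k x r else undefined)\<rparr>"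

definition shift_functor ::
    "('g, 'z) monoid_scheme \<Rightarrow> 'g \<Rightarrow>
     (('g, 'm, 'r) gmod, 'g \<Rightarrow> 'm \<Rightarrow> 'm, ('g, 'm, 'r) gmod, 'g \<Rightarrow> 'm \<Rightarrow> 'm) fctr" where
  "shift_functor G d = \<lparr>fob = shift G d, far = (\<lambda>X Y f. \<lambda>g\<in>carrier G. f (d \<otimes>\<^bsub>G\<^esub> g))\<rparr>"

definition shift_action ::
    "('g, 'z) monoid_scheme \<Rightarrow> 'g \<Rightarrow>
     (('g, 'm, 'r) gmod, 'g \<Rightarrow> 'm \<Rightarrow> 'm, ('g, 'm, 'r) gmod, 'g \<Rightarrow> 'm \<Rightarrow> 'm) fctr" where
  "shift_action G g = shift_functor G (inv\<^bsub>G\<^esub> g)"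

definition pullback ::
    "('g, 'z) monoid_scheme \<Rightarrow> ('g \<Rightarrow> 'r set) \<Rightarrow> ('g \<Rightarrow> 'h) \<Rightarrow> ('h, 'm, 'r) gmod \<Rightarrow>
     ('g, 'm, 'r) gmod" where
  "pullback G A \<pi> Y = \<lparr>
     hc = (\<lambda>g\<in>carrier G. hc Y (\<pi> g)),
     act = (\<lambda>g k y r.
       if g \<in> carrier G \<and> k \<in> carrier G \<and> y \<in> carrier (hc Y (\<pi> g)) \<and> r \<in> A k
       then act Y (\<pi> g) (\<pi> k) y r else undefined)\<rparr>"

text \<open>The \<open>n\<close>-th structure map of \<open>\<Theta>(Y)\<close> is the identity of \<open>\<pi>\<^sup>*(Y)\<close>; it is a morphism to the shift
  of \<open>\<pi>\<^sup>*(Y)\<close> by \<open>inv n\<close> because \<open>\<pi> (inv n \<otimes> g) = \<pi> g\<close> makes the two modules equal.\<close>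

definition Theta ::
    "('g, 'z) monoid_scheme \<Rightarrow> ('h, 'y) monoid_scheme \<Rightarrow> ('g \<Rightarrow> 'r set) \<Rightarrow> ('g \<Rightarrow> 'h) \<Rightarrow>
     (('h, 'm, 'r) gmod, 'h \<Rightarrow> 'm \<Rightarrow> 'm,
      ('g, 'm, 'r) gmod \<times> ('g \<Rightarrow> 'g \<Rightarrow> 'm \<Rightarrow> 'm), 'g \<Rightarrow> 'm \<Rightarrow> 'm) fctr" where
  "Theta G H A \<pi> = \<lparr>
     fob = (\<lambda>Y. (pullback G A \<pi> Y,
       \<lambda>n\<in>kernel G H \<pi>. \<lambda>g\<in>carrier G. \<lambda>y\<in>carrier (hc (pullback G A \<pi> Y) g). y)),
     far = (\<lambda>Y Z f. \<lambda>g\<in>carrier G. f (\<pi> g))\<rparr>"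

end

theory Submission
  imports Defs
begin

text \<open>Faithfulness of \<open>\<Theta>\<close> forces \<open>\<pi>\<close> to be surjective, since the regular module generated in a
  degree outside the image of \<open>\<pi>\<close> restricts to zero. Conversely, an equivariant structure \<open>\<alpha>\<close>
  on \<open>X\<close> is a coherent system of isomorphisms \<open>X\<^sub>g \<rightarrow> X\<^sub>k\<close> for \<open>\<pi> g = \<pi> k\<close>, so a section
  \<open>s\<close> of \<open>\<pi>\<close> yields an \<open>H\<close>-graded module with components \<open>X\<^bsub>s h\<^esub>\<close> whose restriction is
  isomorphic to \<open>X\<close>.

  If \<open>N\<close> is finite, graded submodules of \<open>Y\<close> and of \<open>\<pi>\<^sup>*(Y)\<close> with the same components are
  finitely generated simultaneously, and \<open>\<pi>\<^sup>*\<close> takes free modules of finite rank to free modules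
  of finite rank. Hence \<open>Y\<close> is finitely presented if and only if \<open>\<pi>\<^sup>*(Y)\<close> is.\<close>

section \<open>Equivalences and equivariant categories\<close>

text \<open>On the test module the identity and the zero endomorphism restrict to the same map. To
  tell them apart R must be nonzero, and the module must live on the type \<open>'m\<close>, whence
  the embedding of R into the universe.

  The isomorphism from X_g to X_k is \<alpha> at g k^-1, evaluated in degree g, because shifting g
  by the inverse of g k^-1 gives k. A section s of \<pi> is only a map of sets: for x in X_(s h) and
  r in R_g the product lies in degree s(h) g and must be transported to s(h \<pi>(g)). Moreover a
  homogeneous element of the pushforward ring is only a finite sum of G-homogeneous ones, so the
  action is defined summand by summand and its laws are reduced to G-homogeneous scalars.

  A presentation of the restriction of Y need not come from one of Y. Instead a free cover of Y is
  restricted; its kernel is finitely generated because every finitely generated cover of a finitely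
  presented module has this property, and the generators of the kernel are pushed forward to
  H.\<close>

lemma category_ide: "is_category C \<Longrightarrow> X \<in> Obj C \<Longrightarrow> Ide C X \<in> Arr C X X"
  by (simp add: is_category_def)

lemma category_cmp:
  "\<lbrakk>is_category C; X \<in> Obj C; Y \<in> Obj C; Z \<in> Obj C; f \<in> Arr C X Y; g \<in> Arr C Y Z\<rbrakk>
   \<Longrightarrow> Cmp C X Y Z g f \<in> Arr C X Z"
  by (simp add: is_category_def)

lemma category_ide_right:
  "\<lbrakk>is_category C; X \<in> Obj C; Y \<in> Obj C; f \<in> Arr C X Y\<rbrakk> \<Longrightarrow> Cmp C X X Y f (Ide C X) = f"
  by (simp add: is_category_def)

lemma category_ide_left:
  "\<lbrakk>is_category C; X \<in> Obj C; Y \<in> Obj C; f \<in> Arr C X Y\<rbrakk> \<Longrightarrow> Cmp C X Y Y (Ide C Y) f = f"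
  by (simp add: is_category_def)

lemma category_assoc:
  "\<lbrakk>is_category C; X \<in> Obj C; Y \<in> Obj C; Z \<in> Obj C; W \<in> Obj C;
    f \<in> Arr C X Y; g \<in> Arr C Y Z; h \<in> Arr C Z W\<rbrakk>
   \<Longrightarrow> Cmp C X Z W h (Cmp C X Y Z g f) = Cmp C X Y W (Cmp C Y Z W h g) f"
  by (simp add: is_category_def)

lemma functor_ob: "is_functor C D F \<Longrightarrow> X \<in> Obj C \<Longrightarrow> fob F X \<in> Obj D"
  by (simp add: is_functor_def)

lemma functor_ar:
  "\<lbrakk>is_functor C D F; X \<in> Obj C; Y \<in> Obj C; f \<in> Arr C X Y\<rbrakk>
   \<Longrightarrow> far F X Y f \<in> Arr D (fob F X) (fob F Y)"
  by (simp add: is_functor_def)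

lemma functor_ide:
  "is_functor C D F \<Longrightarrow> X \<in> Obj C \<Longrightarrow> far F X X (Ide C X) = Ide D (fob F X)"
  by (simp add: is_functor_def)

lemma functor_cmp:
  "\<lbrakk>is_functor C D F; X \<in> Obj C; Y \<in> Obj C; Z \<in> Obj C; f \<in> Arr C X Y; g \<in> Arr C Y Z\<rbrakk>
   \<Longrightarrow> far F X Z (Cmp C X Y Z g f) =
       Cmp D (fob F X) (fob F Y) (fob F Z) (far F Y Z g) (far F X Y f)"
  by (simp add: is_functor_def)

lemma functor_source: "is_functor C D F \<Longrightarrow> is_category C"
  and functor_target: "is_functor C D F \<Longrightarrow> is_category D"
  by (simp_all add: is_functor_def)

text \<open>The quasi-inverse is built from choices: \<open>k Y\<close> is a preimage of Y up to the
  isomorphism \<open>e Y\<close>, and a morphism goes to the preimage under F of its conjugate by e.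
  Faithfulness allows all identities for K to be tested in D, where the monic \<open>e Z\<close> can
  be cancelled.\<close>

lemma is_equivalenceI:
  assumes F: "is_functor C D F"
    and full: "\<And>X Y g. \<lbrakk>X \<in> Obj C; Y \<in> Obj C; g \<in> Arr D (fob F X) (fob F Y)\<rbrakk>
      \<Longrightarrow> \<exists>f\<in>Arr C X Y. far F X Y f = g"
    and faithful: "\<And>X Y f f'. \<lbrakk>X \<in> Obj C; Y \<in> Obj C; f \<in> Arr C X Y; f' \<in> Arr C X Y;
      far F X Y f = far F X Y f'\<rbrakk> \<Longrightarrow> f = f'"
    and ess: "\<And>Y. Y \<in> Obj D \<Longrightarrow> \<exists>X\<in>Obj C. \<exists>e. is_iso D (fob F X) Y e"
  shows "is_equivalence C D F"
proof -
  note C = functor_source[OF F] and D = functor_target[OF F]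
  note Fob = functor_ob[OF F] and Far = functor_ar[OF F]
  from ess have "\<forall>Y. \<exists>X e. Y \<in> Obj D \<longrightarrow> X \<in> Obj C \<and> is_iso D (fob F X) Y e" by blast
  then obtain k e where "\<forall>Y. Y \<in> Obj D \<longrightarrow> k Y \<in> Obj C \<and> is_iso D (fob F (k Y)) Y (e Y)"
    by metis
  then have k: "\<And>Y. Y \<in> Obj D \<Longrightarrow> k Y \<in> Obj C"
    and iso_e: "\<And>Y. Y \<in> Obj D \<Longrightarrow> is_iso D (fob F (k Y)) Y (e Y)" by auto
  have e: "e Y \<in> Arr D (fob F (k Y)) Y" if "Y \<in> Obj D" for Y
    using iso_e[OF that] by (simp add: is_iso_def)
  have "\<forall>Y. \<exists>e'. Y \<in> Obj D \<longrightarrow> e' \<in> Arr D Y (fob F (k Y)) \<and>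
     Cmp D (fob F (k Y)) Y (fob F (k Y)) e' (e Y) = Ide D (fob F (k Y)) \<and>
     Cmp D Y (fob F (k Y)) Y (e Y) e' = Ide D Y"
    using iso_e by (auto simp: is_iso_def)
  then obtain e' where "\<forall>Y. Y \<in> Obj D \<longrightarrow> e' Y \<in> Arr D Y (fob F (k Y)) \<and>
     Cmp D (fob F (k Y)) Y (fob F (k Y)) (e' Y) (e Y) = Ide D (fob F (k Y)) \<and>
     Cmp D Y (fob F (k Y)) Y (e Y) (e' Y) = Ide D Y" by metis
  then have e': "\<And>Y. Y \<in> Obj D \<Longrightarrow> e' Y \<in> Arr D Y (fob F (k Y))"
    and e'e: "\<And>Y. Y \<in> Obj D \<Longrightarrow>
      Cmp D (fob F (k Y)) Y (fob F (k Y)) (e' Y) (e Y) = Ide D (fob F (k Y))"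
    and ee': "\<And>Y. Y \<in> Obj D \<Longrightarrow> Cmp D Y (fob F (k Y)) Y (e Y) (e' Y) = Ide D Y" by auto
  define \<phi> where "\<phi> X Y g = (SOME f. f \<in> Arr C X Y \<and> far F X Y f = g)" for X Y g
  have \<phi>: "\<phi> X Y g \<in> Arr C X Y \<and> far F X Y (\<phi> X Y g) = g"
    if "X \<in> Obj C" "Y \<in> Obj C" "g \<in> Arr D (fob F X) (fob F Y)" for X Y g
    unfolding \<phi>_def by (rule someI_ex) (use full[OF that] in blast)
  \<comment> \<open>Conjugation of g by the isomorphisms e. The equation \<open>e_c\<close> below
    says that e is natural for it, which becomes the counit of the equivalence.\<close>
  define c where "c Y Z g = Cmp D (fob F (k Y)) Y (fob F (k Z)) (Cmp D Y Z (fob F (k Z)) (e' Z) g) (e Y)"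
    for Y Z g
  have c: "c Y Z g \<in> Arr D (fob F (k Y)) (fob F (k Z))"
    if "Y \<in> Obj D" "Z \<in> Obj D" "g \<in> Arr D Y Z" for Y Z g
    unfolding c_def using that
    by (intro category_cmp[OF D]) (auto simp: k Fob e e')
  have e_c: "Cmp D (fob F (k Y)) (fob F (k Z)) Z (e Z) (c Y Z g) = Cmp D (fob F (k Y)) Y Z g (e Y)"
    if Y: "Y \<in> Obj D" and Z: "Z \<in> Obj D" and g: "g \<in> Arr D Y Z" for Y Z g
  proof -
    have "Cmp D (fob F (k Y)) (fob F (k Z)) Z (e Z) (c Y Z g) =
      Cmp D (fob F (k Y)) Y Z (Cmp D Y (fob F (k Z)) Z (e Z) (Cmp D Y Z (fob F (k Z)) (e' Z) g)) (e Y)"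
      unfolding c_def using Y Z g
      by (intro category_assoc[OF D]) (auto simp: k Fob e e' intro!: category_cmp[OF D, where Y = Z])
    also have "Cmp D Y (fob F (k Z)) Z (e Z) (Cmp D Y Z (fob F (k Z)) (e' Z) g) =
       Cmp D Y Z Z (Cmp D Z (fob F (k Z)) Z (e Z) (e' Z)) g"
      using Y Z g by (intro category_assoc[OF D]) (auto simp: k Fob e e')
    also have "\<dots> = g" using ee'[OF Z] category_ide_left[OF D Y Z g] by simp
    finally show ?thesis .
  qed
  have e_mono: "u = v" if Z: "Z \<in> Obj D" and W: "W \<in> Obj D" and u: "u \<in> Arr D W (fob F (k Z))"
    and v: "v \<in> Arr D W (fob F (k Z))"
    and eq: "Cmp D W (fob F (k Z)) Z (e Z) u = Cmp D W (fob F (k Z)) Z (e Z) v" for Z W u v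
  proof -
    have *: "Cmp D W Z (fob F (k Z)) (e' Z) (Cmp D W (fob F (k Z)) Z (e Z) w) = w"
      if w: "w \<in> Arr D W (fob F (k Z))" for w
    proof -
      have "Cmp D W Z (fob F (k Z)) (e' Z) (Cmp D W (fob F (k Z)) Z (e Z) w) =
        Cmp D W (fob F (k Z)) (fob F (k Z)) (Cmp D (fob F (k Z)) Z (fob F (k Z)) (e' Z) (e Z)) w"
        using w Z W by (intro category_assoc[OF D]) (auto simp: k Fob e e')
      also have "\<dots> = w" using e'e[OF Z] category_ide_left[OF D W _ w] Z by (simp add: k Fob)
      finally show ?thesis .
    qed
    show ?thesis
      using arg_cong[OF eq, of "Cmp D W Z (fob F (k Z)) (e' Z)"] unfolding *[OF u] *[OF v] .
  qed
  define K where "K = \<lparr>fob = k, far = (\<lambda>Y Z g. \<phi> (k Y) (k Z) (c Y Z g))\<rparr>"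
  have fK: "fob K Y = k Y" "far K Y Z g = \<phi> (k Y) (k Z) (c Y Z g)" for Y Z g
    by (simp_all add: K_def)
  have Kar: "far K Y Z g \<in> Arr C (k Y) (k Z)" "far F (k Y) (k Z) (far K Y Z g) = c Y Z g"
    if "Y \<in> Obj D" "Z \<in> Obj D" "g \<in> Arr D Y Z" for Y Z g
    using \<phi>[OF k[OF that(1)] k[OF that(2)] c[OF that]] by (simp_all add: fK)
  have Kfun: "is_functor D C K"
    unfolding is_functor_def
  proof (intro conjI ballI)
    fix X assume X: "X \<in> Obj D"
    show "fob K X \<in> Obj C" by (simp add: fK k X)
    have i: "Ide D X \<in> Arr D X X" by (rule category_ide[OF D X])
    have "c X X (Ide D X) = Ide D (fob F (k X))"
      unfolding c_def using category_ide_right[OF D X _ e'[OF X]] e'e[OF X] X by (simp add: k Fob)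
    then show "far K X X (Ide D X) = Ide C (fob K X)"
      using Kar[OF X X i] functor_ide[OF F k[OF X]] category_ide[OF C k[OF X]]
      by (intro faithful[OF k[OF X] k[OF X]]) (simp_all add: fK(1))
  next
    fix X Y f assume "X \<in> Obj D" "Y \<in> Obj D" "f \<in> Arr D X Y"
    then show "far K X Y f \<in> Arr C (fob K X) (fob K Y)" using Kar by (simp add: fK(1))
  next
    fix X Y Z f g
    assume X: "X \<in> Obj D" and Y: "Y \<in> Obj D" and Z: "Z \<in> Obj D"
      and f: "f \<in> Arr D X Y" and g: "g \<in> Arr D Y Z"
    note gf = category_cmp[OF D X Y Z f g]
    let ?l = "far K X Z (Cmp D X Y Z g f)" and ?r = "Cmp C (k X) (k Y) (k Z) (far K Y Z g) (far K X Y f)"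
    let ?G = "\<lambda>X. fob F (k X)"
    have r: "?r \<in> Arr C (k X) (k Z)"
      by (rule category_cmp[OF C k[OF X] k[OF Y] k[OF Z] Kar(1)[OF X Y f] Kar(1)[OF Y Z g]])
    have "c X Z (Cmp D X Y Z g f) = Cmp D (?G X) (?G Y) (?G Z) (c Y Z g) (c X Y f)"
    proof (rule e_mono[OF Z])
      show "?G X \<in> Obj D" by (simp add: k Fob X)
      show "c X Z (Cmp D X Y Z g f) \<in> Arr D (?G X) (?G Z)" by (rule c[OF X Z gf])
      show "Cmp D (?G X) (?G Y) (?G Z) (c Y Z g) (c X Y f) \<in> Arr D (?G X) (?G Z)"
        using X Y Z f g by (intro category_cmp[OF D]) (auto simp: k Fob c)
      have "Cmp D (?G X) (?G Z) Z (e Z) (Cmp D (?G X) (?G Y) (?G Z) (c Y Z g) (c X Y f)) =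
         Cmp D (?G X) (?G Y) Z (Cmp D (?G Y) (?G Z) Z (e Z) (c Y Z g)) (c X Y f)"
        using X Y Z f g by (intro category_assoc[OF D]) (auto simp: k Fob c e)
      also have "\<dots> = Cmp D (?G X) (?G Y) Z (Cmp D (?G Y) Y Z g (e Y)) (c X Y f)"
        by (simp add: e_c Y Z g)
      also have "\<dots> = Cmp D (?G X) Y Z g (Cmp D (?G X) (?G Y) Y (e Y) (c X Y f))"
        using X Y Z f g by (intro category_assoc[OF D, symmetric]) (auto simp: k Fob c e)
      also have "\<dots> = Cmp D (?G X) Y Z g (Cmp D (?G X) X Y f (e X))"
        by (simp add: e_c X Y f)
      also have "\<dots> = Cmp D (?G X) X Z (Cmp D X Y Z g f) (e X)"
        using X Y Z f g by (intro category_assoc[OF D]) (auto simp: k Fob c e)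
      also have "\<dots> = Cmp D (?G X) (?G Z) Z (e Z) (c X Z (Cmp D X Y Z g f))"
        by (simp add: e_c X Z gf)
      finally show "Cmp D (?G X) (?G Z) Z (e Z) (c X Z (Cmp D X Y Z g f)) =
        Cmp D (?G X) (?G Z) Z (e Z) (Cmp D (?G X) (?G Y) (?G Z) (c Y Z g) (c X Y f))" by simp
    qed
    then have "?l = ?r"
      using functor_cmp[OF F k[OF X] k[OF Y] k[OF Z] Kar(1)[OF X Y f] Kar(1)[OF Y Z g]]
        Kar[OF X Z gf] Kar(2)[OF X Y f] Kar(2)[OF Y Z g] r
      by (intro faithful[OF k[OF X] k[OF Z]]) simp_all
    then show "?l = Cmp C (fob K X) (fob K Y) (fob K Z) (far K Y Z g) (far K X Y f)"
      by (simp add: fK(1))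
  qed (use C D in auto)
  have FK: "naturally_isomorphic D D (comp_functor F K) id_functor"
    unfolding naturally_isomorphic_def
  proof (intro exI[of _ e] conjI ballI)
    fix X assume "X \<in> Obj D"
    then show "is_iso D (fob (comp_functor F K) X) (fob id_functor X) (e X)"
      by (simp add: comp_functor_def id_functor_def fK(1) iso_e)
  next
    fix X Y f assume "X \<in> Obj D" "Y \<in> Obj D" "f \<in> Arr D X Y"
    then show "Cmp D (fob (comp_functor F K) X) (fob (comp_functor F K) Y) (fob id_functor Y) (e Y)
        (far (comp_functor F K) X Y f) =
       Cmp D (fob (comp_functor F K) X) (fob id_functor X) (fob id_functor Y) (far id_functor X Y f) (e X)"
      using e_c Kar(2) by (simp add: comp_functor_def id_functor_def fK(1))
  qed
  \<comment> \<open>The unit is the preimage under F of the inverse of \<open>e (fob F X)\<close>;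
    the preimage \<epsilon> of \<open>e (fob F X)\<close> itself inverts it.\<close>
  define \<eta> where "\<eta> X = \<phi> X (k (fob F X)) (e' (fob F X))" for X
  have \<eta>: "\<eta> X \<in> Arr C X (k (fob F X))" "far F X (k (fob F X)) (\<eta> X) = e' (fob F X)"
    if "X \<in> Obj C" for X
    using \<phi>[OF that k[OF Fob[OF that]] e'[OF Fob[OF that]]] by (simp_all add: \<eta>_def)
  have KF: "naturally_isomorphic C C id_functor (comp_functor K F)"
    unfolding naturally_isomorphic_def
  proof (intro exI[of _ \<eta>] conjI ballI)
    fix X assume X: "X \<in> Obj C"
    let ?X' = "k (fob F X)"
    have X': "?X' \<in> Obj C" by (simp add: X k Fob)
    define \<epsilon> where "\<epsilon> = \<phi> ?X' X (e (fob F X))"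
    have \<epsilon>: "\<epsilon> \<in> Arr C ?X' X" "far F ?X' X \<epsilon> = e (fob F X)"
      using \<phi>[OF X' X e[OF Fob[OF X]]] by (simp_all add: \<epsilon>_def)
    have "Cmp C X ?X' X \<epsilon> (\<eta> X) = Ide C X"
      using category_cmp[OF C X X' X \<eta>(1)[OF X] \<epsilon>(1)] category_ide[OF C X]
        functor_cmp[OF F X X' X \<eta>(1)[OF X] \<epsilon>(1)] functor_ide[OF F X] ee'[OF Fob[OF X]]
        \<eta>(2)[OF X] \<epsilon>(2)
      by (intro faithful[OF X X]) simp_all
    moreover have "Cmp C ?X' X ?X' (\<eta> X) \<epsilon> = Ide C ?X'"
      using category_cmp[OF C X' X X' \<epsilon>(1) \<eta>(1)[OF X]] category_ide[OF C X']
        functor_cmp[OF F X' X X' \<epsilon>(1) \<eta>(1)[OF X]] functor_ide[OF F X'] e'e[OF Fob[OF X]]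
        \<eta>(2)[OF X] \<epsilon>(2)
      by (intro faithful[OF X' X']) simp_all
    ultimately show "is_iso C (fob id_functor X) (fob (comp_functor K F) X) (\<eta> X)"
      using \<eta>(1)[OF X] \<epsilon>(1) unfolding is_iso_def
      by (auto simp: comp_functor_def id_functor_def fK(1) intro!: bexI[of _ \<epsilon>])
  next
    fix X Y f assume X: "X \<in> Obj C" and Y: "Y \<in> Obj C" and f: "f \<in> Arr C X Y"
    let ?X' = "k (fob F X)" and ?Y' = "k (fob F Y)"
    let ?G = "\<lambda>X. fob F X"
    have X': "?X' \<in> Obj C" and Y': "?Y' \<in> Obj C" by (simp_all add: X Y k Fob)
    note Ff = Far[OF X Y f]
    have KFf: "far K (?G X) (?G Y) (far F X Y f) \<in> Arr C ?X' ?Y'"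
      "far F ?X' ?Y' (far K (?G X) (?G Y) (far F X Y f)) = c (?G X) (?G Y) (far F X Y f)"
      using Kar[OF Fob[OF X] Fob[OF Y] Ff] by auto
    have "Cmp D (?G X) (?G ?X') (?G ?Y') (c (?G X) (?G Y) (far F X Y f)) (e' (?G X)) =
       Cmp D (?G X) (?G X) (?G ?Y') (Cmp D (?G X) (?G Y) (?G ?Y') (e' (?G Y)) (far F X Y f))
         (Cmp D (?G X) (?G ?X') (?G X) (e (?G X)) (e' (?G X)))"
      unfolding c_def using X Y X' Y' Ff
      by (intro category_assoc[OF D, symmetric])
        (auto simp: k Fob e e' intro!: category_cmp[OF D, where Y = "?G Y"])
    also have "\<dots> = Cmp D (?G X) (?G Y) (?G ?Y') (e' (?G Y)) (far F X Y f)"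
      unfolding ee'[OF Fob[OF X]]
      by (intro category_ide_right[OF D] category_cmp[OF D]) (use X Y Y' Ff in \<open>auto simp: Fob e'\<close>)
    finally have "Cmp C X Y ?Y' (\<eta> Y) f = Cmp C X ?X' ?Y' (far K (?G X) (?G Y) (far F X Y f)) (\<eta> X)"
      using functor_cmp[OF F X Y Y' f \<eta>(1)[OF Y]] functor_cmp[OF F X X' Y' \<eta>(1)[OF X] KFf(1)]
        KFf(2) \<eta>(2)[OF X] \<eta>(2)[OF Y]
        category_cmp[OF C X Y Y' f \<eta>(1)[OF Y]] category_cmp[OF C X X' Y' \<eta>(1)[OF X] KFf(1)]
      by (intro faithful[OF X Y']) simp_all
    then show "Cmp C (fob id_functor X) (fob id_functor Y) (fob (comp_functor K F) Y) (\<eta> Y) (far id_functor X Y f) =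
      Cmp C (fob id_functor X) (fob (comp_functor K F) X) (fob (comp_functor K F) Y)
        (far (comp_functor K F) X Y f) (\<eta> X)"
      by (simp add: comp_functor_def id_functor_def fK(1))
  qed
  show ?thesis unfolding is_equivalence_def using F Kfun KF FK by blast
qed

text \<open>Naturality of the unit expresses the composite of f with \<eta> at Y through F f alone,
  and \<eta> at Y has a left inverse.\<close>

lemma equivalence_faithful:
  assumes "is_equivalence C D F" and X: "X \<in> Obj C" and Y: "Y \<in> Obj C"
    and f: "f \<in> Arr C X Y" and f': "f' \<in> Arr C X Y" and eq: "far F X Y f = far F X Y f'"
  shows "f = f'"
proof -
  obtain K where F: "is_functor C D F" and K: "is_functor D C K"
    and "naturally_isomorphic C C id_functor (comp_functor K F)"
    using assms(1) unfolding is_equivalence_def by blast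
  then obtain \<eta> where iso: "\<And>X. X \<in> Obj C \<Longrightarrow> is_iso C X (fob K (fob F X)) (\<eta> X)"
    and nat: "\<And>X Y f. \<lbrakk>X \<in> Obj C; Y \<in> Obj C; f \<in> Arr C X Y\<rbrakk> \<Longrightarrow>
      Cmp C X Y (fob K (fob F Y)) (\<eta> Y) f =
      Cmp C X (fob K (fob F X)) (fob K (fob F Y)) (far K (fob F X) (fob F Y) (far F X Y f)) (\<eta> X)"
    unfolding naturally_isomorphic_def id_functor_def comp_functor_def fctr.simps by metis
  let ?Y' = "fob K (fob F Y)"
  have Y': "?Y' \<in> Obj C" using F K Y by (simp add: functor_ob)
  note C = functor_source[OF F]
  obtain \<epsilon> where \<eta>: "\<eta> Y \<in> Arr C Y ?Y'" and \<epsilon>: "\<epsilon> \<in> Arr C ?Y' Y"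
    and inv: "Cmp C Y ?Y' Y \<epsilon> (\<eta> Y) = Ide C Y"
    using iso[OF Y] unfolding is_iso_def by blast
  have *: "Cmp C X ?Y' Y \<epsilon> (Cmp C X Y ?Y' (\<eta> Y) u) = u" if u: "u \<in> Arr C X Y" for u
    using category_assoc[OF C X Y Y' Y u \<eta> \<epsilon>] category_ide_left[OF C X Y u] by (simp add: inv)
  have "Cmp C X Y ?Y' (\<eta> Y) f = Cmp C X Y ?Y' (\<eta> Y) f'"
    by (simp add: nat X Y f f' eq)
  from arg_cong[OF this, of "Cmp C X ?Y' Y \<epsilon>"] show ?thesis unfolding *[OF f] *[OF f'] .
qed

section \<open>Full subcategories and categories of equivariant objects\<close>

lemma full_subcategory_simps [simp]:
  "Obj (full_subcategory C P) = {X \<in> Obj C. P X}" "Arr (full_subcategory C P) = Arr C"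
  "Cmp (full_subcategory C P) = Cmp C" "Ide (full_subcategory C P) = Ide C"
  by (simp_all add: full_subcategory_def)

lemma is_iso_full_subcategory [simp]: "is_iso (full_subcategory C P) = is_iso C"
  by (simp add: is_iso_def fun_eq_iff)

lemma is_category_full_subcategory: "is_category C \<Longrightarrow> is_category (full_subcategory C P)"
  by (simp add: is_category_def)

lemma is_functor_full_subcategory:
  assumes "is_functor C D F" and "\<And>X. X \<in> Obj C \<Longrightarrow> P X \<Longrightarrow> Q (fob F X)"
  shows "is_functor (full_subcategory C P) (full_subcategory D Q) F"
  using assms is_category_full_subcategory[of C P] is_category_full_subcategory[of D Q]
  by (simp add: is_functor_def)

text \<open>Morphisms, composites and isomorphisms are those of C, so only the condition P on the
  underlying object survives. This turns the statement about finitely presented modules into one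
  about full subcategories of the source and target of \<Theta>.\<close>

lemma equivariant_cat_full_subcategory:
  "equivariant_cat N (full_subcategory C P) F =
   full_subcategory (equivariant_cat N C F) (\<lambda>X. P (fst X))"
  unfolding equivariant_cat_def by (auto simp: full_subcategory_def is_iso_def)

lemma equivariant_cat_simps [simp]:
  "Arr (equivariant_cat N C F) X Y = {\<theta> \<in> Arr C (fst X) (fst Y). \<forall>n\<in>carrier N.
       Cmp C (fst X) (fst Y) (fob (F n) (fst Y)) (snd Y n) \<theta> =
       Cmp C (fst X) (fob (F n) (fst X)) (fob (F n) (fst Y)) (far (F n) (fst X) (fst Y) \<theta>) (snd X n)}"
  "Cmp (equivariant_cat N C F) X Y Z = Cmp C (fst X) (fst Y) (fst Z)"
  "Ide (equivariant_cat N C F) X = Ide C (fst X)"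
  by (simp_all add: equivariant_cat_def split_beta)

lemma equivariant_objD:
  assumes "X \<in> Obj (equivariant_cat N C F)"
  shows "fst X \<in> Obj C" "n \<in> carrier N \<Longrightarrow> snd X n \<in> Arr C (fst X) (fob (F n) (fst X))"
  using assms by (auto simp: equivariant_cat_def is_iso_def)

text \<open>The equivariance squares of f and g are pasted along the structure map of the middle
  object; functoriality of \<open>F n\<close> identifies the outer edge.\<close>

lemma is_category_equivariant_cat:
  assumes C: "is_category C" and F: "\<And>n. n \<in> carrier N \<Longrightarrow> is_functor C C (F n)"
  shows "is_category (equivariant_cat N C F)"
  unfolding is_category_def
proof (intro conjI ballI)
  note ob = equivariant_objD(1) and st = equivariant_objD(2)
  fix X assume X: "X \<in> Obj (equivariant_cat N C F)"
  then show "Ide (equivariant_cat N C F) X \<in> Arr (equivariant_cat N C F) X X"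
    using category_ide[OF C ob[OF X]] category_ide_right[OF C ob[OF X] _ st[OF X]]
      category_ide_left[OF C ob[OF X] _ st[OF X]] functor_ide[OF F ob[OF X]]
      functor_ob[OF F ob[OF X]] by simp
  fix Y assume Y: "Y \<in> Obj (equivariant_cat N C F)"
  {
    fix f assume "f \<in> Arr (equivariant_cat N C F) X Y"
    then show "Cmp (equivariant_cat N C F) X X Y f (Ide (equivariant_cat N C F) X) = f"
      "Cmp (equivariant_cat N C F) X Y Y (Ide (equivariant_cat N C F) Y) f = f"
      using category_ide_right[OF C ob[OF X] ob[OF Y]] category_ide_left[OF C ob[OF X] ob[OF Y]]
      by simp_all
  }
  fix Z assume Z: "Z \<in> Obj (equivariant_cat N C F)"
  {
    fix f g assume f: "f \<in> Arr (equivariant_cat N C F) X Y" and g: "g \<in> Arr (equivariant_cat N C F) Y Z"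
    obtain x \<alpha> y \<beta> z \<gamma> where [simp]: "X = (x,\<alpha>)" "Y = (y,\<beta>)" "Z = (z,\<gamma>)" by fastforce
    have x: "x \<in> Obj C" and y: "y \<in> Obj C" and z: "z \<in> Obj C" using ob[OF X] ob[OF Y] ob[OF Z] by auto
    have fa: "f \<in> Arr C x y" and ga: "g \<in> Arr C y z" using f g by auto
    have "Cmp C x z (fob (F n) z) (\<gamma> n) (Cmp C x y z g f) =
          Cmp C x (fob (F n) x) (fob (F n) z) (far (F n) x z (Cmp C x y z g f)) (\<alpha> n)"
      if n: "n \<in> carrier N" for n
    proof -
      note Fn = F[OF n]
      have Fx: "fob (F n) x \<in> Obj C" "fob (F n) y \<in> Obj C" "fob (F n) z \<in> Obj C"
        using x y z by (auto intro: functor_ob[OF Fn])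
      have a: "\<alpha> n \<in> Arr C x (fob (F n) x)" "\<beta> n \<in> Arr C y (fob (F n) y)" "\<gamma> n \<in> Arr C z (fob (F n) z)"
        using st[OF X n] st[OF Y n] st[OF Z n] by auto
      have Ff: "far (F n) x y f \<in> Arr C (fob (F n) x) (fob (F n) y)"
        "far (F n) y z g \<in> Arr C (fob (F n) y) (fob (F n) z)"
        using functor_ar[OF Fn x y fa] functor_ar[OF Fn y z ga] by auto
      have "Cmp C x z (fob (F n) z) (\<gamma> n) (Cmp C x y z g f) =
         Cmp C x y (fob (F n) z) (Cmp C y z (fob (F n) z) (\<gamma> n) g) f"
        by (rule category_assoc[OF C x y z Fx(3) fa ga a(3)])
      also have "\<dots> = Cmp C x y (fob (F n) z) (Cmp C y (fob (F n) y) (fob (F n) z) (far (F n) y z g) (\<beta> n)) f"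
        using g n by simp
      also have "\<dots> = Cmp C x (fob (F n) y) (fob (F n) z) (far (F n) y z g) (Cmp C x y (fob (F n) y) (\<beta> n) f)"
        by (rule category_assoc[OF C x y Fx(2) Fx(3) fa a(2) Ff(2), symmetric])
      also have "\<dots> = Cmp C x (fob (F n) y) (fob (F n) z) (far (F n) y z g)
          (Cmp C x (fob (F n) x) (fob (F n) y) (far (F n) x y f) (\<alpha> n))"
        using f n by simp
      also have "\<dots> = Cmp C x (fob (F n) x) (fob (F n) z)
          (Cmp C (fob (F n) x) (fob (F n) y) (fob (F n) z) (far (F n) y z g) (far (F n) x y f)) (\<alpha> n)"
        by (rule category_assoc[OF C x Fx(1) Fx(2) Fx(3) a(1) Ff])
      finally show ?thesis using functor_cmp[OF Fn x y z fa ga] by simp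
    qed
    then show "Cmp (equivariant_cat N C F) X Y Z g f \<in> Arr (equivariant_cat N C F) X Z"
      using category_cmp[OF C x y z fa ga] by simp
  }
  fix W f g h assume W: "W \<in> Obj (equivariant_cat N C F)"
    "f \<in> Arr (equivariant_cat N C F) X Y" "g \<in> Arr (equivariant_cat N C F) Y Z"
    "h \<in> Arr (equivariant_cat N C F) Z W"
  then show "Cmp (equivariant_cat N C F) X Z W h (Cmp (equivariant_cat N C F) X Y Z g f) =
     Cmp (equivariant_cat N C F) X Y W (Cmp (equivariant_cat N C F) Y Z W h g) f"
    using category_assoc[OF C ob[OF X] ob[OF Y] ob[OF Z] ob[OF W(1)]] by simp
qed

text \<open>The inverse of the underlying morphism is automatically equivariant: inserting \<theta>
  \<psi> = id before \<open>\<beta> n\<close>, applying the square of \<theta> and cancelling the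
  images of \<psi> and \<theta> under \<open>F n\<close> yields the square of \<psi>.\<close>

lemma is_iso_equivariant:
  assumes C: "is_category C" and F: "\<And>n. n \<in> carrier N \<Longrightarrow> is_functor C C (F n)"
    and X: "X \<in> Obj (equivariant_cat N C F)" and Y: "Y \<in> Obj (equivariant_cat N C F)"
    and \<theta>: "\<theta> \<in> Arr (equivariant_cat N C F) X Y" and iso: "is_iso C (fst X) (fst Y) \<theta>"
  shows "is_iso (equivariant_cat N C F) X Y \<theta>"
proof -
  obtain x \<alpha> y \<beta> where [simp]: "X = (x,\<alpha>)" "Y = (y,\<beta>)" by fastforce
  have x: "x \<in> Obj C" and y: "y \<in> Obj C" using equivariant_objD(1)[OF X] equivariant_objD(1)[OF Y] by auto
  obtain \<psi> where \<psi>: "\<psi> \<in> Arr C y x" and l: "Cmp C x y x \<psi> \<theta> = Ide C x" and r: "Cmp C y x y \<theta> \<psi> = Ide C y"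
    using iso unfolding is_iso_def by auto
  have \<theta>': "\<theta> \<in> Arr C x y" using \<theta> by simp
  have "Cmp C y x (fob (F n) x) (\<alpha> n) \<psi> = Cmp C y (fob (F n) y) (fob (F n) x) (far (F n) y x \<psi>) (\<beta> n)"
    if n: "n \<in> carrier N" for n
  proof -
    note Fn = F[OF n]
    have Fx: "fob (F n) x \<in> Obj C" "fob (F n) y \<in> Obj C"
      using x y by (auto intro: functor_ob[OF Fn])
    have a: "\<alpha> n \<in> Arr C x (fob (F n) x)" "\<beta> n \<in> Arr C y (fob (F n) y)"
      using equivariant_objD(2)[OF X n] equivariant_objD(2)[OF Y n] by auto
    have Fp: "far (F n) y x \<psi> \<in> Arr C (fob (F n) y) (fob (F n) x)"
      "far (F n) x y \<theta> \<in> Arr C (fob (F n) x) (fob (F n) y)"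
      using functor_ar[OF Fn y x \<psi>] functor_ar[OF Fn x y \<theta>'] by auto
    have ap: "Cmp C y x (fob (F n) x) (\<alpha> n) \<psi> \<in> Arr C y (fob (F n) x)"
      by (rule category_cmp[OF C y x Fx(1) \<psi> a(1)])
    have "Cmp C y (fob (F n) y) (fob (F n) x) (far (F n) y x \<psi>) (\<beta> n) =
       Cmp C y (fob (F n) y) (fob (F n) x) (far (F n) y x \<psi>) (Cmp C y y (fob (F n) y) (\<beta> n) (Cmp C y x y \<theta> \<psi>))"
      using category_ide_right[OF C y Fx(2) a(2)] by (simp add: r)
    also have "Cmp C y y (fob (F n) y) (\<beta> n) (Cmp C y x y \<theta> \<psi>) = 
        Cmp C y x (fob (F n) y) (Cmp C x y (fob (F n) y) (\<beta> n) \<theta>) \<psi>"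
      by (rule category_assoc[OF C y x y Fx(2) \<psi> \<theta>' a(2)])
    also have "Cmp C x y (fob (F n) y) (\<beta> n) \<theta> = Cmp C x (fob (F n) x) (fob (F n) y) (far (F n) x y \<theta>) (\<alpha> n)"
      using \<theta> n by simp
    also have "Cmp C y x (fob (F n) y) (Cmp C x (fob (F n) x) (fob (F n) y) (far (F n) x y \<theta>) (\<alpha> n)) \<psi>
       = Cmp C y (fob (F n) x) (fob (F n) y) (far (F n) x y \<theta>) (Cmp C y x (fob (F n) x) (\<alpha> n) \<psi>)"
      by (rule category_assoc[OF C y x Fx(1) Fx(2) \<psi> a(1) Fp(2), symmetric])
    also have "Cmp C y (fob (F n) y) (fob (F n) x) (far (F n) y x \<psi>) \<dots> =
       Cmp C y (fob (F n) x) (fob (F n) x) (Cmp C (fob (F n) x) (fob (F n) y) (fob (F n) x) (far (F n) y x \<psi>)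
          (far (F n) x y \<theta>)) (Cmp C y x (fob (F n) x) (\<alpha> n) \<psi>)"
      by (rule category_assoc[OF C y Fx(1) Fx(2) Fx(1) ap Fp(2) Fp(1)])
    also have "Cmp C (fob (F n) x) (fob (F n) y) (fob (F n) x) (far (F n) y x \<psi>) (far (F n) x y \<theta>) = Ide C (fob (F n) x)"
      using functor_cmp[OF Fn x y x \<theta>' \<psi>] functor_ide[OF Fn x] by (simp add: l)
    also have "Cmp C y (fob (F n) x) (fob (F n) x) \<dots> (Cmp C y x (fob (F n) x) (\<alpha> n) \<psi>) = Cmp C y x (fob (F n) x) (\<alpha> n) \<psi>"
      by (rule category_ide_left[OF C y Fx(1) ap])
    finally show ?thesis by simp
  qed
  then show ?thesis
    unfolding is_iso_def using \<theta> \<psi> l r by (auto intro!: bexI[of _ \<psi>])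
qed

section \<open>Homogeneous components and the pushforward grading\<close>

locale grading = G: group G + R: ring R
  for G :: "('g, 'z) monoid_scheme" (structure) and R :: "('r, 'w) ring_scheme" +
  fixes A :: "'g \<Rightarrow> 'r set"
  assumes graded: "graded_ring G R A"
begin

lemma A_subset: "g \<in> carrier G \<Longrightarrow> r \<in> A g \<Longrightarrow> r \<in> carrier R"
  using additive_subgroup.a_subset[OF graded_ring.A_subgroup[OF graded]] by blast

lemma A_zero: "g \<in> carrier G \<Longrightarrow> \<zero>\<^bsub>R\<^esub> \<in> A g"
  using additive_subgroup.zero_closed[OF graded_ring.A_subgroup[OF graded]] by blast

lemma A_add: "\<lbrakk>g \<in> carrier G; r \<in> A g; s \<in> A g\<rbrakk> \<Longrightarrow> r \<oplus>\<^bsub>R\<^esub> s \<in> A g"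
  using additive_subgroup.a_closed[OF graded_ring.A_subgroup[OF graded]] by blast

lemma A_minus: "\<lbrakk>g \<in> carrier G; r \<in> A g\<rbrakk> \<Longrightarrow> \<ominus>\<^bsub>R\<^esub> r \<in> A g"
  using additive_subgroup.a_inv_closed[OF graded_ring.A_subgroup[OF graded]] R.abelian_group_axioms
  by blast

lemmas A_mult = graded_ring.A_mult[OF graded]

lemma A_finsum:
  assumes "g \<in> carrier G" "\<And>i. i \<in> S \<Longrightarrow> f i \<in> A g"
  shows "finsum R f S \<in> A g"
  using assms(2)
proof (induction S rule: infinite_finite_induct)
  case (insert x F)
  then have "finsum R f (insert x F) = f x \<oplus>\<^bsub>R\<^esub> finsum R f F"
    using assms(1) by (intro R.finsum_insert) (auto intro: A_subset)
  then show ?case using insert assms(1) by (simp add: A_add)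
qed (auto simp: A_zero assms(1))

definition component :: "'r \<Rightarrow> 'g \<Rightarrow> 'r" where
  "component r = (THE c. c \<in> (\<Pi>\<^sub>E g\<in>carrier G. A g) \<and> finite {g \<in> carrier G. c g \<noteq> \<zero>\<^bsub>R\<^esub>} \<and>
           r = (\<Oplus>\<^bsub>R\<^esub>g\<in>{g \<in> carrier G. c g \<noteq> \<zero>\<^bsub>R\<^esub>}. c g))"

definition support :: "'r \<Rightarrow> 'g set" where
  "support r = {g \<in> carrier G. component r g \<noteq> \<zero>\<^bsub>R\<^esub>}"

lemma component_theI:
  assumes "r \<in> carrier R"
  shows "component r \<in> (\<Pi>\<^sub>E g\<in>carrier G. A g) \<and> finite (support r) \<and>
    r = (\<Oplus>\<^bsub>R\<^esub>g\<in>support r. component r g)"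
  unfolding component_def support_def by (rule theI'[OF graded_ring.A_direct_sum[OF graded assms]])

lemma component_in: "r \<in> carrier R \<Longrightarrow> g \<in> carrier G \<Longrightarrow> component r g \<in> A g"
  using component_theI by blast

lemma component_closed: "r \<in> carrier R \<Longrightarrow> g \<in> carrier G \<Longrightarrow> component r g \<in> carrier R"
  using component_in A_subset by blast

lemma finite_support: "r \<in> carrier R \<Longrightarrow> finite (support r)"
  using component_theI by blast

lemma component_sum_support: "r \<in> carrier R \<Longrightarrow> (\<Oplus>\<^bsub>R\<^esub>g\<in>support r. component r g) = r"
  using component_theI by (metis (no_types, lifting))

lemma support_subset: "support r \<subseteq> carrier G"
  by (auto simp: support_def)

lemma component_sum:
  assumes "r \<in> carrier R" "finite S" "support r \<subseteq> S" "S \<subseteq> carrier G"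
  shows "(\<Oplus>\<^bsub>R\<^esub>g\<in>S. component r g) = r"
proof -
  have "(\<Oplus>\<^bsub>R\<^esub>g\<in>support r. component r g) = (\<Oplus>\<^bsub>R\<^esub>g\<in>S. component r g)"
    using assms by (intro R.add.finprod_mono_neutral_cong_left) (auto simp: support_def component_closed)
  then show ?thesis using component_sum_support[OF assms(1)] by simp
qed

text \<open>The family c, extended by zero outside S, satisfies the condition in
  \<open>A_direct_sum\<close>, so uniqueness there identifies it with
  \<open>component\<close>.\<close>

lemma component_unique:
  assumes S: "finite S" "S \<subseteq> carrier G" and c: "\<And>g. g \<in> S \<Longrightarrow> c g \<in> A g" and g: "g \<in> carrier G"
  shows "component (\<Oplus>\<^bsub>R\<^esub>g\<in>S. c g) g = (if g \<in> S then c g else \<zero>\<^bsub>R\<^esub>)"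
proof -
  let ?d = "\<lambda>g\<in>carrier G. if g \<in> S then c g else \<zero>\<^bsub>R\<^esub>"
  let ?r = "\<Oplus>\<^bsub>R\<^esub>g\<in>S. c g"
  have cR: "\<And>g. g \<in> S \<Longrightarrow> c g \<in> carrier R" using c S A_subset by blast
  then have r: "?r \<in> carrier R" by (intro R.finsum_closed) auto
  have sub: "{g \<in> carrier G. ?d g \<noteq> \<zero>\<^bsub>R\<^esub>} \<subseteq> S" by auto
  have "?d \<in> (\<Pi>\<^sub>E g\<in>carrier G. A g)" using c by (auto simp: A_zero)
  moreover have "finite {g \<in> carrier G. ?d g \<noteq> \<zero>\<^bsub>R\<^esub>}" using finite_subset[OF sub S(1)] .
  moreover have "?r = (\<Oplus>\<^bsub>R\<^esub>g\<in>{g \<in> carrier G. ?d g \<noteq> \<zero>\<^bsub>R\<^esub>}. ?d g)"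
    using S cR sub by (intro R.add.finprod_mono_neutral_cong_right) auto
  ultimately have "component ?r = ?d"
    using component_theI[OF r] graded_ring.A_direct_sum[OF graded r] unfolding support_def
    by blast
  then show ?thesis using g by simp
qed

lemma component_homogeneous:
  assumes "g \<in> carrier G" "r \<in> A g" "k \<in> carrier G"
  shows "component r k = (if k = g then r else \<zero>\<^bsub>R\<^esub>)"
  using component_unique[of "{g}" "\<lambda>_. r" k] assms A_subset[OF assms(1,2)]
  by (simp add: R.add.finprod_insert)

lemma component_add:
  assumes r: "r \<in> carrier R" and s: "s \<in> carrier R" and g: "g \<in> carrier G"
  shows "component (r \<oplus>\<^bsub>R\<^esub> s) g = component r g \<oplus>\<^bsub>R\<^esub> component s g"
proof -
  let ?S = "support r \<union> support s"
  have S: "finite ?S" "?S \<subseteq> carrier G" using r s finite_support support_subset by auto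
  have cl: "component r \<in> ?S \<rightarrow> carrier R" "component s \<in> ?S \<rightarrow> carrier R"
    using S r s component_closed by auto
  have "r \<oplus>\<^bsub>R\<^esub> s = (\<Oplus>\<^bsub>R\<^esub>g\<in>?S. component r g) \<oplus>\<^bsub>R\<^esub> (\<Oplus>\<^bsub>R\<^esub>g\<in>?S. component s g)"
    using S r s by (simp add: component_sum)
  also have "\<dots> = (\<Oplus>\<^bsub>R\<^esub>g\<in>?S. component r g \<oplus>\<^bsub>R\<^esub> component s g)"
    using R.finsum_addf[OF cl] by simp
  finally have rs: "r \<oplus>\<^bsub>R\<^esub> s = (\<Oplus>\<^bsub>R\<^esub>g\<in>?S. component r g \<oplus>\<^bsub>R\<^esub> component s g)" .
  have "component (r \<oplus>\<^bsub>R\<^esub> s) g =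
      (if g \<in> ?S then component r g \<oplus>\<^bsub>R\<^esub> component s g else \<zero>\<^bsub>R\<^esub>)"
    unfolding rs using r s S g by (intro component_unique A_add component_in) auto
  then show ?thesis using g by (auto simp: support_def)
qed

lemma component_zero: "g \<in> carrier G \<Longrightarrow> component \<zero>\<^bsub>R\<^esub> g = \<zero>\<^bsub>R\<^esub>"
  using component_homogeneous[OF _ A_zero] by simp

lemma component_minus:
  assumes r: "r \<in> carrier R" and g: "g \<in> carrier G"
  shows "component (\<ominus>\<^bsub>R\<^esub> r) g = \<ominus>\<^bsub>R\<^esub> component r g"
proof -
  have "component (\<ominus>\<^bsub>R\<^esub> r) g \<oplus>\<^bsub>R\<^esub> component r g = \<zero>\<^bsub>R\<^esub>"
    using component_add[of "\<ominus>\<^bsub>R\<^esub> r" r g] r g by (simp add: R.l_neg component_zero)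
  then show ?thesis using r g by (simp add: R.minus_equality component_closed)
qed

lemma component_finsum:
  assumes "\<And>i. i \<in> S \<Longrightarrow> f i \<in> carrier R" and g: "g \<in> carrier G"
  shows "component (finsum R f S) g = (\<Oplus>\<^bsub>R\<^esub>i\<in>S. component (f i) g)"
  using assms(1)
proof (induction S rule: infinite_finite_induct)
  case (insert x F)
  then have "f \<in> F \<rightarrow> carrier R" "f x \<in> carrier R"
    "(\<lambda>i. component (f i) g) \<in> F \<rightarrow> carrier R"
    using g component_closed by auto
  then show ?case using insert g
    by (simp add: R.finsum_insert component_add component_closed R.finsum_closed)
qed (simp_all add: component_zero g)

lemma component_inject:
  assumes "r \<in> carrier R" "s \<in> carrier R" "\<And>g. g \<in> carrier G \<Longrightarrow> component r g = component s g"
  shows "r = s"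
proof -
  let ?S = "support r \<union> support s"
  have S: "finite ?S" "?S \<subseteq> carrier G" using assms finite_support support_subset by auto
  have "r = (\<Oplus>\<^bsub>R\<^esub>g\<in>?S. component r g)" using S assms(1) by (simp add: component_sum)
  also have "\<dots> = (\<Oplus>\<^bsub>R\<^esub>g\<in>?S. component s g)"
    using S assms component_closed by (intro R.add.finprod_cong') auto
  also have "\<dots> = s" using S assms(2) by (simp add: component_sum)
  finally show ?thesis .
qed

text \<open>The grading axioms do not place the unit in degree one. Write 1 as the sum of its
  components e_g. For r of degree k, comparing components of degree k in r = r 1 gives r = r e_1.
  Applying this to every r = e_g and summing gives e_1 = 1.\<close>

lemma one_homogeneous: "\<one>\<^bsub>R\<^esub> \<in> A \<one>"
proof -
  \<comment> \<open>The unit degree is added to the support so that k itself occurs among the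
    translated degrees k g, even if the component of 1 there were zero.\<close>
  let ?e = "component \<one>\<^bsub>R\<^esub>" and ?S = "insert \<one> (support \<one>\<^bsub>R\<^esub>)"
  have S: "finite ?S" "?S \<subseteq> carrier G" using finite_support support_subset by auto
  have e: "?e g \<in> A g" if "g \<in> carrier G" for g using that by (simp add: component_in)
  have hom: "r \<otimes>\<^bsub>R\<^esub> ?e \<one> = r" if k: "k \<in> carrier G" and r: "r \<in> A k" for k r
  proof -
    have rR: "r \<in> carrier R" using A_subset[OF k r] .
    let ?c = "\<lambda>g. r \<otimes>\<^bsub>R\<^esub> ?e (inv k \<otimes> g)"
    have im: "(\<lambda>g. k \<otimes> g) ` ?S \<subseteq> carrier G" using S k by auto
    have c: "?c g \<in> A g" if "g \<in> carrier G" for g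
      using A_mult[OF k _ r e, of "inv k \<otimes> g"] k that
      by (simp add: G.m_assoc[symmetric])
    have cancel: "inv k \<otimes> (k \<otimes> g) = g" if "g \<in> carrier G" for g
      using k that by (simp add: G.m_assoc[symmetric])
    have inj: "inj_on (\<lambda>g. k \<otimes> g) ?S"
      using S k by (intro inj_on_subset[OF G.inj_on_cmult]) auto
    have "r = r \<otimes>\<^bsub>R\<^esub> (\<Oplus>\<^bsub>R\<^esub>g\<in>?S. ?e g)"
      using S rR by (subst component_sum) auto
    also have "\<dots> = (\<Oplus>\<^bsub>R\<^esub>g\<in>?S. r \<otimes>\<^bsub>R\<^esub> ?e g)"
      using S rR component_closed by (intro R.finsum_rdistr) auto
    also have "\<dots> = (\<Oplus>\<^bsub>R\<^esub>g\<in>?S. ?c (k \<otimes> g))"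
      using S rR component_closed by (intro R.add.finprod_cong') (auto simp: cancel)
    also have "\<dots> = (\<Oplus>\<^bsub>R\<^esub>g\<in>(\<lambda>g. k \<otimes> g) ` ?S. ?c g)"
    proof (rule R.add.finprod_reindex[symmetric])
      show "?c \<in> (\<lambda>g. k \<otimes> g) ` ?S \<rightarrow> carrier R"
        using im c A_subset by blast
    qed (rule inj)
    finally have "component r k = ?c k"
      using component_unique[of "(\<lambda>g. k \<otimes> g) ` ?S" ?c k] S im c k
      by (auto simp: image_iff)
    then show ?thesis using component_homogeneous[OF k r k] k by simp
  qed
  have e1: "?e \<one> \<in> carrier R" by (simp add: component_closed)
  have "\<one>\<^bsub>R\<^esub> \<otimes>\<^bsub>R\<^esub> ?e \<one> = (\<Oplus>\<^bsub>R\<^esub>g\<in>?S. ?e g) \<otimes>\<^bsub>R\<^esub> ?e \<one>"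
    using S by (subst component_sum) auto
  also have "\<dots> = (\<Oplus>\<^bsub>R\<^esub>g\<in>?S. ?e g \<otimes>\<^bsub>R\<^esub> ?e \<one>)"
    using S e1 component_closed by (intro R.finsum_ldistr) auto
  also have "\<dots> = (\<Oplus>\<^bsub>R\<^esub>g\<in>?S. ?e g)"
    using S hom[OF _ e] component_closed by (intro R.add.finprod_cong') auto
  also have "\<dots> = \<one>\<^bsub>R\<^esub>" using S by (subst component_sum) auto
  finally show ?thesis using e[of "\<one>"] e1 by simp
qed

end

section \<open>The pushforward grading along a homomorphism\<close>

locale grading_hom = grading G R A + H: group H
  for G :: "('g, 'z) monoid_scheme" (structure) and R :: "('r, 'w) ring_scheme" and A
    and H :: "('h, 'y) monoid_scheme" +
  fixes \<pi> :: "'g \<Rightarrow> 'h"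
  assumes hom: "\<pi> \<in> hom G H"
begin

abbreviation B :: "'h \<Rightarrow> 'r set" where "B \<equiv> pushforward_grading G R A \<pi>"

lemma \<pi>_closed: "g \<in> carrier G \<Longrightarrow> \<pi> g \<in> carrier H"
  using hom by (auto simp: hom_def)

lemma \<pi>_mult: "g \<in> carrier G \<Longrightarrow> k \<in> carrier G \<Longrightarrow> \<pi> (g \<otimes> k) = \<pi> g \<otimes>\<^bsub>H\<^esub> \<pi> k"
  using hom by (auto simp: hom_def)

lemma group_hom: "group_hom G H \<pi>"
  using hom by (simp add: group_hom_def group_hom_axioms_def G.group_axioms H.group_axioms)

lemma \<pi>_one: "\<pi> \<one> = \<one>\<^bsub>H\<^esub>"
  using group_hom.hom_one[OF group_hom] .

lemma \<pi>_inv: "g \<in> carrier G \<Longrightarrow> \<pi> (inv g) = inv\<^bsub>H\<^esub> \<pi> g"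
  using group_hom.hom_inv[OF group_hom] .

lemma B_subset: "r \<in> B h \<Longrightarrow> r \<in> carrier R"
  unfolding pushforward_grading_def by clarify (rule R.finsum_closed, use A_subset in blast)

lemma component_B:
  assumes "r \<in> B h" "g \<in> carrier G" "\<pi> g \<noteq> h"
  shows "component r g = \<zero>\<^bsub>R\<^esub>"
proof -
  obtain S c where "r = (\<Oplus>\<^bsub>R\<^esub>g\<in>S. c g)" "finite S" "S \<subseteq> {g \<in> carrier G. \<pi> g = h}" "c \<in> (\<Pi> g\<in>S. A g)"
    using assms(1) unfolding pushforward_grading_def by blast
  moreover from this have "S \<subseteq> carrier G" "\<And>g. g \<in> S \<Longrightarrow> c g \<in> A g" by auto
  ultimately show ?thesis using component_unique[of S c g] assms by auto
qed

lemma support_B: "r \<in> B k \<Longrightarrow> support r \<subseteq> {g \<in> carrier G. \<pi> g = k}"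
  using component_B by (auto simp: support_def)

text \<open>Membership becomes a linear condition on components, from which the closure properties
  of \<open>B h\<close> are immediate.\<close>

lemma B_iff: "r \<in> B h \<longleftrightarrow> r \<in> carrier R \<and> (\<forall>g\<in>carrier G. \<pi> g \<noteq> h \<longrightarrow> component r g = \<zero>\<^bsub>R\<^esub>)"
proof
  assume *: "r \<in> carrier R \<and> (\<forall>g\<in>carrier G. \<pi> g \<noteq> h \<longrightarrow> component r g = \<zero>\<^bsub>R\<^esub>)"
  then have r: "r \<in> carrier R" by blast
  have "r = (\<Oplus>\<^bsub>R\<^esub>g\<in>support r. component r g)"
    using component_sum_support[OF r] by (rule sym)
  moreover have "support r \<subseteq> {g \<in> carrier G. \<pi> g = h}" using * by (auto simp: support_def)
  moreover have "finite (support r)" by (rule finite_support[OF r])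
  moreover have "component r \<in> (\<Pi> g\<in>support r. A g)"
    using support_subset component_in[OF r] by auto
  ultimately show "r \<in> B h" unfolding pushforward_grading_def by blast
qed (use B_subset component_B in auto)

lemma A_sub_B: "g \<in> carrier G \<Longrightarrow> r \<in> A g \<Longrightarrow> r \<in> B (\<pi> g)"
  by (auto simp: B_iff component_homogeneous dest: A_subset)

lemma B_zero: "\<zero>\<^bsub>R\<^esub> \<in> B h"
  by (simp add: B_iff component_zero)

lemma B_add: "r \<in> B h \<Longrightarrow> s \<in> B h \<Longrightarrow> r \<oplus>\<^bsub>R\<^esub> s \<in> B h"
  by (simp add: B_iff component_add)

lemma B_minus: "r \<in> B h \<Longrightarrow> \<ominus>\<^bsub>R\<^esub> r \<in> B h"
  by (simp add: B_iff component_minus)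

text \<open>The principle behind all later arguments over the pushforward ring: a property that
  holds at zero and is preserved by sums needs to be checked only for the elements of the pieces
  \<open>A g\<close> with \<pi> g = h.\<close>

lemma B_induct [consumes 1, case_names zero homogeneous add]:
  assumes "r \<in> B h" and zero: "P \<zero>\<^bsub>R\<^esub>"
    and hom: "\<And>g r. g \<in> carrier G \<Longrightarrow> \<pi> g = h \<Longrightarrow> r \<in> A g \<Longrightarrow> P r"
    and add: "\<And>r s. r \<in> B h \<Longrightarrow> s \<in> B h \<Longrightarrow> P r \<Longrightarrow> P s \<Longrightarrow> P (r \<oplus>\<^bsub>R\<^esub> s)"
  shows "P r"
proof -
  obtain S c where r: "r = (\<Oplus>\<^bsub>R\<^esub>g\<in>S. c g)" and S: "finite S" "S \<subseteq> {g \<in> carrier G. \<pi> g = h}"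
    "c \<in> (\<Pi> g\<in>S. A g)"
    using assms(1) unfolding pushforward_grading_def by blast
  from S have "(\<Oplus>\<^bsub>R\<^esub>g\<in>S. c g) \<in> B h \<and> P (\<Oplus>\<^bsub>R\<^esub>g\<in>S. c g)"
  proof (induction S rule: finite_induct)
    case (insert x F)
    then have x: "x \<in> carrier G" "\<pi> x = h" "c x \<in> A x" by auto
    have c: "c \<in> F \<rightarrow> carrier R" "c x \<in> carrier R" using insert.prems A_subset by blast+
    have xB: "c x \<in> B h" using A_sub_B x by blast
    have "(\<Oplus>\<^bsub>R\<^esub>g\<in>F. c g) \<in> B h \<and> P (\<Oplus>\<^bsub>R\<^esub>g\<in>F. c g)"
      using insert by (intro insert.IH) auto
    then show ?case
      using insert.hyps c xB hom[OF x] by (simp add: R.finsum_insert B_add add)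
  qed (simp add: B_zero zero)
  then show ?thesis using r by simp
qed

lemma B_mult:
  assumes "h \<in> carrier H" "k \<in> carrier H" and r: "r \<in> B h" and s: "s \<in> B k"
  shows "r \<otimes>\<^bsub>R\<^esub> s \<in> B (h \<otimes>\<^bsub>H\<^esub> k)"
  using r
proof (induction rule: B_induct)
  case zero
  then show ?case using B_subset[OF s] by (simp add: B_zero)
next
  case (add r r')
  then show ?case using B_subset[OF s] by (simp add: R.l_distr B_subset B_add)
next
  case (homogeneous g r)
  note rR = A_subset[OF homogeneous(1,3)]
  from s show ?case
  proof (induction rule: B_induct)
    case zero
    then show ?case using rR by (simp add: B_zero)
  next
    case (add s s')
    then show ?case using rR by (simp add: R.r_distr B_subset B_add)
  next
    case (homogeneous g' s)
    then show ?case
      using A_sub_B[OF _ A_mult, of g g' r s] \<open>g \<in> carrier G\<close> \<open>\<pi> g = h\<close> \<open>r \<in> A g\<close>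
      by (simp add: \<pi>_mult)
  qed
qed

text \<open>Every G-degree lies over a different element than h, so all components vanish. This is
  where a homomorphism that is not surjective loses information.\<close>

lemma B_eq_zero:
  assumes "h \<notin> \<pi> ` carrier G"
  shows "B h = {\<zero>\<^bsub>R\<^esub>}"
proof -
  have "r = \<zero>\<^bsub>R\<^esub>" if "r \<in> B h" for r
  proof (rule component_inject[OF B_subset[OF that] R.zero_closed])
    fix g assume g: "g \<in> carrier G"
    then show "component r g = component \<zero>\<^bsub>R\<^esub> g"
      using component_B[OF that g] assms by (auto simp: component_zero)
  qed
  then show ?thesis using B_zero by blast
qed

text \<open>For existence the G-components of r are grouped by fibres of \<pi>. For uniqueness, the
  G-components of the summand \<open>c h\<close> are forced to be those of r in the degrees over h
  and zero in the others.\<close>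

lemma graded_ring_B: "graded_ring H R B"
proof (unfold_locales)
  fix h assume h: "h \<in> carrier H"
  show "B h \<subseteq> carrier (add_monoid R)" using B_subset by auto
  show "x \<otimes>\<^bsub>add_monoid R\<^esub> y \<in> B h" if "x \<in> B h" "y \<in> B h" for x y
    using B_add[OF that] by simp
  show "\<one>\<^bsub>add_monoid R\<^esub> \<in> B h" using B_zero by simp
  show "inv\<^bsub>add_monoid R\<^esub> x \<in> B h" if "x \<in> B h" for x
    using B_minus[OF that] by (simp add: a_inv_def)
next
  fix r assume r: "r \<in> carrier R"
  let ?P = "\<lambda>c. c \<in> (\<Pi>\<^sub>E h\<in>carrier H. B h) \<and> finite {h \<in> carrier H. c h \<noteq> \<zero>\<^bsub>R\<^esub>} \<and>
     r = (\<Oplus>\<^bsub>R\<^esub>h\<in>{h \<in> carrier H. c h \<noteq> \<zero>\<^bsub>R\<^esub>}. c h)"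
  show "\<exists>!c. ?P c"
  proof (rule ex_ex1I)
    let ?c = "\<lambda>h\<in>carrier H. \<Oplus>\<^bsub>R\<^esub>g\<in>{g \<in> support r. \<pi> g = h}. component r g"
    have cl: "component r g \<in> carrier R" if "g \<in> support r" for g
      using that support_subset component_closed[OF r] by blast
    have sub: "{h \<in> carrier H. ?c h \<noteq> \<zero>\<^bsub>R\<^esub>} \<subseteq> \<pi> ` support r"
    proof
      fix h assume h: "h \<in> {h \<in> carrier H. ?c h \<noteq> \<zero>\<^bsub>R\<^esub>}"
      show "h \<in> \<pi> ` support r"
      proof (rule ccontr)
        assume "h \<notin> \<pi> ` support r"
        then have empty: "{g \<in> support r. \<pi> g = h} = {}" by auto
        have "(\<Oplus>\<^bsub>R\<^esub>g\<in>{g \<in> support r. \<pi> g = h}. component r g) = \<zero>\<^bsub>R\<^esub>"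
          unfolding empty by simp
        then show False using h by auto
      qed
    qed
    have sub': "\<pi> ` support r \<subseteq> carrier H" using support_subset[of r] \<pi>_closed by blast
    have fin: "finite (\<pi> ` support r)" using finite_support[OF r] by simp
    \<comment> \<open>The support of r is the disjoint union of its intersections with the fibres of
      \<pi>.\<close>
    have "r = (\<Oplus>\<^bsub>R\<^esub>g\<in>(\<Union>h\<in>\<pi> ` support r. {g \<in> support r. \<pi> g = h}). component r g)"
    proof -
      have "(\<Union>h\<in>\<pi> ` support r. {g \<in> support r. \<pi> g = h}) = support r" by auto
      then show ?thesis using component_sum_support[OF r] by simp
    qed
    also have "\<dots> = (\<Oplus>\<^bsub>R\<^esub>h\<in>\<pi> ` support r. \<Oplus>\<^bsub>R\<^esub>g\<in>{g \<in> support r. \<pi> g = h}. component r g)"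
      using finite_support[OF r] cl
      by (intro R.add.finprod_UN_disjoint) (auto simp: pairwise_def disjnt_def)
    also have "\<dots> = (\<Oplus>\<^bsub>R\<^esub>h\<in>{h \<in> carrier H. ?c h \<noteq> \<zero>\<^bsub>R\<^esub>}. ?c h)"
    proof (rule R.add.finprod_mono_neutral_cong_right[OF fin sub])
      show "(\<Oplus>\<^bsub>R\<^esub>g\<in>{g \<in> support r. \<pi> g = h}. component r g) = \<zero>\<^bsub>R\<^esub>"
        if "h \<in> \<pi> ` support r - {h \<in> carrier H. ?c h \<noteq> \<zero>\<^bsub>R\<^esub>}" for h
        using that sub' by auto
      show "(\<Oplus>\<^bsub>R\<^esub>g\<in>{g \<in> support r. \<pi> g = h}. component r g) = ?c h"
        if "h \<in> {h \<in> carrier H. ?c h \<noteq> \<zero>\<^bsub>R\<^esub>}" for h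
        using that by simp
    qed (auto intro!: R.finsum_closed cl)
    finally have "r = (\<Oplus>\<^bsub>R\<^esub>h\<in>{h \<in> carrier H. ?c h \<noteq> \<zero>\<^bsub>R\<^esub>}. ?c h)" .
    moreover have "finite {h \<in> carrier H. ?c h \<noteq> \<zero>\<^bsub>R\<^esub>}" by (rule finite_subset[OF sub fin])
    moreover have "?c \<in> (\<Pi>\<^sub>E h\<in>carrier H. B h)"
    proof -
      have "(\<Oplus>\<^bsub>R\<^esub>g\<in>{g \<in> support r. \<pi> g = h}. component r g) \<in> B h" for h
        unfolding pushforward_grading_def
        using finite_support[OF r] support_subset[of r] component_in[OF r]
        by (intro CollectI exI[of _ "{g \<in> support r. \<pi> g = h}"] exI[of _ "component r"]) auto
      then show ?thesis by auto
    qed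
    ultimately show "\<exists>c. ?P c" by blast
  next
    \<comment> \<open>The right-hand side does not mention c, so two decompositions have the same
      G-components in every degree and agree.\<close>
    have *: "component (c h) g = (if \<pi> g = h then component r g else \<zero>\<^bsub>R\<^esub>)"
      if c: "?P c" and h: "h \<in> carrier H" and g: "g \<in> carrier G" for c h g
    proof (cases "\<pi> g = h")
      case True
      \<comment> \<open>Inserting h guarantees a summand at h, although \<open>c h\<close> may be
        zero.\<close>
      let ?T = "insert h {h \<in> carrier H. c h \<noteq> \<zero>\<^bsub>R\<^esub>}"
      have cB: "c h \<in> B h" if "h \<in> carrier H" for h using c that by auto
      have cR: "c h \<in> carrier R" if "h \<in> carrier H" for h using B_subset[OF cB[OF that]] .
      have T: "finite ?T" "?T \<subseteq> carrier H" using c h by auto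
      have "r = (\<Oplus>\<^bsub>R\<^esub>h\<in>{h \<in> carrier H. c h \<noteq> \<zero>\<^bsub>R\<^esub>}. c h)" using c by blast
      also have "\<dots> = (\<Oplus>\<^bsub>R\<^esub>h\<in>?T. c h)"
        using T cR h by (intro R.add.finprod_mono_neutral_cong_left) auto
      finally have "component r g = component (\<Oplus>\<^bsub>R\<^esub>h\<in>?T. c h) g" by simp
      also have "\<dots> = (\<Oplus>\<^bsub>R\<^esub>k\<in>?T. component (c k) g)"
        using T cR g by (intro component_finsum) auto
      also have "\<dots> = (\<Oplus>\<^bsub>R\<^esub>k\<in>?T. if h = k then component (c k) g else \<zero>\<^bsub>R\<^esub>)"
      proof (intro R.add.finprod_cong' refl)
        fix k assume "k \<in> ?T"
        then have k: "k \<in> carrier H" using T by blast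
        show "component (c k) g = (if h = k then component (c k) g else \<zero>\<^bsub>R\<^esub>)"
          using component_B[OF cB[OF k] g] True by auto
      qed (use T cR g component_closed in auto)
      also have "\<dots> = component (c h) g"
      proof (rule R.add.finprod_singleton[OF _ T(1)])
        show "(\<lambda>k. component (c k) g) \<in> ?T \<rightarrow> carrier R"
          using T(2) cR component_closed[OF _ g] by blast
      qed simp
      finally show ?thesis using True by simp
    next
      case False
      then show ?thesis using c h g component_B[of "c h" h g] by auto
    qed
    fix c c' assume c: "?P c" and c': "?P c'"
    show "c = c'"
    proof (rule PiE_ext)
      fix h assume h: "h \<in> carrier H"
      have "c h \<in> carrier R" "c' h \<in> carrier R"
        using c c' h by (auto intro: B_subset)
      then show "c h = c' h"
        by (rule component_inject) (simp add: *[OF c h] *[OF c' h])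
    qed (fact conjunct1[OF c] conjunct1[OF c'])+
  qed
next
  fix h k r s assume "h \<in> carrier H" "k \<in> carrier H" "r \<in> B h" "s \<in> B k"
  then show "r \<otimes>\<^bsub>R\<^esub> s \<in> B (h \<otimes>\<^bsub>H\<^esub> k)" by (rule B_mult)
qed

lemma grading_B: "grading H R B"
  using graded_ring_B H.group_axioms R.ring_axioms by (simp add: grading_def grading_axioms_def)

end

section \<open>The category of graded modules and its degree shifts\<close>

lemma gmod_hom_hom: "f \<in> gmod_hom G A X Y \<Longrightarrow> g \<in> carrier G \<Longrightarrow> f g \<in> hom (hc X g) (hc Y g)"
  by (auto simp: gmod_hom_def PiE_iff)

lemma gmod_hom_extensional:
  "f \<in> gmod_hom G A X Y \<Longrightarrow> g \<in> carrier G \<Longrightarrow> f g \<in> extensional (carrier (hc X g))"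
  by (auto simp: gmod_hom_def PiE_iff)

lemma gmod_hom_closed:
  "\<lbrakk>f \<in> gmod_hom G A X Y; g \<in> carrier G; x \<in> carrier (hc X g)\<rbrakk> \<Longrightarrow> f g x \<in> carrier (hc Y g)"
  by (rule hom_in_carrier[OF gmod_hom_hom])

lemma gmod_hom_mult:
  "\<lbrakk>f \<in> gmod_hom G A X Y; g \<in> carrier G; x \<in> carrier (hc X g); y \<in> carrier (hc X g)\<rbrakk> \<Longrightarrow>
   f g (x \<otimes>\<^bsub>hc X g\<^esub> y) = f g x \<otimes>\<^bsub>hc Y g\<^esub> f g y"
  by (rule hom_mult[OF gmod_hom_hom])

lemma gmod_hom_act:
  "\<lbrakk>f \<in> gmod_hom G A X Y; g \<in> carrier G; k \<in> carrier G; x \<in> carrier (hc X g); r \<in> A k\<rbrakk> \<Longrightarrow>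
   f (g \<otimes>\<^bsub>G\<^esub> k) (act X g k x r) = act Y g k (f g x) r"
  by (auto simp: gmod_hom_def)

lemma gmod_homI:
  assumes "\<And>g x. g \<in> carrier G \<Longrightarrow> x \<in> carrier (hc X g) \<Longrightarrow> f g x \<in> carrier (hc Y g)"
    and "\<And>g x y. \<lbrakk>g \<in> carrier G; x \<in> carrier (hc X g); y \<in> carrier (hc X g)\<rbrakk> \<Longrightarrow>
      f g (x \<otimes>\<^bsub>hc X g\<^esub> y) = f g x \<otimes>\<^bsub>hc Y g\<^esub> f g y"
    and "\<And>g k x r. \<lbrakk>g \<in> carrier G; k \<in> carrier G; x \<in> carrier (hc X g); r \<in> A k\<rbrakk> \<Longrightarrow>
      f (g \<otimes>\<^bsub>G\<^esub> k) (act X g k x r) = act Y g k (f g x) r"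
    and "\<And>g. g \<in> carrier G \<Longrightarrow> f g \<in> extensional (carrier (hc X g))" and "f \<in> extensional (carrier G)"
  shows "f \<in> gmod_hom G A X Y"
  unfolding gmod_hom_def PiE_def hom_def using assms by auto

lemma gmod_hom_eqI:
  assumes f: "f \<in> gmod_hom G A X Y" and f': "f' \<in> gmod_hom G A X Z"
    and eq: "\<And>g x. g \<in> carrier G \<Longrightarrow> x \<in> carrier (hc X g) \<Longrightarrow> f g x = f' g x"
  shows "f = f'"
proof (rule extensionalityI)
  show "f \<in> extensional (carrier G)" "f' \<in> extensional (carrier G)"
    using f f' by (auto simp: gmod_hom_def PiE_iff)
  fix g assume g: "g \<in> carrier G"
  show "f g = f' g"
    by (rule extensionalityI[OF gmod_hom_extensional[OF f g] gmod_hom_extensional[OF f' g]])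
      (rule eq[OF g])
qed

lemma Mod_cat_simps [simp]:
  "Obj (Mod_cat U G R A) = {X. graded_module G R A X}"
  "Arr (Mod_cat U G R A) = gmod_hom G A"
  "Cmp (Mod_cat U G R A) X Y Z f' f = (\<lambda>g\<in>carrier G. compose (carrier (hc X g)) (f' g) (f g))"
  "Ide (Mod_cat U G R A) X = (\<lambda>g\<in>carrier G. \<lambda>x\<in>carrier (hc X g). x)"
  by (simp_all add: Mod_cat_def)

context grading
begin

lemma graded_moduleI:
  assumes "\<And>g. g \<in> carrier G \<Longrightarrow> comm_group (hc X g)"
    and "\<And>g k x r. \<lbrakk>g \<in> carrier G; k \<in> carrier G; x \<in> carrier (hc X g); r \<in> A k\<rbrakk> \<Longrightarrow>
      act X g k x r \<in> carrier (hc X (g \<otimes> k))"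
    and "\<And>g k x y r. \<lbrakk>g \<in> carrier G; k \<in> carrier G; x \<in> carrier (hc X g); y \<in> carrier (hc X g); r \<in> A k\<rbrakk> \<Longrightarrow>
      act X g k (x \<otimes>\<^bsub>hc X g\<^esub> y) r = act X g k x r \<otimes>\<^bsub>hc X (g \<otimes> k)\<^esub> act X g k y r"
    and "\<And>g k x r s. \<lbrakk>g \<in> carrier G; k \<in> carrier G; x \<in> carrier (hc X g); r \<in> A k; s \<in> A k\<rbrakk> \<Longrightarrow>
      act X g k x (r \<oplus>\<^bsub>R\<^esub> s) = act X g k x r \<otimes>\<^bsub>hc X (g \<otimes> k)\<^esub> act X g k x s"
    and "\<And>g x. \<lbrakk>g \<in> carrier G; x \<in> carrier (hc X g)\<rbrakk> \<Longrightarrow> act X g \<one> x \<one>\<^bsub>R\<^esub> = x"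
    and "\<And>g k l x r s. \<lbrakk>g \<in> carrier G; k \<in> carrier G; l \<in> carrier G; x \<in> carrier (hc X g); r \<in> A k; s \<in> A l\<rbrakk> \<Longrightarrow>
      act X (g \<otimes> k) l (act X g k x r) s = act X g (k \<otimes> l) x (r \<otimes>\<^bsub>R\<^esub> s)"
    and "hc X \<in> extensional (carrier G)"
    and "\<And>g k x r. \<not> (g \<in> carrier G \<and> k \<in> carrier G \<and> x \<in> carrier (hc X g) \<and> r \<in> A k) \<Longrightarrow>
      act X g k x r = undefined"
  shows "graded_module G R A X"
  by (intro graded_module.intro[OF graded] graded_module_axioms.intro) (fact assms)+

context
  fixes X :: "('g, 'm, 'r) gmod" assumes X: "graded_module G R A X"
begin

lemma hc_comm_group: "g \<in> carrier G \<Longrightarrow> comm_group (hc X g)"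
  using graded_module.hc_comm_group[OF X] .

lemma hc_group: "g \<in> carrier G \<Longrightarrow> group (hc X g)"
  using hc_comm_group comm_group.axioms(2) by blast

lemma hc_comm_monoid: "g \<in> carrier G \<Longrightarrow> comm_monoid (hc X g)"
  using hc_comm_group comm_group.axioms(1) by blast

lemma hc_monoid: "g \<in> carrier G \<Longrightarrow> monoid (hc X g)"
  using hc_comm_monoid comm_monoid.axioms(1) by blast

lemma hc_one: "g \<in> carrier G \<Longrightarrow> \<one>\<^bsub>hc X g\<^esub> \<in> carrier (hc X g)"
  using monoid.one_closed[OF hc_monoid] .

lemma hc_mult: "\<lbrakk>g \<in> carrier G; x \<in> carrier (hc X g); y \<in> carrier (hc X g)\<rbrakk> \<Longrightarrow>
   x \<otimes>\<^bsub>hc X g\<^esub> y \<in> carrier (hc X g)"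
  using monoid.m_closed[OF hc_monoid] .

lemmas act_closed = graded_module.act_closed[OF X]
  and act_add_left = graded_module.act_add_left[OF X]
  and act_add_right = graded_module.act_add_right[OF X]
  and act_one = graded_module.act_one[OF X]
  and act_mult = graded_module.act_mult[OF X]
  and act_ext = graded_module.act_ext[OF X]
  and hc_ext = graded_module.hc_ext[OF X]

lemma act_zero:
  assumes g: "g \<in> carrier G" and k: "k \<in> carrier G" and x: "x \<in> carrier (hc X g)"
  shows "act X g k x \<zero>\<^bsub>R\<^esub> = \<one>\<^bsub>hc X (g \<otimes> k)\<^esub>"
proof -
  interpret gk: group "hc X (g \<otimes> k)" using hc_group g k by simp
  note a = act_closed[OF g k x A_zero[OF k]]
  have "act X g k x \<zero>\<^bsub>R\<^esub> \<otimes>\<^bsub>hc X (g \<otimes> k)\<^esub> act X g k x \<zero>\<^bsub>R\<^esub> = act X g k x \<zero>\<^bsub>R\<^esub>"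
    using act_add_right[OF g k x A_zero[OF k] A_zero[OF k]] by simp
  then show ?thesis using a gk.l_cancel_one' by metis
qed

lemma act_one_left:
  assumes g: "g \<in> carrier G" and k: "k \<in> carrier G" and r: "r \<in> A k"
  shows "act X g k \<one>\<^bsub>hc X g\<^esub> r = \<one>\<^bsub>hc X (g \<otimes> k)\<^esub>"
proof -
  interpret gk: group "hc X (g \<otimes> k)" using hc_group g k by simp
  interpret g: group "hc X g" using hc_group g by simp
  note a = act_closed[OF g k g.one_closed r]
  have "act X g k \<one>\<^bsub>hc X g\<^esub> r \<otimes>\<^bsub>hc X (g \<otimes> k)\<^esub> act X g k \<one>\<^bsub>hc X g\<^esub> r = act X g k \<one>\<^bsub>hc X g\<^esub> r"
    using act_add_left[OF g k g.one_closed g.one_closed r] by simp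
  then show ?thesis using a gk.l_cancel_one' by metis
qed

end

lemma gmod_hom_one:
  assumes X: "graded_module G R A X" and Y: "graded_module G R A Y"
    and f: "f \<in> gmod_hom G A X Y" and g: "g \<in> carrier G"
  shows "f g \<one>\<^bsub>hc X g\<^esub> = \<one>\<^bsub>hc Y g\<^esub>"
  using hom_one[OF gmod_hom_hom[OF f g] hc_group[OF X g] hc_group[OF Y g]] .

lemma gmod_hom_ide: "graded_module G R A X \<Longrightarrow>
  (\<lambda>g\<in>carrier G. \<lambda>x\<in>carrier (hc X g). x) \<in> gmod_hom G A X X"
  by (rule gmod_homI) (auto simp: hc_mult act_closed)

lemma gmod_hom_compose:
  assumes X: "graded_module G R A X" and f: "f \<in> gmod_hom G A X Y" and f': "f' \<in> gmod_hom G A Y Z"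
  shows "(\<lambda>g\<in>carrier G. compose (carrier (hc X g)) (f' g) (f g)) \<in> gmod_hom G A X Z"
  using X f f'
  by (intro gmod_homI)
    (auto simp: compose_def hc_mult act_closed gmod_hom_closed gmod_hom_mult gmod_hom_act)

lemma is_category_Mod_cat: "is_category (Mod_cat TYPE('m) G R A)"
  unfolding is_category_def
proof (intro conjI ballI)
  fix X :: "('g, 'm, 'r) gmod" assume "X \<in> Obj (Mod_cat TYPE('m) G R A)"
  then have X: "graded_module G R A X" by simp
  show "Ide (Mod_cat TYPE('m) G R A) X \<in> Arr (Mod_cat TYPE('m) G R A) X X"
    using gmod_hom_ide[OF X] by simp
  fix Y :: "('g, 'm, 'r) gmod" assume "Y \<in> Obj (Mod_cat TYPE('m) G R A)"
  then have Y: "graded_module G R A Y" by simp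
  {
    fix f assume "f \<in> Arr (Mod_cat TYPE('m) G R A) X Y"
    then have f: "f \<in> gmod_hom G A X Y" by simp
    show "Cmp (Mod_cat TYPE('m) G R A) X X Y f (Ide (Mod_cat TYPE('m) G R A) X) = f"
      using gmod_hom_compose[OF X gmod_hom_ide[OF X] f]
      by (intro gmod_hom_eqI[OF _ f]) (auto simp: compose_def)
    show "Cmp (Mod_cat TYPE('m) G R A) X Y Y (Ide (Mod_cat TYPE('m) G R A) Y) f = f"
      using gmod_hom_compose[OF X f gmod_hom_ide[OF Y]]
      by (intro gmod_hom_eqI[OF _ f]) (auto simp: compose_def gmod_hom_closed[OF f])
  }
  fix Z :: "('g, 'm, 'r) gmod" assume Z: "Z \<in> Obj (Mod_cat TYPE('m) G R A)"
  fix f f' assume f: "f \<in> Arr (Mod_cat TYPE('m) G R A) X Y" and f': "f' \<in> Arr (Mod_cat TYPE('m) G R A) Y Z"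
  show "Cmp (Mod_cat TYPE('m) G R A) X Y Z f' f \<in> Arr (Mod_cat TYPE('m) G R A) X Z"
    using gmod_hom_compose[OF X] f f' by simp
  fix W :: "('g, 'm, 'r) gmod" and h
  show "Cmp (Mod_cat TYPE('m) G R A) X Z W h (Cmp (Mod_cat TYPE('m) G R A) X Y Z f' f) =
      Cmp (Mod_cat TYPE('m) G R A) X Y W (Cmp (Mod_cat TYPE('m) G R A) Y Z W h f') f"
    using f by (auto simp: compose_def gmod_hom_closed fun_eq_iff restrict_def)
qed

text \<open>Every equation required of the inverse can be checked after applying the injective map
  f, where it becomes linearity of f.\<close>

lemma gmod_hom_inverse:
  assumes X: "graded_module G R A X" and Y: "graded_module G R A Y" and f: "f \<in> gmod_hom G A X Y"
    and bij: "\<And>g. g \<in> carrier G \<Longrightarrow> bij_betw (f g) (carrier (hc X g)) (carrier (hc Y g))"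
  shows "(\<lambda>g\<in>carrier G. \<lambda>y\<in>carrier (hc Y g). inv_into (carrier (hc X g)) (f g) y) \<in> gmod_hom G A Y X"
proof -
  let ?i = "\<lambda>g. inv_into (carrier (hc X g)) (f g)"
  have i: "?i g y \<in> carrier (hc X g)" "f g (?i g y) = y"
    if "g \<in> carrier G" "y \<in> carrier (hc Y g)" for g y
    using bij[OF that(1)] that(2) by (auto simp: bij_betw_def inv_into_into f_inv_into_f)
  have eq: "?i g y = x" if "g \<in> carrier G" "x \<in> carrier (hc X g)" "f g x = y" for g x y
    using bij[OF that(1)] that(2,3) by (auto simp: bij_betw_def inv_into_f_f)
  show ?thesis
  proof (rule gmod_homI)
    fix g x y assume "g \<in> carrier G" "x \<in> carrier (hc Y g)" "y \<in> carrier (hc Y g)"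
    then show "(\<lambda>g\<in>carrier G. \<lambda>y\<in>carrier (hc Y g). ?i g y) g (x \<otimes>\<^bsub>hc Y g\<^esub> y) =
       (\<lambda>g\<in>carrier G. \<lambda>y\<in>carrier (hc Y g). ?i g y) g x \<otimes>\<^bsub>hc X g\<^esub> (\<lambda>g\<in>carrier G. \<lambda>y\<in>carrier (hc Y g). ?i g y) g y"
      using X Y f by (simp add: hc_mult) (intro eq; simp add: i hc_mult gmod_hom_mult[OF f])
  next
    fix g k x r assume "g \<in> carrier G" "k \<in> carrier G" "x \<in> carrier (hc Y g)" "r \<in> A k"
    then show "(\<lambda>g\<in>carrier G. \<lambda>y\<in>carrier (hc Y g). ?i g y) (g \<otimes> k) (act Y g k x r) =
       act X g k ((\<lambda>g\<in>carrier G. \<lambda>y\<in>carrier (hc Y g). ?i g y) g x) r"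
      using X Y f by (simp add: act_closed) (intro eq; simp add: i act_closed gmod_hom_act[OF f])
  qed (use i in auto)
qed

lemma is_iso_Mod_catI:
  assumes X: "graded_module G R A X" and Y: "graded_module G R A Y" and f: "f \<in> gmod_hom G A X Y"
    and bij: "\<And>g. g \<in> carrier G \<Longrightarrow> bij_betw (f g) (carrier (hc X g)) (carrier (hc Y g))"
  shows "is_iso (Mod_cat TYPE('m) G R A) X Y f"
proof -
  let ?i = "\<lambda>g\<in>carrier G. \<lambda>y\<in>carrier (hc Y g). inv_into (carrier (hc X g)) (f g) y"
  have i: "?i \<in> gmod_hom G A Y X" using gmod_hom_inverse[OF assms] .
  have 1: "inv_into (carrier (hc X g)) (f g) (f g x) = x" if "g \<in> carrier G" "x \<in> carrier (hc X g)" for g x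
    using bij[OF that(1)] that(2) by (simp add: bij_betw_inv_into_left)
  have 2: "f g (inv_into (carrier (hc X g)) (f g) x) = x" if "g \<in> carrier G" "x \<in> carrier (hc Y g)" for g x
    using bij[OF that(1)] that(2) by (simp add: bij_betw_inv_into_right)
  show ?thesis unfolding is_iso_def
    using f i 1 2
    by (auto simp: compose_def gmod_hom_closed fun_eq_iff restrict_def intro!: bexI[of _ ?i])
qed

lemma is_iso_Mod_catD:
  assumes iso: "is_iso (Mod_cat TYPE('m) G R A) X Y f" and g: "g \<in> carrier G"
  shows "bij_betw (f g) (carrier (hc X g)) (carrier (hc Y g))"
proof -
  obtain f' where f: "f \<in> gmod_hom G A X Y" and f': "f' \<in> gmod_hom G A Y X"
    and 1: "(\<lambda>g\<in>carrier G. compose (carrier (hc X g)) (f' g) (f g)) = (\<lambda>g\<in>carrier G. \<lambda>x\<in>carrier (hc X g). x)"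
    and 2: "(\<lambda>g\<in>carrier G. compose (carrier (hc Y g)) (f g) (f' g)) = (\<lambda>g\<in>carrier G. \<lambda>x\<in>carrier (hc Y g). x)"
    using iso by (auto simp: is_iso_def)
  show ?thesis
  proof (rule bij_betw_byWitness[of _ "f' g"])
    show "\<forall>a\<in>carrier (hc X g). f' g (f g a) = a"
    proof
      fix x assume "x \<in> carrier (hc X g)"
      then show "f' g (f g x) = x" using fun_cong[OF fun_cong[OF 1, of g], of x] g by (simp add: compose_def)
    qed
    show "\<forall>a\<in>carrier (hc Y g). f g (f' g a) = a"
    proof
      fix x assume "x \<in> carrier (hc Y g)"
      then show "f g (f' g x) = x" using fun_cong[OF fun_cong[OF 2, of g], of x] g by (simp add: compose_def)
    qed
  qed (use gmod_hom_closed[OF f g] gmod_hom_closed[OF f' g] in auto)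
qed

section \<open>Degree shifts as a strict action\<close>

lemma graded_module_shift:
  assumes X: "graded_module G R A X" and d: "d \<in> carrier G"
  shows "graded_module G R A (shift G d X)"
proof (rule graded_moduleI)
  fix g k x r
  assume n: "\<not> (g \<in> carrier G \<and> k \<in> carrier G \<and> x \<in> carrier (hc (shift G d X) g) \<and> r \<in> A k)"
  show "act (shift G d X) g k x r = undefined"
  proof (cases "g \<in> carrier G")
    case True
    then have "\<not> (d \<otimes> g \<in> carrier G \<and> k \<in> carrier G \<and> x \<in> carrier (hc X (d \<otimes> g)) \<and> r \<in> A k)"
      using n by (auto simp: shift_def)
    then show ?thesis using True by (simp add: shift_def act_ext[OF X])
  qed (simp add: shift_def)
qed (use X d in \<open>auto simp: shift_def hc_comm_group act_closed act_add_left act_add_right act_one act_mult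
    G.m_assoc[symmetric]\<close>)

lemma gmod_hom_shift:
  assumes X: "graded_module G R A X" and f: "f \<in> gmod_hom G A X Y" and d: "d \<in> carrier G"
  shows "(\<lambda>g\<in>carrier G. f (d \<otimes> g)) \<in> gmod_hom G A (shift G d X) (shift G d Y)"
  using X d gmod_hom_closed[OF f] gmod_hom_mult[OF f] gmod_hom_act[OF f] gmod_hom_extensional[OF f]
  by (intro gmod_homI) (auto simp: shift_def G.m_assoc[symmetric])

lemma is_functor_shift:
  assumes d: "d \<in> carrier G"
  shows "is_functor (Mod_cat TYPE('m) G R A) (Mod_cat TYPE('m) G R A) (shift_functor G d)"
  unfolding is_functor_def
proof (intro conjI ballI)
  fix X :: "('g, 'm, 'r) gmod" assume "X \<in> Obj (Mod_cat TYPE('m) G R A)"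
  then have X: "graded_module G R A X" by simp
  show "fob (shift_functor G d) X \<in> Obj (Mod_cat TYPE('m) G R A)"
    using graded_module_shift[OF X d] by (simp add: shift_functor_def)
  show "far (shift_functor G d) X X (Ide (Mod_cat TYPE('m) G R A) X) =
         Ide (Mod_cat TYPE('m) G R A) (fob (shift_functor G d) X)"
    using d by (auto simp: shift_functor_def shift_def)
  fix Y f assume "f \<in> Arr (Mod_cat TYPE('m) G R A) X Y"
  then have f: "f \<in> gmod_hom G A X Y" by simp
  show "far (shift_functor G d) X Y f
       \<in> Arr (Mod_cat TYPE('m) G R A) (fob (shift_functor G d) X) (fob (shift_functor G d) Y)"
    using gmod_hom_shift[OF X f d] by (simp add: shift_functor_def)
  fix Z :: "('g, 'm, 'r) gmod" and f'
  show "far (shift_functor G d) X Z (Cmp (Mod_cat TYPE('m) G R A) X Y Z f' f) =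
       Cmp (Mod_cat TYPE('m) G R A) (fob (shift_functor G d) X) (fob (shift_functor G d) Y)
        (fob (shift_functor G d) Z) (far (shift_functor G d) Y Z f') (far (shift_functor G d) X Y f)"
    using d by (auto simp: shift_functor_def shift_def)
qed (rule is_category_Mod_cat)+

lemma gmod_eqI:
  assumes "\<And>g. hc X g = hc Y g" "\<And>g k x r. act X g k x r = act Y g k x r"
  shows "X = (Y :: ('a, 'b, 'c) gmod)"
  using assms by (cases X, cases Y) (auto simp: fun_eq_iff)

text \<open>Component g of F_n(F_m X) is the component of X in degree m^-1 n^-1 g, which is (n m)^-1
  g; this is why the action shifts by inverses. The laws hold as equalities, not merely up to
  isomorphism, because modules and morphisms are fixed outside their domains.\<close>

lemma strict_action_shift:
  assumes N: "subgroup K G"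
  shows "strict_action (G\<lparr>carrier := K\<rparr>) (Mod_cat TYPE('m) G R A) (shift_action G)"
  unfolding strict_action_def functor_eq_def
proof (intro conjI ballI)
  show "group (G\<lparr>carrier := K\<rparr>)" by (rule subgroup.subgroup_is_group[OF N G.group_axioms])
  fix X :: "('g, 'm, 'r) gmod" assume "X \<in> Obj (Mod_cat TYPE('m) G R A)"
  then have X: "graded_module G R A X" by simp
  have ue: "act X g k x r = undefined" if "g \<notin> carrier G" for g k x r
    using act_ext[OF X] that by blast
  show "fob (shift_action G \<one>\<^bsub>G\<lparr>carrier := K\<rparr>\<^esub>) X = fob id_functor X"
    using extensional_arb[OF hc_ext[OF X]] ue
    by (auto simp: shift_action_def shift_functor_def id_functor_def shift_def intro!: gmod_eqI)
  fix Y :: "('g, 'm, 'r) gmod" and f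
  assume "f \<in> Arr (Mod_cat TYPE('m) G R A) X Y"
  then have "f \<in> extensional (carrier G)" by (simp add: gmod_hom_def PiE_iff)
  then show "far (shift_action G \<one>\<^bsub>G\<lparr>carrier := K\<rparr>\<^esub>) X Y f = far id_functor X Y f"
    by (auto simp: shift_action_def shift_functor_def id_functor_def fun_eq_iff restrict_def extensional_def)
next
  have sub: "k \<in> carrier G" if "k \<in> K" for k using subgroup.mem_carrier[OF N that] .
  fix n assume "n \<in> carrier (G\<lparr>carrier := K\<rparr>)"
  then have n: "n \<in> carrier G" using sub by simp
  show "is_functor (Mod_cat TYPE('m) G R A) (Mod_cat TYPE('m) G R A) (shift_action G n)"
    unfolding shift_action_def using n by (intro is_functor_shift) simp
  fix m assume "m \<in> carrier (G\<lparr>carrier := K\<rparr>)"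
  then have m: "m \<in> carrier G" using sub by simp
  fix X :: "('g, 'm, 'r) gmod"
  show "fob (shift_action G (n \<otimes>\<^bsub>G\<lparr>carrier := K\<rparr>\<^esub> m)) X = fob (comp_functor (shift_action G n) (shift_action G m)) X"
    using n m by (auto simp: shift_action_def shift_functor_def comp_functor_def shift_def
       G.inv_mult_group G.m_assoc fun_eq_iff intro!: gmod_eqI)
  fix Y :: "('g, 'm, 'r) gmod" and f
  show "far (shift_action G (n \<otimes>\<^bsub>G\<lparr>carrier := K\<rparr>\<^esub> m)) X Y f =
     far (comp_functor (shift_action G n) (shift_action G m)) X Y f"
    using n m by (auto simp: shift_action_def shift_functor_def comp_functor_def
       G.inv_mult_group G.m_assoc)
qed

end

section \<open>The functor \<open>\<Theta>\<close>\<close>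

context grading_hom
begin

abbreviation N :: "('g, 'z) monoid_scheme" where "N \<equiv> G\<lparr>carrier := kernel G H \<pi>\<rparr>"

lemma subgroup_kernel: "subgroup (kernel G H \<pi>) G"
  using group_hom.subgroup_kernel[OF group_hom] .

lemma kernel_iff: "n \<in> kernel G H \<pi> \<longleftrightarrow> n \<in> carrier G \<and> \<pi> n = \<one>\<^bsub>H\<^esub>"
  by (auto simp: kernel_def)

lemmas B_closed = grading.act_closed[OF grading_B]
  and B_add_left = grading.act_add_left[OF grading_B]
  and B_add_right = grading.act_add_right[OF grading_B]
  and B_act_one = grading.act_one[OF grading_B]
  and B_act_mult = grading.act_mult[OF grading_B]
  and B_hc_mult = grading.hc_mult[OF grading_B]
  and B_hc_one = grading.hc_one[OF grading_B]

lemma graded_module_pullback: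
  assumes Y: "graded_module H R B Y"
  shows "graded_module G R A (pullback G A \<pi> Y)"
  using Y
  by (intro graded_moduleI)
    (auto simp: pullback_def \<pi>_closed \<pi>_mult \<pi>_one A_sub_B A_add A_mult one_homogeneous
      grading.hc_comm_group[OF grading_B] B_closed B_add_left B_add_right B_act_one B_act_mult B_hc_mult)

lemma gmod_hom_pullback:
  assumes Y: "graded_module H R B Y" and f: "f \<in> gmod_hom H B Y Z"
  shows "(\<lambda>g\<in>carrier G. f (\<pi> g)) \<in> gmod_hom G A (pullback G A \<pi> Y) (pullback G A \<pi> Z)"
  using Y gmod_hom_closed[OF f] gmod_hom_mult[OF f] gmod_hom_act[OF f] gmod_hom_extensional[OF f]
  by (intro gmod_homI) (auto simp: pullback_def \<pi>_closed \<pi>_mult A_sub_B B_closed)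

lemma shift_pullback:
  assumes n: "n \<in> kernel G H \<pi>"
  shows "fob (shift_action G n) (pullback G A \<pi> Y) = pullback G A \<pi> Y"
proof -
  have "\<pi> (inv n \<otimes> g) = \<pi> g" "inv n \<otimes> g \<in> carrier G" if "g \<in> carrier G" for g
    using n that by (simp_all add: kernel_iff \<pi>_mult \<pi>_inv \<pi>_closed)
  then show ?thesis
    by (auto simp: shift_action_def shift_functor_def shift_def pullback_def fun_eq_iff intro!: gmod_eqI)
qed

lemma is_category_equivariant: "is_category (equivariant_cat N (Mod_cat TYPE('m) G R A) (shift_action G))"
  using strict_action_shift[OF subgroup_kernel]
  by (intro is_category_equivariant_cat is_category_Mod_cat) (auto simp: strict_action_def)

lemma Theta_simps [simp]:
  "fst (fob (Theta G H A \<pi>) Y) = pullback G A \<pi> Y"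
  "snd (fob (Theta G H A \<pi>) Y) =
    (\<lambda>n\<in>kernel G H \<pi>. \<lambda>g\<in>carrier G. \<lambda>y\<in>carrier (hc (pullback G A \<pi> Y) g). y)"
  "far (Theta G H A \<pi>) Y Z f = (\<lambda>g\<in>carrier G. f (\<pi> g))"
  by (simp_all add: Theta_def)

lemma pullback_hc: "g \<in> carrier G \<Longrightarrow> hc (pullback G A \<pi> Y) g = hc Y (\<pi> g)"
  by (simp add: pullback_def)

text \<open>With identities as structure maps the equivariance square loses both of them, leaving
  that f takes equal values at g and at n^-1 g. An equivariant morphism between restrictions is thus
  one that is constant on cosets of the kernel.\<close>

lemma Arr_Theta:
  "f \<in> Arr (equivariant_cat N (Mod_cat TYPE('m) G R A) (shift_action G))
      (fob (Theta G H A \<pi>) Y) (fob (Theta G H A \<pi>) Z) \<longleftrightarrow>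
   f \<in> gmod_hom G A (pullback G A \<pi> Y) (pullback G A \<pi> Z) \<and>
   (\<forall>n\<in>kernel G H \<pi>. \<forall>g\<in>carrier G. f (inv n \<otimes> g) = f g)"
  (is "?L \<longleftrightarrow> ?h \<and> ?R")
proof -
  let ?Y = "pullback G A \<pi> Y" and ?Z = "pullback G A \<pi> Z"
  have "Cmp (Mod_cat TYPE('m) G R A) ?Y ?Z ?Z (Ide (Mod_cat TYPE('m) G R A) ?Z) f =
      Cmp (Mod_cat TYPE('m) G R A) ?Y ?Y ?Z (far (shift_action G n) ?Y ?Z f) (Ide (Mod_cat TYPE('m) G R A) ?Y)
    \<longleftrightarrow> (\<forall>g\<in>carrier G. f (inv n \<otimes> g) = f g)"
    if f: ?h and n: "n \<in> kernel G H \<pi>" for n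
  proof -
    have ng: "\<pi> (inv n \<otimes> g) = \<pi> g" "inv n \<otimes> g \<in> carrier G" if "g \<in> carrier G" for g
      using n that by (simp_all add: kernel_iff \<pi>_mult \<pi>_inv \<pi>_closed)
    have l: "Cmp (Mod_cat TYPE('m) G R A) ?Y ?Z ?Z (Ide (Mod_cat TYPE('m) G R A) ?Z) f = (\<lambda>g\<in>carrier G. f g)"
      using gmod_hom_closed[OF f] gmod_hom_extensional[OF f]
      by (auto simp: fun_eq_iff compose_def restrict_def extensional_def)
    have r: "Cmp (Mod_cat TYPE('m) G R A) ?Y ?Y ?Z (far (shift_action G n) ?Y ?Z f) (Ide (Mod_cat TYPE('m) G R A) ?Y)
       = (\<lambda>g\<in>carrier G. f (inv n \<otimes> g))"
      using gmod_hom_extensional[OF f ng(2)] ng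
      by (auto simp: fun_eq_iff compose_def restrict_def extensional_def shift_action_def shift_functor_def pullback_hc)
    show ?thesis unfolding l r by (auto simp: fun_eq_iff restrict_def)
  qed
  then show ?thesis
    by (auto simp: shift_pullback simp del: Mod_cat_simps(3)) 
qed

lemma Theta_object:
  assumes Y: "graded_module H R B (Y :: ('h, 'm, 'r) gmod)"
  shows "fob (Theta G H A \<pi>) Y \<in> Obj (equivariant_cat N (Mod_cat TYPE('m) G R A) (shift_action G))"
proof -
  let ?C = "Mod_cat TYPE('m) G R A" and ?Y = "pullback G A \<pi> Y"
  note Y' = graded_module_pullback[OF Y]
  note C = is_category_Mod_cat
  have ob: "?Y \<in> Obj ?C" using Y' by simp
  have iso: "is_iso ?C ?Y ?Y (Ide ?C ?Y)"
    using category_ide[OF C ob] category_ide_left[OF C ob ob category_ide[OF C ob]]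
    unfolding is_iso_def by blast
  have far: "far (shift_action G n) ?Y ?Y (Ide ?C ?Y) = Ide ?C ?Y" if n: "n \<in> kernel G H \<pi>" for n
    using functor_ide[OF is_functor_shift ob, of "inv n"] shift_pullback[OF n, of Y] n
    by (simp add: shift_action_def kernel_iff)
  show ?thesis
    unfolding equivariant_cat_def Theta_def
    using Y' iso far category_ide_left[OF C ob ob category_ide[OF C ob]]
      subgroup.m_closed[OF subgroup_kernel]
    by (simp add: shift_pullback del: Mod_cat_simps(2-3)) 
qed

lemma is_functor_Theta:
  "is_functor (Mod_cat TYPE('m) H R B)
      (equivariant_cat N (Mod_cat TYPE('m) G R A) (shift_action G)) (Theta G H A \<pi>)"
  (is "is_functor ?C ?D _")
  unfolding is_functor_def
proof (intro conjI ballI)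
  show "is_category ?C" by (rule grading.is_category_Mod_cat[OF grading_B])
  show "is_category ?D" by (rule is_category_equivariant)
  fix X assume "X \<in> Obj ?C"
  then have X: "graded_module H R B X" by simp
  show "fob (Theta G H A \<pi>) X \<in> Obj ?D" by (rule Theta_object[OF X])
  show "far (Theta G H A \<pi>) X X (Ide ?C X) = Ide ?D (fob (Theta G H A \<pi>) X)"
    by (auto simp: pullback_hc \<pi>_closed fun_eq_iff restrict_def)
  fix Y f assume Y: "Y \<in> Obj ?C" and f: "f \<in> Arr ?C X Y"
  show "far (Theta G H A \<pi>) X Y f \<in> Arr ?D (fob (Theta G H A \<pi>) X) (fob (Theta G H A \<pi>) Y)"
    unfolding Arr_Theta using gmod_hom_pullback[OF X, of f Y] f
    by (auto simp: kernel_iff \<pi>_mult \<pi>_inv \<pi>_closed)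
  fix Z f' assume "Z \<in> Obj ?C" "f' \<in> Arr ?C Y Z"
  show "far (Theta G H A \<pi>) X Z (Cmp ?C X Y Z f' f) =
     Cmp ?D (fob (Theta G H A \<pi>) X) (fob (Theta G H A \<pi>) Y) (fob (Theta G H A \<pi>) Z)
       (far (Theta G H A \<pi>) Y Z f') (far (Theta G H A \<pi>) X Y f)"
    by (auto simp: pullback_hc \<pi>_closed fun_eq_iff restrict_def)
qed

text \<open>Both sides of the linearity condition are additive in the scalar, so
  \<open>B_induct\<close> extends it from G-homogeneous scalars to all of
  \<open>B k\<close>.\<close>

lemma hom_of_pullback_hom:
  assumes Y: "graded_module H R B Y" and Z: "graded_module H R B Z"
    and closed: "\<And>h y. h \<in> carrier H \<Longrightarrow> y \<in> carrier (hc Y h) \<Longrightarrow> f h y \<in> carrier (hc Z h)"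
    and mult: "\<And>h x y. \<lbrakk>h \<in> carrier H; x \<in> carrier (hc Y h); y \<in> carrier (hc Y h)\<rbrakk> \<Longrightarrow>
      f h (x \<otimes>\<^bsub>hc Y h\<^esub> y) = f h x \<otimes>\<^bsub>hc Z h\<^esub> f h y"
    and act: "\<And>h g x r. \<lbrakk>h \<in> carrier H; g \<in> carrier G; x \<in> carrier (hc Y h); r \<in> A g\<rbrakk> \<Longrightarrow>
      f (h \<otimes>\<^bsub>H\<^esub> \<pi> g) (act Y h (\<pi> g) x r) = act Z h (\<pi> g) (f h x) r"
    and ext: "\<And>h. h \<in> carrier H \<Longrightarrow> f h \<in> extensional (carrier (hc Y h))" "f \<in> extensional (carrier H)"
  shows "f \<in> gmod_hom H B Y Z"
proof (rule gmod_homI)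
  fix h k x r assume h: "h \<in> carrier H" and k: "k \<in> carrier H" and x: "x \<in> carrier (hc Y h)" and "r \<in> B k"
  interpret Zg: group "hc Z (h \<otimes>\<^bsub>H\<^esub> k)" using grading.hc_group[OF grading_B Z] h k by simp
  interpret Yg: group "hc Y (h \<otimes>\<^bsub>H\<^esub> k)" using grading.hc_group[OF grading_B Y] h k by simp
  have hk: "h \<otimes>\<^bsub>H\<^esub> k \<in> carrier H" using h k by simp
  from \<open>r \<in> B k\<close> show "f (h \<otimes>\<^bsub>H\<^esub> k) (act Y h k x r) = act Z h k (f h x) r"
  proof (induction rule: B_induct)
    case zero
    have "f (h \<otimes>\<^bsub>H\<^esub> k) \<one>\<^bsub>hc Y (h \<otimes>\<^bsub>H\<^esub> k)\<^esub> = \<one>\<^bsub>hc Z (h \<otimes>\<^bsub>H\<^esub> k)\<^esub>"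
      using closed[OF hk] mult[OF hk]
      by (intro hom_one[OF homI Yg.is_group Zg.is_group]) auto
    then show ?case
      using grading.act_zero[OF grading_B Y h k x] grading.act_zero[OF grading_B Z h k closed[OF h x]] by simp
  next
    case (homogeneous g r)
    then show ?case using act[OF h _ x] by blast
  next
    case (add r s)
    then show ?case using Y Z h k x closed
      by (simp add: B_add_right B_closed mult)
  qed
qed (fact closed mult ext)+

text \<open>Invariance under the kernel makes f constant on the fibres of \<pi>, so it factors
  through H along any set-theoretic section.\<close>

lemma gmod_hom_factor:
  assumes Y: "graded_module H R B Y" and Z: "graded_module H R B Z"
    and surj: "\<pi> ` carrier G = carrier H"
    and f: "f \<in> gmod_hom G A (pullback G A \<pi> Y) (pullback G A \<pi> Z)"
    and inv: "\<And>n g. n \<in> kernel G H \<pi> \<Longrightarrow> g \<in> carrier G \<Longrightarrow> f (inv n \<otimes> g) = f g"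
  shows "\<exists>f'\<in>gmod_hom H B Y Z. (\<lambda>g\<in>carrier G. f' (\<pi> g)) = f"
proof -
  define s where "s = inv_into (carrier G) \<pi>"
  have s: "s h \<in> carrier G" "\<pi> (s h) = h" if "h \<in> carrier H" for h
    using that surj by (auto simp: s_def inv_into_into f_inv_into_f)
  \<comment> \<open>For n = g k^-1 in the kernel, n^-1 g = k.\<close>
  have eq: "f g = f k" if "g \<in> carrier G" "k \<in> carrier G" "\<pi> g = \<pi> k" for g k
  proof -
    have "g \<otimes> inv k \<in> kernel G H \<pi>"
      using that \<pi>_closed[of k] by (simp add: kernel_iff \<pi>_mult \<pi>_inv)
    from inv[OF this that(1)] show ?thesis
      using that by (simp add: G.inv_mult_group G.m_assoc)
  qed
  let ?f = "\<lambda>h\<in>carrier H. f (s h)"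
  have sg: "f (s (\<pi> g)) = f g" if "g \<in> carrier G" for g
    using that by (intro eq) (auto simp: s \<pi>_closed)
  \<comment> \<open>The section need not be multiplicative, but both degrees lie over h \<pi>(g),
    and f only sees the fibre.\<close>
  have fh: "f (s h \<otimes> g) = f (s (h \<otimes>\<^bsub>H\<^esub> \<pi> g))" if "h \<in> carrier H" "g \<in> carrier G" for h g
    using that by (intro eq) (auto simp: s \<pi>_closed \<pi>_mult)
  have "?f \<in> gmod_hom H B Y Z"
  proof (rule hom_of_pullback_hom[OF Y Z])
    fix h g x r assume h: "h \<in> carrier H" and g: "g \<in> carrier G" and x: "x \<in> carrier (hc Y h)" and r: "r \<in> A g"
    have x': "x \<in> carrier (hc (pullback G A \<pi> Y) (s h))" using h x by (simp add: pullback_hc s)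
    have fx: "f (s h) x \<in> carrier (hc Z h)"
      using gmod_hom_closed[OF f s(1)[OF h] x'] h by (simp add: pullback_hc s)
    show "?f (h \<otimes>\<^bsub>H\<^esub> \<pi> g) (act Y h (\<pi> g) x r) = act Z h (\<pi> g) (?f h x) r"
      using gmod_hom_act[OF f s(1)[OF h] g x' r] h g x r fx
      by (simp add: fh \<pi>_closed) (simp add: pullback_def s)
  next
    fix h x assume "h \<in> carrier H" "x \<in> carrier (hc Y h)"
    then show "?f h x \<in> carrier (hc Z h)"
      using gmod_hom_closed[OF f s(1), of h x] by (simp add: pullback_hc s)
  next
    fix h x y assume "h \<in> carrier H" "x \<in> carrier (hc Y h)" "y \<in> carrier (hc Y h)"
    then show "?f h (x \<otimes>\<^bsub>hc Y h\<^esub> y) = ?f h x \<otimes>\<^bsub>hc Z h\<^esub> ?f h y"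
      using gmod_hom_mult[OF f s(1), of h x y] by (simp add: pullback_hc s)
  next
    fix h assume "h \<in> carrier H"
    then show "?f h \<in> extensional (carrier (hc Y h))"
      using gmod_hom_extensional[OF f s(1), of h] by (simp add: pullback_hc s)
  qed simp
  moreover have "(\<lambda>g\<in>carrier G. ?f (\<pi> g)) = f"
    using f by (auto simp: sg \<pi>_closed fun_eq_iff restrict_def gmod_hom_def PiE_iff extensional_def)
  ultimately show ?thesis by blast
qed

lemma Theta_full:
  fixes X Y :: "('h, 'm, 'r) gmod"
  assumes surj: "\<pi> ` carrier G = carrier H"
    and X: "graded_module H R B X" and Y: "graded_module H R B Y"
    and f: "f \<in> Arr (equivariant_cat N (Mod_cat TYPE('m) G R A) (shift_action G))
      (fob (Theta G H A \<pi>) X) (fob (Theta G H A \<pi>) Y)"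
  shows "\<exists>f'\<in>gmod_hom H B X Y. far (Theta G H A \<pi>) X Y f' = f"
  using gmod_hom_factor[OF X Y surj] f unfolding Arr_Theta by simp

lemma Theta_faithful:
  assumes surj: "\<pi> ` carrier G = carrier H"
    and f: "f \<in> gmod_hom H B X Y" and f': "f' \<in> gmod_hom H B X Y"
    and eq: "far (Theta G H A \<pi>) X Y f = far (Theta G H A \<pi>) X Y f'"
  shows "f = f'"
proof (rule gmod_hom_eqI[OF f f'])
  fix h x assume "h \<in> carrier H"
  then obtain g where "g \<in> carrier G" "h = \<pi> g" using surj by blast
  then show "f h x = f' h x" using fun_cong[OF eq, of g] by simp
qed

end

section \<open>Necessity of surjectivity\<close>

context grading
begin

text \<open>The shift R(d) has components inside R, whereas the objects of the category are carried
  by \<open>'m\<close>; its structure is therefore transported along the injection \<iota>, with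
  \<rho> as the way back.\<close>

lemma exists_shifted_regular_module:
  fixes \<iota> :: "'r \<Rightarrow> 'm"
  assumes \<iota>: "inj_on \<iota> (carrier R)" and d: "d \<in> carrier G"
  shows "\<exists>X :: ('g, 'm, 'r) gmod. graded_module G R A X \<and>
    (\<forall>g\<in>carrier G. carrier (hc X g) = \<iota> ` A (d \<otimes> g))"
proof -
  define \<rho> where "\<rho> = inv_into (carrier R) \<iota>"
  have \<rho>: "\<rho> (\<iota> r) = r" if "r \<in> carrier R" for r using that \<iota> by (simp add: \<rho>_def)
  let ?X = "\<lparr>hc = \<lambda>g\<in>carrier G. \<lparr>carrier = \<iota> ` A (d \<otimes> g), monoid.mult = (\<lambda>x y. \<iota> (\<rho> x \<oplus>\<^bsub>R\<^esub> \<rho> y)), one = \<iota> \<zero>\<^bsub>R\<^esub>\<rparr>,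
      act = \<lambda>g k x r. if g \<in> carrier G \<and> k \<in> carrier G \<and> x \<in> \<iota> ` A (d \<otimes> g) \<and> r \<in> A k
        then \<iota> (\<rho> x \<otimes>\<^bsub>R\<^esub> r) else undefined\<rparr> :: ('g, 'm, 'r) gmod"
  have AR: "r \<in> carrier R" if "r \<in> A (d \<otimes> g)" "g \<in> carrier G" for r g
    using that d A_subset[of "d \<otimes> g"] by simp
  have dm: "r \<otimes>\<^bsub>R\<^esub> s \<in> A (d \<otimes> (g \<otimes> k))"
    if "r \<in> A (d \<otimes> g)" "s \<in> A k" "g \<in> carrier G" "k \<in> carrier G" for r s g k
    using A_mult[of "d \<otimes> g" k r s] that d by (simp add: G.m_assoc)
  have "graded_module G R A ?X"
  proof (rule graded_moduleI)
    fix g assume g: "g \<in> carrier G"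
    then have dg: "d \<otimes> g \<in> carrier G" using d by simp
    note AR' = AR[OF _ g]
    have "comm_group \<lparr>carrier = \<iota> ` A (d \<otimes> g), monoid.mult = (\<lambda>x y. \<iota> (\<rho> x \<oplus>\<^bsub>R\<^esub> \<rho> y)), one = \<iota> \<zero>\<^bsub>R\<^esub>\<rparr>"
      (is "comm_group ?M")
    proof (rule comm_groupI)
      fix x assume x: "x \<in> carrier ?M"
      then obtain r where r: "r \<in> A (d \<otimes> g)" "x = \<iota> r" by auto
      show "\<one>\<^bsub>?M\<^esub> \<otimes>\<^bsub>?M\<^esub> x = x" using r AR' by (simp add: \<rho>)
      have "\<ominus>\<^bsub>R\<^esub> r \<in> A (d \<otimes> g)" using A_minus[OF dg r(1)] .
      moreover have "\<iota> (\<ominus>\<^bsub>R\<^esub> r) \<otimes>\<^bsub>?M\<^esub> x = \<one>\<^bsub>?M\<^esub>" using r AR' by (simp add: \<rho> R.l_neg)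
      ultimately show "\<exists>y\<in>carrier ?M. y \<otimes>\<^bsub>?M\<^esub> x = \<one>\<^bsub>?M\<^esub>" by auto
      fix y assume "y \<in> carrier ?M"
      then obtain s where s: "s \<in> A (d \<otimes> g)" "y = \<iota> s" by auto
      show "x \<otimes>\<^bsub>?M\<^esub> y \<in> carrier ?M" using r s AR' A_add[OF dg r(1) s(1)] by (simp add: \<rho>)
      show "x \<otimes>\<^bsub>?M\<^esub> y = y \<otimes>\<^bsub>?M\<^esub> x" using r s AR' by (simp add: \<rho> R.a_comm)
      fix z assume "z \<in> carrier ?M"
      then obtain t where t: "t \<in> A (d \<otimes> g)" "z = \<iota> t" by auto
      show "x \<otimes>\<^bsub>?M\<^esub> y \<otimes>\<^bsub>?M\<^esub> z = x \<otimes>\<^bsub>?M\<^esub> (y \<otimes>\<^bsub>?M\<^esub> z)"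
        using r s t AR' by (simp add: \<rho> R.a_assoc)
    qed (use A_zero[OF dg] in auto)
    then show "comm_group (hc ?X g)" using g by simp
  next
    fix g x assume "g \<in> carrier G" "x \<in> carrier (hc ?X g)"
    then show "act ?X g \<one> x \<one>\<^bsub>R\<^esub> = x"
      using one_homogeneous by (auto simp: \<rho> AR)
  next
    fix g k x r s assume *: "g \<in> carrier G" "k \<in> carrier G" "x \<in> carrier (hc ?X g)" "r \<in> A k" "s \<in> A k"
    then obtain a where a: "a \<in> A (d \<otimes> g)" "x = \<iota> a" by auto
    show "act ?X g k x (r \<oplus>\<^bsub>R\<^esub> s) = act ?X g k x r \<otimes>\<^bsub>hc ?X (g \<otimes> k)\<^esub> act ?X g k x s"
      using * a A_subset[of k] AR[OF _ *(1)] by (simp add: A_add \<rho> R.r_distr)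
  next
    fix g k x y r assume *: "g \<in> carrier G" "k \<in> carrier G" "x \<in> carrier (hc ?X g)" "y \<in> carrier (hc ?X g)" "r \<in> A k"
    then obtain a b where ab: "a \<in> A (d \<otimes> g)" "x = \<iota> a" "b \<in> A (d \<otimes> g)" "y = \<iota> b" by auto
    then have "a \<oplus>\<^bsub>R\<^esub> b \<in> A (d \<otimes> g)" "a \<otimes>\<^bsub>R\<^esub> r \<in> carrier R" "b \<otimes>\<^bsub>R\<^esub> r \<in> carrier R"
      using * d A_subset[of k] by (auto simp: A_add AR)
    then show "act ?X g k (x \<otimes>\<^bsub>hc ?X g\<^esub> y) r = act ?X g k x r \<otimes>\<^bsub>hc ?X (g \<otimes> k)\<^esub> act ?X g k y r"
      using * ab A_subset[of k] AR[OF _ *(1)] by (simp add: \<rho> R.l_distr)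
  next
    fix g k l x r s assume *: "g \<in> carrier G" "k \<in> carrier G" "l \<in> carrier G" "x \<in> carrier (hc ?X g)" "r \<in> A k" "s \<in> A l"
    then obtain a where a: "a \<in> A (d \<otimes> g)" "x = \<iota> a" by auto
    show "act ?X (g \<otimes> k) l (act ?X g k x r) s = act ?X g (k \<otimes> l) x (r \<otimes>\<^bsub>R\<^esub> s)"
      using * a A_subset[of k] A_subset[of l] AR[OF _ *(1)]
      by (simp add: A_mult dm \<rho> R.m_assoc)
  qed (auto simp: \<rho> AR dm)
  then show ?thesis by (intro exI[of _ ?X]) simp
qed

lemma gmod_hom_trivial:
  assumes X: "graded_module G R A X" and Y: "graded_module G R A Y"
  shows "(\<lambda>g\<in>carrier G. \<lambda>x\<in>carrier (hc X g). \<one>\<^bsub>hc Y g\<^esub>) \<in> gmod_hom G A X Y"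
  using X Y
  by (intro gmod_homI)
    (auto simp: hc_one hc_mult act_closed act_one_left monoid.l_one[OF hc_monoid])

end

context grading_hom
begin

text \<open>For h outside the image, the regular module shifted by h^-1 is generated by 1 in degree
  h and vanishes in every degree \<pi>(g): otherwise h^-1 \<pi>(g) = \<pi>(k) for some k, so that h
  = \<pi>(g k^-1). Hence \<Theta> cannot separate its identity from its zero endomorphism.\<close>

lemma surjective_of_equivalence:
  assumes equiv: "is_equivalence (Mod_cat TYPE('m) H R B)
      (equivariant_cat N (Mod_cat TYPE('m) G R A) (shift_action G)) (Theta G H A \<pi>)"
    and nonzero: "\<one>\<^bsub>R\<^esub> \<noteq> \<zero>\<^bsub>R\<^esub>" and universe: "carrier R \<lesssim> (UNIV :: 'm set)"
  shows "\<pi> ` carrier G = carrier H"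
proof (rule ccontr)
  assume "\<pi> ` carrier G \<noteq> carrier H"
  then obtain h where h: "h \<in> carrier H" "h \<notin> \<pi> ` carrier G" using \<pi>_closed by blast
  obtain \<iota> :: "'r \<Rightarrow> 'm" where \<iota>: "inj_on \<iota> (carrier R)" using universe by (auto simp: lepoll_def)
  obtain X :: "('h, 'm, 'r) gmod" where X: "graded_module H R B X"
    and carr: "\<And>g. g \<in> carrier H \<Longrightarrow> carrier (hc X g) = \<iota> ` B (inv\<^bsub>H\<^esub> h \<otimes>\<^bsub>H\<^esub> g)"
    using grading.exists_shifted_regular_module[OF grading_B \<iota>, of "inv\<^bsub>H\<^esub> h"] h by blast
  let ?i = "\<lambda>g\<in>carrier H. \<lambda>x\<in>carrier (hc X g). x"
  let ?z = "\<lambda>g\<in>carrier H. \<lambda>x\<in>carrier (hc X g). \<one>\<^bsub>hc X g\<^esub>"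
  have i: "?i \<in> gmod_hom H B X X" by (rule grading.gmod_hom_ide[OF grading_B X])
  have z: "?z \<in> gmod_hom H B X X" by (rule grading.gmod_hom_trivial[OF grading_B X X])
  have "x = \<one>\<^bsub>hc X (\<pi> g)\<^esub>" if g: "g \<in> carrier G" and x: "x \<in> carrier (hc X (\<pi> g))" for g x
  proof -
    have "inv\<^bsub>H\<^esub> h \<otimes>\<^bsub>H\<^esub> \<pi> g \<notin> \<pi> ` carrier G"
    proof
      assume "inv\<^bsub>H\<^esub> h \<otimes>\<^bsub>H\<^esub> \<pi> g \<in> \<pi> ` carrier G"
      then obtain k where k: "k \<in> carrier G" "inv\<^bsub>H\<^esub> h \<otimes>\<^bsub>H\<^esub> \<pi> g = \<pi> k" by blast
      have "\<pi> (g \<otimes> inv k) = \<pi> g \<otimes>\<^bsub>H\<^esub> inv\<^bsub>H\<^esub> (inv\<^bsub>H\<^esub> h \<otimes>\<^bsub>H\<^esub> \<pi> g)"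
        using g k by (simp add: \<pi>_mult \<pi>_inv)
      also have "\<dots> = h"
        using g h(1) \<pi>_closed[OF g] by (simp add: H.inv_mult_group H.m_assoc[symmetric])
      finally show False using h(2) g k by auto
    qed
    then have "carrier (hc X (\<pi> g)) = {\<iota> \<zero>\<^bsub>R\<^esub>}" using carr[OF \<pi>_closed[OF g]] by (simp add: B_eq_zero)
    then show ?thesis using x B_hc_one[OF X \<pi>_closed[OF g]] by simp
  qed
  then have "far (Theta G H A \<pi>) X X ?i = far (Theta G H A \<pi>) X X ?z"
    by (auto simp: \<pi>_closed fun_eq_iff restrict_def)
  then have eq: "?i = ?z" using equivalence_faithful[OF equiv] X i z by simp
  \<comment> \<open>Degree h separates the two endomorphisms: the component there is a copy of the
    degree-one part of the ring, which contains both 1 and 0.\<close>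
  have "carrier (hc X h) = \<iota> ` B \<one>\<^bsub>H\<^esub>" using carr[OF h(1)] h(1) by simp
  moreover have "x = \<one>\<^bsub>hc X h\<^esub>" if "x \<in> carrier (hc X h)" for x
    using fun_cong[OF fun_cong[OF eq, of h], of x] h(1) that by simp
  ultimately have "\<iota> \<one>\<^bsub>R\<^esub> = \<iota> \<zero>\<^bsub>R\<^esub>"
    using B_zero grading.one_homogeneous[OF grading_B] by (metis imageI)
  then show False using inj_onD[OF \<iota>] nonzero by blast
qed

end

section \<open>Descent\<close>

text \<open>Descent data in groupoid form: \<open>T g k\<close> carries X_g to X_k whenever g and k
  lie in the same fibre of \<pi>. \<open>T_refl\<close> and \<open>T_trans\<close> are the coherence
  laws, and \<open>T_act\<close> says that transport along right translates by l commutes with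
  multiplication by scalars of degree l. It replaces the structure maps \<alpha>, whose source and
  target degrees are less visible.\<close>

locale descent_data = grading_hom G R A H \<pi>
  for G :: "('g, 'z) monoid_scheme" (structure) and R :: "('r, 'w) ring_scheme" and A
    and H :: "('h, 'y) monoid_scheme" and \<pi> +
  fixes X :: "('g, 'm, 'r) gmod" and T :: "'g \<Rightarrow> 'g \<Rightarrow> 'm \<Rightarrow> 'm"
  assumes surj: "\<pi> ` carrier G = carrier H" and X: "graded_module G R A X"
    and T_closed: "\<And>g k x. \<lbrakk>g \<in> carrier G; k \<in> carrier G; \<pi> g = \<pi> k; x \<in> carrier (hc X g)\<rbrakk> \<Longrightarrow>
      T g k x \<in> carrier (hc X k)"
    and T_mult: "\<And>g k x y. \<lbrakk>g \<in> carrier G; k \<in> carrier G; \<pi> g = \<pi> k; x \<in> carrier (hc X g); y \<in> carrier (hc X g)\<rbrakk> \<Longrightarrow>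
      T g k (x \<otimes>\<^bsub>hc X g\<^esub> y) = T g k x \<otimes>\<^bsub>hc X k\<^esub> T g k y"
    and T_refl: "\<And>g x. \<lbrakk>g \<in> carrier G; x \<in> carrier (hc X g)\<rbrakk> \<Longrightarrow> T g g x = x"
    and T_trans: "\<And>g k l x. \<lbrakk>g \<in> carrier G; k \<in> carrier G; l \<in> carrier G; \<pi> g = \<pi> k; \<pi> k = \<pi> l; x \<in> carrier (hc X g)\<rbrakk> \<Longrightarrow>
      T k l (T g k x) = T g l x"
    and T_act: "\<And>g k l x r. \<lbrakk>g \<in> carrier G; k \<in> carrier G; l \<in> carrier G; \<pi> g = \<pi> k; x \<in> carrier (hc X g); r \<in> A l\<rbrakk> \<Longrightarrow>
      T (g \<otimes> l) (k \<otimes> l) (act X g l x r) = act X k l (T g k x) r"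
begin

definition sec :: "'h \<Rightarrow> 'g" where "sec = inv_into (carrier G) \<pi>"

lemma sec: "h \<in> carrier H \<Longrightarrow> sec h \<in> carrier G" "h \<in> carrier H \<Longrightarrow> \<pi> (sec h) = h"
  using surj by (auto simp: sec_def inv_into_into f_inv_into_f)

text \<open>Multiplication by r in \<open>A g\<close> leads from degree \<open>sec h\<close> to
  \<open>sec h \<otimes> g\<close>, which is in general not a chosen representative; the transport
  moves the result to the representative of its fibre.\<close>

definition hact :: "'h \<Rightarrow> 'h \<Rightarrow> 'm \<Rightarrow> 'g \<Rightarrow> 'r \<Rightarrow> 'm" where
  "hact h k y g r = T (sec h \<otimes> g) (sec (h \<otimes>\<^bsub>H\<^esub> k)) (act X (sec h) g y r)"

text \<open>Components are written multiplicatively, so \<open>finprod\<close> is the sum of the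
  contributions of the G-homogeneous components of r. Restricting it to the support keeps it finite
  even if the fibre over k is infinite.\<close>

definition descended :: "('h, 'm, 'r) gmod" where
  "descended = \<lparr>hc = \<lambda>h\<in>carrier H. hc X (sec h),
     act = \<lambda>h k y r. if h \<in> carrier H \<and> k \<in> carrier H \<and> y \<in> carrier (hc X (sec h)) \<and> r \<in> B k
       then finprod (hc X (sec (h \<otimes>\<^bsub>H\<^esub> k))) (\<lambda>g. hact h k y g (component r g)) (support r)
       else undefined\<rparr>"

lemma hc_descended: "h \<in> carrier H \<Longrightarrow> hc descended h = hc X (sec h)"
  by (simp add: descended_def)

lemma T_one:
  assumes "g \<in> carrier G" "k \<in> carrier G" "\<pi> g = \<pi> k"
  shows "T g k \<one>\<^bsub>hc X g\<^esub> = \<one>\<^bsub>hc X k\<^esub>"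
  using T_closed[OF assms] T_mult[OF assms] hc_group[OF X assms(1)] hc_group[OF X assms(2)]
  by (intro hom_one[OF homI]) auto

context
  fixes h k g :: _
  assumes h: "h \<in> carrier H" and g: "g \<in> carrier G" and k: "\<pi> g = k"
begin

lemma hact_aux: "sec h \<in> carrier G" "sec h \<otimes> g \<in> carrier G" "sec (h \<otimes>\<^bsub>H\<^esub> k) \<in> carrier G"
  "\<pi> (sec h \<otimes> g) = \<pi> (sec (h \<otimes>\<^bsub>H\<^esub> k))"
  using h g k by (auto simp: sec \<pi>_mult \<pi>_closed)

lemma hact_closed:
  "y \<in> carrier (hc X (sec h)) \<Longrightarrow> r \<in> A g \<Longrightarrow> hact h k y g r \<in> carrier (hc X (sec (h \<otimes>\<^bsub>H\<^esub> k)))"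
  unfolding hact_def by (intro T_closed hact_aux act_closed[OF X] g)

lemma hact_add_left:
  "\<lbrakk>x \<in> carrier (hc X (sec h)); y \<in> carrier (hc X (sec h)); r \<in> A g\<rbrakk> \<Longrightarrow>
   hact h k (x \<otimes>\<^bsub>hc X (sec h)\<^esub> y) g r = hact h k x g r \<otimes>\<^bsub>hc X (sec (h \<otimes>\<^bsub>H\<^esub> k))\<^esub> hact h k y g r"
  unfolding hact_def
  by (simp add: act_add_left[OF X] hact_aux g T_mult act_closed[OF X])

lemma hact_add_right:
  "\<lbrakk>x \<in> carrier (hc X (sec h)); r \<in> A g; s \<in> A g\<rbrakk> \<Longrightarrow>
   hact h k x g (r \<oplus>\<^bsub>R\<^esub> s) = hact h k x g r \<otimes>\<^bsub>hc X (sec (h \<otimes>\<^bsub>H\<^esub> k))\<^esub> hact h k x g s"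
  unfolding hact_def
  by (simp add: act_add_right[OF X] hact_aux g T_mult act_closed[OF X])

lemma hact_zero:
  "x \<in> carrier (hc X (sec h)) \<Longrightarrow> hact h k x g \<zero>\<^bsub>R\<^esub> = \<one>\<^bsub>hc X (sec (h \<otimes>\<^bsub>H\<^esub> k))\<^esub>"
  unfolding hact_def
  by (simp add: act_zero[OF X] hact_aux g T_one)

end

text \<open>Zero components contribute the neutral element, so the support may be enlarged to any
  finite part of the fibre. This allows different scalars to be summed over one common index
  set.\<close>

lemma act_descended:
  assumes h: "h \<in> carrier H" and k: "k \<in> carrier H" and y: "y \<in> carrier (hc X (sec h))" and r: "r \<in> B k"
    and S: "finite S" "support r \<subseteq> S" "S \<subseteq> {g \<in> carrier G. \<pi> g = k}"
  shows "act descended h k y r = finprod (hc X (sec (h \<otimes>\<^bsub>H\<^esub> k))) (\<lambda>g. hact h k y g (component r g)) S"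
proof -
  interpret hk: comm_group "hc X (sec (h \<otimes>\<^bsub>H\<^esub> k))" using hc_comm_group[OF X sec(1)] h k by simp
  have "act descended h k y r = finprod (hc X (sec (h \<otimes>\<^bsub>H\<^esub> k))) (\<lambda>g. hact h k y g (component r g)) (support r)"
    using h k y r by (simp add: descended_def)
  also have "\<dots> = finprod (hc X (sec (h \<otimes>\<^bsub>H\<^esub> k))) (\<lambda>g. hact h k y g (component r g)) S"
  proof (rule hk.finprod_mono_neutral_cong_left[OF S(1,2)])
    show "hact h k y g (component r g) = \<one>\<^bsub>hc X (sec (h \<otimes>\<^bsub>H\<^esub> k))\<^esub>" if "g \<in> S - support r" for g
    proof -
      have g: "g \<in> carrier G" "\<pi> g = k" "component r g = \<zero>\<^bsub>R\<^esub>" using that S(3) by (auto simp: support_def)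
      show ?thesis unfolding g(3) by (rule hact_zero[OF h g(1,2) y])
    qed
    show "(\<lambda>g. hact h k y g (component r g)) \<in> S \<rightarrow> carrier (hc X (sec (h \<otimes>\<^bsub>H\<^esub> k)))"
    proof
      fix g assume "g \<in> S"
      then have g: "g \<in> carrier G" "\<pi> g = k" using S(3) by auto
      show "hact h k y g (component r g) \<in> carrier (hc X (sec (h \<otimes>\<^bsub>H\<^esub> k)))"
        by (rule hact_closed[OF h g y component_in[OF B_subset[OF r] g(1)]])
    qed
  qed simp
  finally show ?thesis .
qed

lemma act_descended_homogeneous:
  assumes h: "h \<in> carrier H" and g: "g \<in> carrier G" and y: "y \<in> carrier (hc X (sec h))" and r: "r \<in> A g"
  shows "act descended h (\<pi> g) y r = hact h (\<pi> g) y g r"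
proof -
  interpret hk: comm_group "hc X (sec (h \<otimes>\<^bsub>H\<^esub> \<pi> g))"
    using hc_comm_group[OF X sec(1)] h \<pi>_closed[OF g] by simp
  have "support r \<subseteq> {g}"
    using component_homogeneous[OF g r] by (auto simp: support_def split: if_splits)
  then show ?thesis
    using act_descended[OF h \<pi>_closed[OF g] y A_sub_B[OF g r], of "{g}"] g
      component_homogeneous[OF g r g] hact_closed[OF h g refl y r]
    by (simp add: hk.finprod_insert)
qed

lemma act_descended_closed:
  assumes h: "h \<in> carrier H" and k: "k \<in> carrier H" and y: "y \<in> carrier (hc X (sec h))" and r: "r \<in> B k"
  shows "act descended h k y r \<in> carrier (hc X (sec (h \<otimes>\<^bsub>H\<^esub> k)))"
proof -
  interpret hk: comm_group "hc X (sec (h \<otimes>\<^bsub>H\<^esub> k))" using hc_comm_group[OF X sec(1)] h k by simp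
  have "hact h k y g (component r g) \<in> carrier (hc X (sec (h \<otimes>\<^bsub>H\<^esub> k)))" if "g \<in> support r" for g
    using hact_closed[OF h _ _ y component_in[OF B_subset[OF r]]] that support_B[OF r] by auto
  then show ?thesis
    unfolding act_descended[OF h k y r finite_support[OF B_subset[OF r]] subset_refl support_B[OF r]]
    by (intro hk.finprod_closed) auto
qed

lemma act_descended_add_left:
  assumes h: "h \<in> carrier H" and k: "k \<in> carrier H" and x: "x \<in> carrier (hc X (sec h))"
    and y: "y \<in> carrier (hc X (sec h))" and r: "r \<in> B k"
  shows "act descended h k (x \<otimes>\<^bsub>hc X (sec h)\<^esub> y) r =
    act descended h k x r \<otimes>\<^bsub>hc X (sec (h \<otimes>\<^bsub>H\<^esub> k))\<^esub> act descended h k y r"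
proof -
  interpret hk: comm_group "hc X (sec (h \<otimes>\<^bsub>H\<^esub> k))" using hc_comm_group[OF X sec(1)] h k by simp
  note rR = B_subset[OF r]
  note D = act_descended[OF h k _ r finite_support[OF rR] subset_refl support_B[OF r]]
  have g: "g \<in> carrier G" "\<pi> g = k" "component r g \<in> A g" if "g \<in> support r" for g
    using that support_B[OF r] component_in[OF rR] by auto
  have xy: "x \<otimes>\<^bsub>hc X (sec h)\<^esub> y \<in> carrier (hc X (sec h))" by (rule hc_mult[OF X sec(1)[OF h] x y])
  have cl: "(\<lambda>g. hact h k x g (component r g)) \<in> support r \<rightarrow> carrier (hc X (sec (h \<otimes>\<^bsub>H\<^esub> k)))"
    "(\<lambda>g. hact h k y g (component r g)) \<in> support r \<rightarrow> carrier (hc X (sec (h \<otimes>\<^bsub>H\<^esub> k)))"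
    using hact_closed[OF h g(1,2) x g(3)] hact_closed[OF h g(1,2) y g(3)] by auto
  show ?thesis
    unfolding D[OF x] D[OF y] D[OF xy] hk.finprod_multf[OF cl, symmetric]
    using cl hact_add_left[OF h g(1,2) x y g(3)] by (intro hk.finprod_cong') auto
qed

lemma act_descended_add_right:
  assumes h: "h \<in> carrier H" and k: "k \<in> carrier H" and x: "x \<in> carrier (hc X (sec h))"
    and r: "r \<in> B k" and s: "s \<in> B k"
  shows "act descended h k x (r \<oplus>\<^bsub>R\<^esub> s) =
    act descended h k x r \<otimes>\<^bsub>hc X (sec (h \<otimes>\<^bsub>H\<^esub> k))\<^esub> act descended h k x s"
proof -
  interpret hk: comm_group "hc X (sec (h \<otimes>\<^bsub>H\<^esub> k))" using hc_comm_group[OF X sec(1)] h k by simp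
  note rR = B_subset[OF r] and sR = B_subset[OF s] and rs = B_add[OF r s]
  \<comment> \<open>One index set serving r, s and their sum, so that the three products can be
    compared factor by factor.\<close>
  let ?S = "support r \<union> support s \<union> support (r \<oplus>\<^bsub>R\<^esub> s)"
  have S: "finite ?S" "?S \<subseteq> {g \<in> carrier G. \<pi> g = k}"
    using finite_support rR sR B_subset[OF rs] support_B[OF r] support_B[OF s] support_B[OF rs] by auto
  have g: "g \<in> carrier G" "\<pi> g = k" "component r g \<in> A g" "component s g \<in> A g" if "g \<in> ?S" for g
    using that S(2) component_in[OF rR] component_in[OF sR] by auto
  have D: "act descended h k x t = finprod (hc X (sec (h \<otimes>\<^bsub>H\<^esub> k))) (\<lambda>g. hact h k x g (component t g)) ?S"
    if "t = r \<or> t = s \<or> t = r \<oplus>\<^bsub>R\<^esub> s" for t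
    using that r s rs S by (intro act_descended[OF h k x]) auto
  have cl: "(\<lambda>g. hact h k x g (component r g)) \<in> ?S \<rightarrow> carrier (hc X (sec (h \<otimes>\<^bsub>H\<^esub> k)))"
    "(\<lambda>g. hact h k x g (component s g)) \<in> ?S \<rightarrow> carrier (hc X (sec (h \<otimes>\<^bsub>H\<^esub> k)))"
    using hact_closed[OF h g(1,2) x g(3)] hact_closed[OF h g(1,2) x g(4)] by blast+
  have "act descended h k x (r \<oplus>\<^bsub>R\<^esub> s) =
     finprod (hc X (sec (h \<otimes>\<^bsub>H\<^esub> k))) (\<lambda>g. hact h k x g (component r g) \<otimes>\<^bsub>hc X (sec (h \<otimes>\<^bsub>H\<^esub> k))\<^esub> hact h k x g (component s g)) ?S"
    unfolding D[of "r \<oplus>\<^bsub>R\<^esub> s", simplified]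
  proof (rule hk.finprod_cong'[OF refl])
    show "hact h k x g (component (r \<oplus>\<^bsub>R\<^esub> s) g) =
       hact h k x g (component r g) \<otimes>\<^bsub>hc X (sec (h \<otimes>\<^bsub>H\<^esub> k))\<^esub> hact h k x g (component s g)"
      if "g \<in> ?S" for g
      using hact_add_right[OF h g(1,2) x g(3,4)] g(1) component_add[OF rR sR] that by simp
  qed (use cl in auto)
  then show ?thesis using hk.finprod_multf[OF cl] D[of r] D[of s] by simp
qed

text \<open>Both sides are additive in r and in s, so two nested uses of \<open>B_induct\<close>
  reduce to homogeneous r and s, where associativity in X and the laws of T suffice.\<close>

lemma act_descended_mult:
  assumes h: "h \<in> carrier H" and k: "k \<in> carrier H" and l: "l \<in> carrier H"
    and x: "x \<in> carrier (hc X (sec h))" and r: "r \<in> B k" and s: "s \<in> B l"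
  shows "act descended (h \<otimes>\<^bsub>H\<^esub> k) l (act descended h k x r) s = act descended h (k \<otimes>\<^bsub>H\<^esub> l) x (r \<otimes>\<^bsub>R\<^esub> s)"
proof -
  have hk: "h \<otimes>\<^bsub>H\<^esub> k \<in> carrier H" and kl: "k \<otimes>\<^bsub>H\<^esub> l \<in> carrier H" using h k l by auto
  have hkl: "h \<otimes>\<^bsub>H\<^esub> (k \<otimes>\<^bsub>H\<^esub> l) = h \<otimes>\<^bsub>H\<^esub> k \<otimes>\<^bsub>H\<^esub> l" using h k l by (simp add: H.m_assoc)
  interpret hk: comm_group "hc X (sec (h \<otimes>\<^bsub>H\<^esub> k))" using hc_comm_group[OF X sec(1)] hk by simp
  interpret hkl: comm_group "hc X (sec (h \<otimes>\<^bsub>H\<^esub> k \<otimes>\<^bsub>H\<^esub> l))" using hc_comm_group[OF X sec(1)] hk l by simp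
  \<comment> \<open>Zero is homogeneous of every degree; viewing it in degree \<open>sec b\<close>,
    which lies over b, makes the homogeneous formula available.\<close>
  have act_zero': "act descended a b y \<zero>\<^bsub>R\<^esub> = \<one>\<^bsub>hc X (sec (a \<otimes>\<^bsub>H\<^esub> b))\<^esub>"
    if "a \<in> carrier H" "b \<in> carrier H" "y \<in> carrier (hc X (sec a))" for a b y
  proof -
    have "sec b \<in> carrier G" "\<pi> (sec b) = b" using sec that(2) by auto
    then show ?thesis
      using act_descended_homogeneous[OF that(1) _ that(3) A_zero, of "sec b"] hact_zero[OF that(1) _ refl that(3), of "sec b"]
      by simp
  qed
  from r show ?thesis
  proof (induction rule: B_induct)
    case zero
    have "act descended (h \<otimes>\<^bsub>H\<^esub> k) l \<one>\<^bsub>hc X (sec (h \<otimes>\<^bsub>H\<^esub> k))\<^esub> s = \<one>\<^bsub>hc X (sec (h \<otimes>\<^bsub>H\<^esub> k \<otimes>\<^bsub>H\<^esub> l))\<^esub>"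
      using act_descended_closed[OF hk l _ s] act_descended_add_left[OF hk l _ _ s]
      by (intro hom_one[OF homI hk.is_group hkl.is_group, where h="\<lambda>x. act descended (h \<otimes>\<^bsub>H\<^esub> k) l x s"]) auto
    then show ?case
      using act_zero' zero h k l kl x hkl B_subset[OF s]
      by simp
  next
    case (add r r')
    then show ?case
      using act_descended_closed[OF h k x] act_descended_add_right[OF h k x] act_descended_add_left[OF hk l _ _ s]
        act_descended_add_right[OF h kl x] B_mult[OF k l] s B_subset hkl
      by (simp add: R.l_distr)
  next
    case (homogeneous g r)
    note g = \<open>g \<in> carrier G\<close> and gk = \<open>\<pi> g = k\<close> and r = \<open>r \<in> A g\<close>
    note rB = A_sub_B[OF g r, unfolded gk] and rR = A_subset[OF g r]
    note xr = act_descended_closed[OF h k x rB]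
    from s show ?case
    proof (induction rule: B_induct)
      case zero
      then show ?case
        using act_zero' hk l xr h kl x hkl rR by simp
    next
      case (add s s')
      then show ?case
        using act_descended_add_right[OF hk l xr] act_descended_add_right[OF h kl x] B_mult[OF k l rB] B_subset rR hkl
        by (simp add: R.r_distr)
    next
      case (homogeneous g' s)
      note g' = \<open>g' \<in> carrier G\<close> and gl = \<open>\<pi> g' = l\<close> and s = \<open>s \<in> A g'\<close>
      have gg: "g \<otimes> g' \<in> carrier G" "\<pi> (g \<otimes> g') = k \<otimes>\<^bsub>H\<^esub> l" using g g' gk gl by (auto simp: \<pi>_mult)
      note a = hact_aux[OF h g gk] and a' = hact_aux[OF hk g' gl] and a'' = hact_aux[OF h gg]
      have as: "sec h \<otimes> (g \<otimes> g') = sec h \<otimes> g \<otimes> g'" using a(1) g g' by (simp add: G.m_assoc)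
      have 1: "act descended h k x r = hact h k x g r"
        using act_descended_homogeneous[OF h g x r] by (simp add: gk)
      have "act descended (h \<otimes>\<^bsub>H\<^esub> k) l (hact h k x g r) s = hact (h \<otimes>\<^bsub>H\<^esub> k) l (hact h k x g r) g' s"
        using act_descended_homogeneous[OF hk g' hact_closed[OF h g gk x r] s] by (simp add: gl)
      also have "\<dots> = T (sec (h \<otimes>\<^bsub>H\<^esub> k) \<otimes> g') (sec (h \<otimes>\<^bsub>H\<^esub> k \<otimes>\<^bsub>H\<^esub> l))
          (act X (sec (h \<otimes>\<^bsub>H\<^esub> k)) g' (hact h k x g r) s)"
        by (rule hact_def)
      \<comment> \<open>\<open>T_act\<close> moves the inner transport outside the multiplication by
        s. Associativity of the action on X then applies, and \<open>T_trans\<close> merges the two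
        transports.\<close>
      also have "act X (sec (h \<otimes>\<^bsub>H\<^esub> k)) g' (hact h k x g r) s =
         T (sec h \<otimes> g \<otimes> g') (sec (h \<otimes>\<^bsub>H\<^esub> k) \<otimes> g') (act X (sec h \<otimes> g) g' (act X (sec h) g x r) s)"
        unfolding hact_def by (rule T_act[OF a(2,3) g' a(4) act_closed[OF X a(1) g x r] s, symmetric])
      also have "act X (sec h \<otimes> g) g' (act X (sec h) g x r) s = act X (sec h) (g \<otimes> g') x (r \<otimes>\<^bsub>R\<^esub> s)"
        by (rule act_mult[OF X a(1) g g' x r s])
      also have "T (sec (h \<otimes>\<^bsub>H\<^esub> k) \<otimes> g') (sec (h \<otimes>\<^bsub>H\<^esub> k \<otimes>\<^bsub>H\<^esub> l))
          (T (sec h \<otimes> g \<otimes> g') (sec (h \<otimes>\<^bsub>H\<^esub> k) \<otimes> g') (act X (sec h) (g \<otimes> g') x (r \<otimes>\<^bsub>R\<^esub> s))) =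
        T (sec h \<otimes> g \<otimes> g') (sec (h \<otimes>\<^bsub>H\<^esub> k \<otimes>\<^bsub>H\<^esub> l)) (act X (sec h) (g \<otimes> g') x (r \<otimes>\<^bsub>R\<^esub> s))"
        using a a' g' h k act_closed[OF X a(1) gg(1) x A_mult[OF g g' r s]]
        by (intro T_trans) (auto simp: as \<pi>_mult)
      also have "\<dots> = hact h (k \<otimes>\<^bsub>H\<^esub> l) x (g \<otimes> g') (r \<otimes>\<^bsub>R\<^esub> s)"
        by (simp add: hact_def as hkl)
      also have "\<dots> = act descended h (k \<otimes>\<^bsub>H\<^esub> l) x (r \<otimes>\<^bsub>R\<^esub> s)"
        using act_descended_homogeneous[OF h gg(1) x A_mult[OF g g' r s]] by (simp add: gg(2))
      finally show ?case unfolding 1 .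
    qed
  qed
qed

lemma graded_module_descended: "graded_module H R B descended"
proof (rule grading.graded_moduleI[OF grading_B])
  fix h x assume h: "h \<in> carrier H" and "x \<in> carrier (hc descended h)"
  then have x: "x \<in> carrier (hc X (sec h))" by (simp add: hc_descended)
  have "act descended h (\<pi> \<one>) x \<one>\<^bsub>R\<^esub> = hact h (\<pi> \<one>) x \<one> \<one>\<^bsub>R\<^esub>"
    by (rule act_descended_homogeneous[OF h _ x one_homogeneous]) simp
  then show "act descended h \<one>\<^bsub>H\<^esub> x \<one>\<^bsub>R\<^esub> = x"
    using h x by (simp add: \<pi>_one hact_def sec act_one[OF X] T_refl)
next
  fix h assume "h \<in> carrier H"
  then show "comm_group (hc descended h)" by (simp add: hc_descended hc_comm_group[OF X] sec)
qed (auto simp: hc_descended act_descended_closed act_descended_add_left act_descended_add_right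
    act_descended_mult, auto simp: descended_def)

section \<open>Comparison of X with the restriction of the descended module\<close>

definition descent_map :: "'g \<Rightarrow> 'm \<Rightarrow> 'm" where
  "descent_map = (\<lambda>g\<in>carrier G. \<lambda>y\<in>carrier (hc X (sec (\<pi> g))). T (sec (\<pi> g)) g y)"

lemma hc_pullback_descended: "g \<in> carrier G \<Longrightarrow> hc (pullback G A \<pi> descended) g = hc X (sec (\<pi> g))"
  by (simp add: pullback_hc hc_descended \<pi>_closed)

text \<open>The action on the descended module ends with a transport to the representative of the
  fibre. Following it by the transport to g k is a single transport by \<open>T_trans\<close>, and
  \<open>T_act\<close> identifies this with acting after the transport to g.\<close>

lemma descent_map_hom: "descent_map \<in> gmod_hom G A (pullback G A \<pi> descended) X"
proof (rule gmod_homI)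
  fix g k y r assume g: "g \<in> carrier G" and k: "k \<in> carrier G" and r: "r \<in> A k"
    and "y \<in> carrier (hc (pullback G A \<pi> descended) g)"
  then have y: "y \<in> carrier (hc X (sec (\<pi> g)))" by (simp add: hc_pullback_descended)
  let ?s = "sec (\<pi> g)"
  note a = hact_aux[OF \<pi>_closed[OF g] k refl]
  have "act (pullback G A \<pi> descended) g k y r = act descended (\<pi> g) (\<pi> k) y r"
    using g k r y by (simp add: pullback_def hc_descended \<pi>_closed)
  also have "\<dots> = hact (\<pi> g) (\<pi> k) y k r" by (rule act_descended_homogeneous[OF \<pi>_closed[OF g] k y r])
  finally have 1: "act (pullback G A \<pi> descended) g k y r = hact (\<pi> g) (\<pi> k) y k r" .
  have "T (sec (\<pi> g \<otimes>\<^bsub>H\<^esub> \<pi> k)) (g \<otimes> k) (hact (\<pi> g) (\<pi> k) y k r) =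
      T (?s \<otimes> k) (g \<otimes> k) (act X ?s k y r)"
    unfolding hact_def using a g k y r
    by (intro T_trans act_closed[OF X]) (auto simp: \<pi>_mult sec \<pi>_closed)
  also have "\<dots> = act X g k (T ?s g y) r"
    using a g k y r by (intro T_act) (auto simp: sec \<pi>_closed)
  finally show "descent_map (g \<otimes> k) (act (pullback G A \<pi> descended) g k y r) = act X g k (descent_map g y) r"
    using g k y hact_closed[OF \<pi>_closed[OF g] k refl y r] by (simp add: descent_map_def 1 \<pi>_mult)
qed (auto simp: descent_map_def hc_pullback_descended sec \<pi>_closed T_closed T_mult hc_mult[OF X])

lemma descent_map_bij:
  assumes g: "g \<in> carrier G"
  shows "bij_betw (descent_map g) (carrier (hc (pullback G A \<pi> descended) g)) (carrier (hc X g))"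
proof (rule bij_betw_byWitness[of _ "T g (sec (\<pi> g))"])
  note s = sec[OF \<pi>_closed[OF g]]
  show "\<forall>a\<in>carrier (hc (pullback G A \<pi> descended) g). T g (sec (\<pi> g)) (descent_map g a) = a"
    using g s by (auto simp: hc_pullback_descended descent_map_def T_trans T_refl)
  show "\<forall>a\<in>carrier (hc X g). descent_map g (T g (sec (\<pi> g)) a) = a"
    using g s by (auto simp: descent_map_def T_trans T_refl T_closed)
  show "descent_map g ` carrier (hc (pullback G A \<pi> descended) g) \<subseteq> carrier (hc X g)"
    using g s by (auto simp: hc_pullback_descended descent_map_def T_closed)
  show "T g (sec (\<pi> g)) ` carrier (hc X g) \<subseteq> carrier (hc (pullback G A \<pi> descended) g)"
    using g s by (auto simp: hc_pullback_descended T_closed)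
qed

text \<open>This is the equivariance of the comparison map: since \<Theta> carries identities, the
  structure maps of X must take its value in degree g to its value in degree k on the same
  element.\<close>

lemma descent_map_transport:
  assumes g: "g \<in> carrier G" and k: "k \<in> carrier G" and gk: "\<pi> g = \<pi> k"
    and y: "y \<in> carrier (hc (pullback G A \<pi> descended) g)"
  shows "T g k (descent_map g y) = descent_map k y"
  using assms by (simp add: hc_pullback_descended descent_map_def T_trans sec \<pi>_closed)

end

section \<open>Essential surjectivity of \<Theta>\<close>

context grading_hom
begin

text \<open>The structure maps of X are rewritten as descent data and the comparison map is shown to
  be equivariant. The last conjunct records an isomorphism of underlying modules, the form in which
  finite presentation is transferred later.\<close>

lemma Theta_essentially_surjective:
  assumes surj: "\<pi> ` carrier G = carrier H"
    and ob: "X \<in> Obj (equivariant_cat N (Mod_cat TYPE('m) G R A) (shift_action G))"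
  shows "\<exists>Y. graded_module H R B Y \<and>
    (\<exists>e. is_iso (equivariant_cat N (Mod_cat TYPE('m) G R A) (shift_action G)) (fob (Theta G H A \<pi>) Y) X e) \<and>
    (\<exists>e. is_iso (Mod_cat TYPE('m) G R A) (pullback G A \<pi> Y) (fst X) e)"
proof -
  let ?C = "Mod_cat TYPE('m) G R A"
  obtain M \<alpha> where MX: "X = (M, \<alpha>)" by fastforce
  have M: "graded_module G R A M" using equivariant_objD(1)[OF ob] by (simp add: MX)
  have iso: "is_iso ?C M (shift G (inv n) M) (\<alpha> n)" if "n \<in> kernel G H \<pi>" for n
    using ob that by (simp add: MX equivariant_cat_def shift_action_def shift_functor_def)
  then have \<alpha>: "\<alpha> n \<in> gmod_hom G A M (shift G (inv n) M)" if "n \<in> kernel G H \<pi>" for n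
    using that by (auto simp: is_iso_def)
  have cocycle: "\<alpha> (n \<otimes> m) g x = \<alpha> m (inv n \<otimes> g) (\<alpha> n g x)"
    if "n \<in> kernel G H \<pi>" "m \<in> kernel G H \<pi>" "g \<in> carrier G" "x \<in> carrier (hc M g)" for n m g x
  proof -
    have "\<alpha> (n \<otimes> m) = (\<lambda>g\<in>carrier G. compose (carrier (hc M g)) (\<lambda>x. \<alpha> m (inv n \<otimes> g) x) (\<alpha> n g))"
      using ob that(1,2) by (simp add: MX equivariant_cat_def shift_action_def shift_functor_def cong: restrict_cong)
    then show ?thesis using that by (simp add: compose_def)
  qed
  \<comment> \<open>The target of \<alpha> at n in degree g is X in degree n^-1 g, and n = g k^-1 is
    the element for which this degree is k.\<close>
  define T where "T g k = \<alpha> (g \<otimes> inv k) g" for g k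
  have n: "g \<otimes> inv k \<in> kernel G H \<pi>" "inv (g \<otimes> inv k) \<otimes> g = k"
    "hc (shift G (inv (g \<otimes> inv k)) M) g = hc M k"
    if "g \<in> carrier G" "k \<in> carrier G" "\<pi> g = \<pi> k" for g k
    using that \<pi>_closed[of k] by (simp_all add: kernel_iff \<pi>_mult \<pi>_inv G.inv_mult_group G.m_assoc shift_def)
  have inv_rule: "a \<otimes> inv b \<otimes> (b \<otimes> inv c) = a \<otimes> inv c"
    if "a \<in> carrier G" "b \<in> carrier G" "c \<in> carrier G" for a b c
  proof -
    have "inv b \<otimes> (b \<otimes> inv c) = inv c"
      using that by (simp add: G.m_assoc[symmetric])
    then show ?thesis using that by (simp add: G.m_assoc)
  qed
  have trans: "T k l (T g k x) = T g l x"
    if "g \<in> carrier G" "k \<in> carrier G" "l \<in> carrier G" "\<pi> g = \<pi> k" "\<pi> k = \<pi> l" "x \<in> carrier (hc M g)" for g k l x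
    using cocycle[OF n(1)[OF that(1,2,4)] n(1)[OF that(2,3,5)] that(1,6)]
    unfolding n(2)[OF that(1,2,4)] inv_rule[OF that(1-3)] T_def by (rule sym)
  have closed: "T g k x \<in> carrier (hc M k)"
    if "g \<in> carrier G" "k \<in> carrier G" "\<pi> g = \<pi> k" "x \<in> carrier (hc M g)" for g k x
    using gmod_hom_closed[OF \<alpha>[OF n(1)[OF that(1-3)]] that(1,4)] n(3)[OF that(1-3)] by (simp add: T_def)
  have mult: "T g k (x \<otimes>\<^bsub>hc M g\<^esub> y) = T g k x \<otimes>\<^bsub>hc M k\<^esub> T g k y"
    if "g \<in> carrier G" "k \<in> carrier G" "\<pi> g = \<pi> k" "x \<in> carrier (hc M g)" "y \<in> carrier (hc M g)" for g k x y
    using gmod_hom_mult[OF \<alpha>[OF n(1)[OF that(1-3)]] that(1,4,5)] n(3)[OF that(1-3)] by (simp add: T_def)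
  \<comment> \<open>The cocycle condition makes \<open>T g g\<close> idempotent, and it is injective
    as a component of an isomorphism, so it is the identity.\<close>
  have refl: "T g g x = x" if "g \<in> carrier G" "x \<in> carrier (hc M g)" for g x
  proof -
    have "inj_on (T g g) (carrier (hc M g))"
      using is_iso_Mod_catD[OF iso[OF n(1)[OF that(1,1) HOL.refl]] that(1)] by (simp add: T_def bij_betw_def)
    then show ?thesis
      using trans[OF that(1,1,1) HOL.refl HOL.refl that(2)] closed[OF that(1,1) HOL.refl] that(2)
      by (auto dest: inj_onD)
  qed
  have act: "T (g \<otimes> l) (k \<otimes> l) (act M g l x r) = act M k l (T g k x) r"
    if that': "g \<in> carrier G" "k \<in> carrier G" "l \<in> carrier G" "\<pi> g = \<pi> k" "x \<in> carrier (hc M g)" "r \<in> A l" for g k l x r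
  proof -
    \<comment> \<open>The transports from g to k and from g l to k l are components of the same
      structure map, so linearity of that map gives the claim.\<close>
    have "g \<otimes> l \<otimes> inv (k \<otimes> l) = g \<otimes> inv k"
      using that by (simp add: G.inv_mult_group G.m_assoc) (simp add: G.m_assoc[symmetric])
    then show ?thesis
      using gmod_hom_act[OF \<alpha>[OF n(1)[OF that(1,2,4)]] that(1,3,5,6)] n(2)[OF that(1,2,4)] that(1)
      by (simp add: T_def shift_def)
  qed
  interpret descent_data G R A H \<pi> M T
  proof (intro descent_data.intro descent_data_axioms.intro)
    show "grading_hom G R A H \<pi>" by (rule grading_hom_axioms)
  qed (rule surj M | (rule closed mult refl trans act; assumption))+
  note Y = graded_module_descended and Y' = graded_module_pullback[OF graded_module_descended]
  have iso': "is_iso ?C (pullback G A \<pi> descended) M descent_map"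
    by (rule is_iso_Mod_catI[OF Y' M descent_map_hom descent_map_bij])
  \<comment> \<open>Conversely every component of a structure map is a transport, from g to n^-1 g,
    so the equivariance square becomes \<open>descent_map_transport\<close>.\<close>
  have \<alpha>T: "\<alpha> n g = T g (inv n \<otimes> g)" if "n \<in> kernel G H \<pi>" "g \<in> carrier G" for n g
  proof -
    have "g \<otimes> inv (inv n \<otimes> g) = n"
      using that by (simp add: kernel_iff G.inv_mult_group G.m_assoc[symmetric])
    then show ?thesis by (simp add: T_def)
  qed
  have "descent_map \<in> Arr (equivariant_cat N ?C (shift_action G)) (fob (Theta G H A \<pi>) descended) X"
  proof -
    have "Cmp ?C (pullback G A \<pi> descended) M (shift G (inv n) M) (\<alpha> n) descent_map =
       Cmp ?C (pullback G A \<pi> descended) (pullback G A \<pi> descended) (shift G (inv n) M)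
         (\<lambda>g\<in>carrier G. descent_map (inv n \<otimes> g))
         (\<lambda>g\<in>carrier G. \<lambda>y\<in>carrier (hc (pullback G A \<pi> descended) g). y)"
      if nk: "n \<in> kernel G H \<pi>" for n
    proof -
      have ng: "\<pi> g = \<pi> (inv n \<otimes> g)" "inv n \<otimes> g \<in> carrier G" if "g \<in> carrier G" for g
        using nk that by (simp_all add: kernel_iff \<pi>_mult \<pi>_inv \<pi>_closed)
      have "\<alpha> n g (descent_map g y) = descent_map (inv n \<otimes> g) y"
        if "g \<in> carrier G" "y \<in> carrier (hc (pullback G A \<pi> descended) g)" for g y
        unfolding \<alpha>T[OF nk that(1)] by (rule descent_map_transport[OF that(1) ng(2)[OF that(1)] ng(1)[OF that(1)] that(2)])
      then show ?thesis by (auto simp: fun_eq_iff compose_def restrict_def)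
    qed
    then show ?thesis
      using descent_map_hom
      by (simp add: MX shift_pullback del: Mod_cat_simps(3)) (simp add: shift_action_def shift_functor_def)
  qed
  then have "is_iso (equivariant_cat N ?C (shift_action G)) (fob (Theta G H A \<pi>) descended) X descent_map"
    using iso' strict_action_shift[OF subgroup_kernel]
    by (intro is_iso_equivariant is_category_Mod_cat Theta_object[OF Y] ob) (auto simp: MX strict_action_def)
  then show ?thesis using Y iso' MX by auto
qed

end

section \<open>Finite presentation\<close>

text \<open>The graded submodule generated by E. Generators are pairs of a degree and an element
  because carriers of different degrees may overlap. In a graded module inverses arise from the
  action of -1, which has degree one.\<close>

inductive gspan ::
    "('g, 'z) monoid_scheme \<Rightarrow> ('g \<Rightarrow> 'r set) \<Rightarrow> ('g, 'm, 'r) gmod \<Rightarrow> ('g \<times> 'm) set \<Rightarrow> 'g \<Rightarrow> 'm \<Rightarrow> bool"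
  for G A X E where
  generator: "(g, x) \<in> E \<Longrightarrow> gspan G A X E g x"
| one: "g \<in> carrier G \<Longrightarrow> gspan G A X E g \<one>\<^bsub>hc X g\<^esub>"
| mult: "gspan G A X E g x \<Longrightarrow> gspan G A X E g y \<Longrightarrow> gspan G A X E g (x \<otimes>\<^bsub>hc X g\<^esub> y)"
| act: "gspan G A X E g x \<Longrightarrow> k \<in> carrier G \<Longrightarrow> r \<in> A k \<Longrightarrow>
    gspan G A X E (g \<otimes>\<^bsub>G\<^esub> k) (act X g k x r)"

definition homogeneous_elements ::
    "('g, 'z) monoid_scheme \<Rightarrow> ('g, 'm, 'r) gmod \<Rightarrow> ('g \<times> 'm) set" where
  "homogeneous_elements G X = (SIGMA g:carrier G. carrier (hc X g))"

text \<open>Stated for a family of subsets, one in each degree, so that it covers kernels and whole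
  modules alike and can be reindexed along \<pi>.\<close>

definition fin_gen ::
    "('g, 'z) monoid_scheme \<Rightarrow> ('g \<Rightarrow> 'r set) \<Rightarrow> ('g, 'm, 'r) gmod \<Rightarrow> ('g \<Rightarrow> 'm set) \<Rightarrow> bool" where
  "fin_gen G A X K \<longleftrightarrow> (\<exists>E. finite E \<and> E \<subseteq> homogeneous_elements G X \<and>
     (\<forall>g\<in>carrier G. \<forall>x. x \<in> K g \<longleftrightarrow> gspan G A X E g x))"

definition map_homogeneous :: "('g \<Rightarrow> 'm \<Rightarrow> 'n) \<Rightarrow> ('g \<times> 'm) set \<Rightarrow> ('g \<times> 'n) set" where
  "map_homogeneous f E = (\<lambda>(g, x). (g, f g x)) ` E"

lemma gspan_trans:
  "gspan G A X E g x \<Longrightarrow> (\<And>g x. (g, x) \<in> E \<Longrightarrow> gspan G A X E' g x) \<Longrightarrow> gspan G A X E' g x"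
  by (induction rule: gspan.induct) (auto intro: gspan.intros)

lemma gspan_mono: "gspan G A X E g x \<Longrightarrow> E \<subseteq> E' \<Longrightarrow> gspan G A X E' g x"
  by (rule gspan_trans) (auto intro: gspan.generator)

context grading
begin

lemma gspan_closed:
  assumes X: "graded_module G R A X" and E: "E \<subseteq> homogeneous_elements G X"
  shows "gspan G A X E g x \<Longrightarrow> g \<in> carrier G \<and> x \<in> carrier (hc X g)"
proof (induction rule: gspan.induct)
  case (generator g x)
  then show ?case using E by (auto simp: homogeneous_elements_def)
qed (auto simp: hc_one[OF X] hc_mult[OF X] act_closed[OF X])

lemma map_homogeneous_subset:
  "f \<in> gmod_hom G A X Y \<Longrightarrow> E \<subseteq> homogeneous_elements G X \<Longrightarrow>
   map_homogeneous f E \<subseteq> homogeneous_elements G Y"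
  by (auto simp: map_homogeneous_def homogeneous_elements_def intro: gmod_hom_closed)

lemma gspan_image:
  assumes X: "graded_module G R A X" and Y: "graded_module G R A Y" and f: "f \<in> gmod_hom G A X Y"
    and E: "E \<subseteq> homogeneous_elements G X"
  shows "gspan G A X E g x \<Longrightarrow> gspan G A Y (map_homogeneous f E) g (f g x)"
proof (induction rule: gspan.induct)
  case (generator g x)
  then show ?case by (intro gspan.generator) (auto simp: map_homogeneous_def)
next
  case (one g)
  then show ?case using gmod_hom_one[OF X Y f] by (simp add: gspan.one)
next
  case (mult g x y)
  then have "f g (x \<otimes>\<^bsub>hc X g\<^esub> y) = f g x \<otimes>\<^bsub>hc Y g\<^esub> f g y"
    using gspan_closed[OF X E] gmod_hom_mult[OF f, of g x y] by simp
  then show ?case using gspan.mult[OF mult(3,4)] by simp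
next
  case (act g x k r)
  then have "f (g \<otimes> k) (act X g k x r) = act Y g k (f g x) r"
    using gspan_closed[OF X E] gmod_hom_act[OF f, of g k x r] by simp
  then show ?case using gspan.act[OF act(4,2,3)] by simp
qed

text \<open>Each step that builds y from images of generators can be repeated with the generators
  themselves, since f respects sums and the action. In particular no surjectivity of f enters: the
  preimage is found inside the span of E.\<close>

lemma gspan_lift:
  assumes X: "graded_module G R A X" and Y: "graded_module G R A Y" and f: "f \<in> gmod_hom G A X Y"
    and E: "E \<subseteq> homogeneous_elements G X"
  shows "gspan G A Y (map_homogeneous f E) g y \<Longrightarrow> \<exists>x. gspan G A X E g x \<and> f g x = y"
proof (induction rule: gspan.induct)
  case (generator g y)
  then show ?case by (auto simp: map_homogeneous_def intro: gspan.generator)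
next
  case (one g)
  then show ?case using gmod_hom_one[OF X Y f one] gspan.one[OF one] by (intro exI conjI)
next
  case (mult g y y')
  then obtain x x' where x: "gspan G A X E g x" "f g x = y" "gspan G A X E g x'" "f g x' = y'" by blast
  then have "f g (x \<otimes>\<^bsub>hc X g\<^esub> x') = y \<otimes>\<^bsub>hc Y g\<^esub> y'"
    using gspan_closed[OF X E] gmod_hom_mult[OF f, of g x x'] by simp
  then show ?case using gspan.mult[OF x(1,3)] by (intro exI conjI)
next
  case (act g y k r)
  then obtain x where x: "gspan G A X E g x" "f g x = y" by blast
  then have "f (g \<otimes> k) (act X g k x r) = act Y g k y r"
    using gspan_closed[OF X E] gmod_hom_act[OF f, of g k x r] act by simp
  then show ?case using gspan.act[OF x(1) act(2,3)] by (intro exI conjI)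
qed

lemma gmod_hom_eq_on_gspan:
  assumes X: "graded_module G R A X" and Y: "graded_module G R A Y"
    and f: "f \<in> gmod_hom G A X Y" and f': "f' \<in> gmod_hom G A X Y"
    and E: "E \<subseteq> homogeneous_elements G X" and eq: "\<And>g x. (g, x) \<in> E \<Longrightarrow> f g x = f' g x"
  shows "gspan G A X E g x \<Longrightarrow> f g x = f' g x"
proof (induction rule: gspan.induct)
  case (generator g y)
  then show ?case by (rule eq)
next
  case (one g)
  then show ?case using gmod_hom_one[OF X Y f] gmod_hom_one[OF X Y f'] by simp
next
  case (mult g y y')
  then show ?case
    using gspan_closed[OF X E] gmod_hom_mult[OF f, of g y y'] gmod_hom_mult[OF f', of g y y'] by simp
next
  case (act g y k r)
  then show ?case
    using gspan_closed[OF X E] gmod_hom_act[OF f, of g k y r] gmod_hom_act[OF f', of g k y r] by simp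
qed

text \<open>On the generators f agrees with the zero morphism, hence on their span.\<close>

lemma gspan_in_kernel:
  assumes X: "graded_module G R A X" and Y: "graded_module G R A Y" and f: "f \<in> gmod_hom G A X Y"
    and E: "E \<subseteq> homogeneous_elements G X" and ker: "\<And>g x. (g, x) \<in> E \<Longrightarrow> f g x = \<one>\<^bsub>hc Y g\<^esub>"
    and x: "gspan G A X E g x"
  shows "f g x = \<one>\<^bsub>hc Y g\<^esub>"
proof -
  have "f g x = (\<lambda>g\<in>carrier G. \<lambda>x\<in>carrier (hc X g). \<one>\<^bsub>hc Y g\<^esub>) g x"
    using E ker
    by (intro gmod_hom_eq_on_gspan[OF X Y f gmod_hom_trivial[OF X Y] E _ x])
      (auto simp: homogeneous_elements_def)
  then show ?thesis using gspan_closed[OF X E x] by simp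
qed

section \<open>Free graded modules\<close>

lemma hc_free:
  assumes g: "g \<in> carrier G"
  shows "carrier (hc (free_gmod G R A n d) g) = (\<Pi>\<^sub>E i\<in>{..<n}. A (d i \<otimes> g))"
    "x \<otimes>\<^bsub>hc (free_gmod G R A n d) g\<^esub> y = (\<lambda>i\<in>{..<n}. x i \<oplus>\<^bsub>R\<^esub> y i)"
    "\<one>\<^bsub>hc (free_gmod G R A n d) g\<^esub> = (\<lambda>i\<in>{..<n}. \<zero>\<^bsub>R\<^esub>)"
  using g by (simp_all add: free_gmod_def)

lemma act_free:
  assumes "g \<in> carrier G" "k \<in> carrier G" "v \<in> carrier (hc (free_gmod G R A n d) g)" "r \<in> A k"
  shows "act (free_gmod G R A n d) g k v r = (\<lambda>i\<in>{..<n}. v i \<otimes>\<^bsub>R\<^esub> r)"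
  using assms hc_free(1) by (simp add: free_gmod_def)

lemma graded_module_free:
  assumes d: "d \<in> {..<n} \<rightarrow> carrier G"
  shows "graded_module G R A (free_gmod G R A n d)" (is "graded_module G R A ?F")
proof (rule graded_moduleI)
  have dg: "d i \<otimes> g \<in> carrier G" if "i < n" "g \<in> carrier G" for i g using d that by auto
  have vR: "v i \<in> carrier R" if "v \<in> (\<Pi>\<^sub>E i\<in>{..<n}. A (d i \<otimes> g))" "i < n" "g \<in> carrier G" for v i g
    using A_subset[OF dg[OF that(2,3)]] that(1,2) by auto
  have vr: "(\<lambda>i\<in>{..<n}. v i \<otimes>\<^bsub>R\<^esub> r) \<in> (\<Pi>\<^sub>E i\<in>{..<n}. A (d i \<otimes> (g \<otimes> k)))"
    if "v \<in> (\<Pi>\<^sub>E i\<in>{..<n}. A (d i \<otimes> g))" "g \<in> carrier G" "k \<in> carrier G" "r \<in> A k" for v g k r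
  proof
    fix i assume "i \<in> {..<n}"
    then show "(\<lambda>i\<in>{..<n}. v i \<otimes>\<^bsub>R\<^esub> r) i \<in> A (d i \<otimes> (g \<otimes> k))"
      using A_mult[of "d i \<otimes> g" k "v i" r] dg[of i g] that d by (auto simp: G.m_assoc Pi_iff)
  qed auto
  fix g assume g: "g \<in> carrier G"
  have fac: "group ((add_monoid R)\<lparr>carrier := A (d i \<otimes> g)\<rparr>)" if "i \<in> {..<n}" for i
    using graded_ring.A_subgroup[OF graded dg[of i g]] that g R.add.is_group
    by (intro subgroup.subgroup_is_group additive_subgroup.a_subgroup) auto
  have "hc ?F g = product_group {..<n} (\<lambda>i. (add_monoid R)\<lparr>carrier := A (d i \<otimes> g)\<rparr>)"
    using g by (simp add: free_gmod_def)
  then have grp: "group (hc ?F g)" using product_group[OF fac] by (simp only:)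
  show "comm_group (hc ?F g)"
  proof (rule group.group_comm_groupI[OF grp])
    fix x y assume "x \<in> carrier (hc ?F g)" "y \<in> carrier (hc ?F g)"
    then show "x \<otimes>\<^bsub>hc ?F g\<^esub> y = y \<otimes>\<^bsub>hc ?F g\<^esub> x"
      using g vR[OF _ _ g] by (auto simp: hc_free R.a_comm intro!: restrict_ext)
  qed
  {
    fix v assume "v \<in> carrier (hc ?F g)"
    then show "act ?F g \<one> v \<one>\<^bsub>R\<^esub> = v"
      using g vR[OF _ _ g] one_homogeneous
      by (subst act_free) (auto simp: hc_free fun_eq_iff restrict_def PiE_iff extensional_def)
  }
  fix k assume k: "k \<in> carrier G"
  note gk = G.m_closed[OF g k]
  fix v r assume v: "v \<in> carrier (hc ?F g)" and r: "r \<in> A k"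
  note v' = v[unfolded hc_free(1)[OF g]]
  note rR = A_subset[OF k r]
  show vrF: "act ?F g k v r \<in> carrier (hc ?F (g \<otimes> k))"
    using vr[OF v' g k r] by (simp add: act_free[OF g k v r] hc_free(1)[OF gk])
  {
    fix w assume w: "w \<in> carrier (hc ?F g)"
    note w' = w[unfolded hc_free(1)[OF g]]
    have vw: "v \<otimes>\<^bsub>hc ?F g\<^esub> w \<in> carrier (hc ?F g)"
      using monoid.m_closed[OF group.is_monoid[OF grp] v w] .
    show "act ?F g k (v \<otimes>\<^bsub>hc ?F g\<^esub> w) r = act ?F g k v r \<otimes>\<^bsub>hc ?F (g \<otimes> k)\<^esub> act ?F g k w r"
      unfolding act_free[OF g k v r] act_free[OF g k w r] act_free[OF g k vw r]
      unfolding hc_free(2)[OF gk] hc_free(2)[OF g]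
      using vR[OF v' _ g] vR[OF w' _ g] rR by (auto intro!: restrict_ext simp: R.l_distr)
  }
  {
    fix s assume s: "s \<in> A k"
    show "act ?F g k v (r \<oplus>\<^bsub>R\<^esub> s) = act ?F g k v r \<otimes>\<^bsub>hc ?F (g \<otimes> k)\<^esub> act ?F g k v s"
      unfolding act_free[OF g k v r] act_free[OF g k v s] act_free[OF g k v A_add[OF k r s]] hc_free(2)[OF gk]
      using vR[OF v' _ g] rR A_subset[OF k s] by (auto intro!: restrict_ext simp: R.r_distr)
  }
  fix l s assume l: "l \<in> carrier G" and s: "s \<in> A l"
  show "act ?F (g \<otimes> k) l (act ?F g k v r) s = act ?F g (k \<otimes> l) v (r \<otimes>\<^bsub>R\<^esub> s)"
    unfolding act_free[OF gk l vrF s] act_free[OF g G.m_closed[OF k l] v A_mult[OF k l r s]]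
    using vR[OF v' _ g] rR A_subset[OF l s]
    by (auto intro!: restrict_ext simp: R.m_assoc act_free[OF g k v r])
next
  show "hc ?F \<in> extensional (carrier G)" by (simp add: free_gmod_def)
next
  fix g k v r assume "\<not> (g \<in> carrier G \<and> k \<in> carrier G \<and> v \<in> carrier (hc ?F g) \<and> r \<in> A k)"
  then have "\<not> (g \<in> carrier G \<and> k \<in> carrier G \<and> v \<in> (\<Pi>\<^sub>E i\<in>{..<n}. A (d i \<otimes> g)) \<and> r \<in> A k)"
    using hc_free(1)[of g n d] by blast
  then show "act ?F g k v r = undefined" unfolding free_gmod_def gmod.simps by (rule if_not_P)
qed

definition free_basis :: "nat \<Rightarrow> nat \<Rightarrow> nat \<Rightarrow> 'r" where
  "free_basis n i = (\<lambda>j\<in>{..<n}. if j = i then \<one>\<^bsub>R\<^esub> else \<zero>\<^bsub>R\<^esub>)"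

text \<open>The i-th unit vector sits in degree \<open>inv d i\<close>: the i-th factor in degree g
  is \<open>A (d i \<otimes> g)\<close>, and the unit of the ring lies in
  \<open>A \<one>\<close>.\<close>

definition free_generators :: "nat \<Rightarrow> (nat \<Rightarrow> 'g) \<Rightarrow> ('g \<times> (nat \<Rightarrow> 'r)) set" where
  "free_generators n d = (\<lambda>i. (inv d i, free_basis n i)) ` {..<n}"

context
  fixes n :: nat and d :: "nat \<Rightarrow> 'g"
  assumes d: "d \<in> {..<n} \<rightarrow> carrier G"
begin

lemma free_degree: "i < n \<Longrightarrow> d i \<in> carrier G"
  using d by auto

lemma free_basis_in: "i < n \<Longrightarrow> free_basis n i \<in> carrier (hc (free_gmod G R A n d) (inv d i))"
  using one_homogeneous free_degree
  by (auto simp: hc_free free_basis_def intro!: A_zero)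

lemma free_generators_subset: "free_generators n d \<subseteq> homogeneous_elements G (free_gmod G R A n d)"
  using free_basis_in free_degree by (auto simp: free_generators_def homogeneous_elements_def)

lemma free_component: "\<lbrakk>g \<in> carrier G; v \<in> carrier (hc (free_gmod G R A n d) g); i < n\<rbrakk> \<Longrightarrow> v i \<in> A (d i \<otimes> g)"
  by (auto simp: hc_free)

lemma act_free_basis:
  assumes g: "g \<in> carrier G" and i: "i < n" and r: "r \<in> A (d i \<otimes> g)"
  shows "act (free_gmod G R A n d) (inv d i) (d i \<otimes> g) (free_basis n i) r = (\<lambda>j\<in>{..<n}. if j = i then r else \<zero>\<^bsub>R\<^esub>)"
  using assms free_degree[OF i] A_subset[of "d i \<otimes> g" r] free_basis_in[OF i]
  by (auto simp: act_free free_basis_def fun_eq_iff restrict_def)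

lemma free_generated:
  assumes g: "g \<in> carrier G" and v: "v \<in> carrier (hc (free_gmod G R A n d) g)"
  shows "gspan G A (free_gmod G R A n d) (free_generators n d) g v"
proof -
  let ?F = "free_gmod G R A n d" and ?E = "free_generators n d"
  have vi: "v i \<in> A (d i \<otimes> g)" "v i \<in> carrier R" if "i < n" for i
    using free_component[OF g v that] A_subset[of "d i \<otimes> g" "v i"] free_degree[OF that] g by auto
  have truncated: "gspan G A ?F ?E g (\<lambda>j\<in>{..<n}. if j < m then v j else \<zero>\<^bsub>R\<^esub>)" if "m \<le> n" for m
    using that
  proof (induction m)
    case 0
    then show ?case using gspan.one[OF g, of A ?F ?E] by (simp add: hc_free[OF g] restrict_def)
  next
    case (Suc m)
    then have m: "m < n" by simp
    have dm: "d m \<in> carrier G" by (rule free_degree[OF m])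
    have "gspan G A ?F ?E (inv d m) (free_basis n m)"
      using m by (intro gspan.generator) (auto simp: free_generators_def)
    from gspan.act[OF this _ vi(1)[OF m]] have
      b: "gspan G A ?F ?E (inv d m \<otimes> (d m \<otimes> g)) (\<lambda>j\<in>{..<n}. if j = m then v m else \<zero>\<^bsub>R\<^esub>)"
      using dm g by (simp add: act_free_basis[OF g m vi(1)[OF m]])
    have c: "inv d m \<otimes> (d m \<otimes> g) = g" using dm g by (simp add: G.m_assoc[symmetric])
    have "gspan G A ?F ?E g ((\<lambda>j\<in>{..<n}. if j < m then v j else \<zero>\<^bsub>R\<^esub>) \<otimes>\<^bsub>hc ?F g\<^esub> (\<lambda>j\<in>{..<n}. if j = m then v m else \<zero>\<^bsub>R\<^esub>))"
      using gspan.mult[OF Suc.IH[OF less_imp_le[OF m]] b[unfolded c]] .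
    moreover have "(\<lambda>j\<in>{..<n}. if j < m then v j else \<zero>\<^bsub>R\<^esub>) \<otimes>\<^bsub>hc ?F g\<^esub> (\<lambda>j\<in>{..<n}. if j = m then v m else \<zero>\<^bsub>R\<^esub>)
       = (\<lambda>j\<in>{..<n}. if j < Suc m then v j else \<zero>\<^bsub>R\<^esub>)"
      unfolding hc_free(2)[OF g] using vi(2) by (intro restrict_ext) auto
    ultimately show ?case by (simp only:)
  qed
  have "(\<lambda>j\<in>{..<n}. if j < n then v j else \<zero>\<^bsub>R\<^esub>) = v"
    using v by (auto simp: hc_free[OF g] fun_eq_iff PiE_iff extensional_def)
  then show ?thesis using truncated[of n] by simp
qed

text \<open>A vector v of degree g must go to the sum of the products of \<open>x i\<close> with
  \<open>v i\<close>. Since \<open>v i\<close> has degree d_i g and \<open>x i\<close> degree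
  d_i^-1, all summands lie in degree g.\<close>

lemma free_universal:
  assumes X: "graded_module G R A X" and x: "\<And>i. i < n \<Longrightarrow> x i \<in> carrier (hc X (inv d i))"
  shows "\<exists>p\<in>gmod_hom G A (free_gmod G R A n d) X. \<forall>i<n. p (inv d i) (free_basis n i) = x i"
proof -
  let ?F = "free_gmod G R A n d"
  let ?t = "\<lambda>g v i. act X (inv d i) (d i \<otimes> g) (x i) (v i)"
  let ?p = "\<lambda>g\<in>carrier G. \<lambda>v\<in>carrier (hc ?F g). finprod (hc X g) (?t g v) {..<n}"
  note F = graded_module_free[OF d]
  have cancel: "inv d i \<otimes> (d i \<otimes> g) = g" if "i < n" "g \<in> carrier G" for i g
    using free_degree[OF that(1)] that(2) by (simp add: G.m_assoc[symmetric])
  have t: "?t g v i \<in> carrier (hc X g)" if "g \<in> carrier G" "v \<in> carrier (hc ?F g)" "i < n" for g v i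
    using act_closed[OF X _ _ x[OF that(3)] free_component[OF that]] cancel[OF that(3,1)] free_degree[OF that(3)] that(1)
    by simp
  have "?p \<in> gmod_hom G A ?F X"
  proof (rule gmod_homI)
    fix g v assume g: "g \<in> carrier G" and v: "v \<in> carrier (hc ?F g)"
    interpret g: comm_group "hc X g" using hc_comm_group[OF X g] .
    note tv = t[OF g v]
    show "?p g v \<in> carrier (hc X g)" using g v tv by (auto intro!: g.finprod_closed)
    {
      fix w assume w: "w \<in> carrier (hc ?F g)"
      note tw = t[OF g w]
      have "?t g (v \<otimes>\<^bsub>hc ?F g\<^esub> w) i = ?t g v i \<otimes>\<^bsub>hc X g\<^esub> ?t g w i" if "i < n" for i
        using act_add_right[OF X _ _ x[OF that] free_component[OF g v that] free_component[OF g w that]]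
          cancel[OF that g] free_degree[OF that] g that
        by (simp add: hc_free[OF g])
      then have "finprod (hc X g) (?t g (v \<otimes>\<^bsub>hc ?F g\<^esub> w)) {..<n} =
        finprod (hc X g) (\<lambda>i. ?t g v i \<otimes>\<^bsub>hc X g\<^esub> ?t g w i) {..<n}"
        using tv tw by (intro g.finprod_cong') auto
      also have "\<dots> = finprod (hc X g) (?t g v) {..<n} \<otimes>\<^bsub>hc X g\<^esub> finprod (hc X g) (?t g w) {..<n}"
        using tv tw by (intro g.finprod_multf) auto
      finally show "?p g (v \<otimes>\<^bsub>hc ?F g\<^esub> w) = ?p g v \<otimes>\<^bsub>hc X g\<^esub> ?p g w"
        using g v w by (simp add: hc_mult[OF F])
    }
    fix k r assume k: "k \<in> carrier G" and r: "r \<in> A k"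
    note gk = G.m_closed[OF g k]
    interpret gk: comm_group "hc X (g \<otimes> k)" using hc_comm_group[OF X gk] .
    have tr: "?t (g \<otimes> k) (act ?F g k v r) i = act X g k (?t g v i) r" if "i < n" for i
      using act_mult[OF X _ _ k x[OF that] free_component[OF g v that] r]
        cancel[OF that g] free_degree[OF that] g k that
      by (simp add: act_free[OF g k v r] G.m_assoc)
    have "finprod (hc X (g \<otimes> k)) (?t (g \<otimes> k) (act ?F g k v r)) {..<n} =
       finprod (hc X (g \<otimes> k)) (\<lambda>i. act X g k (?t g v i) r) {..<n}"
      using act_closed[OF X g k tv r] by (intro gk.finprod_cong') (auto simp: tr)
    also have "\<dots> = act X g k (finprod (hc X g) (?t g v) {..<n}) r"
    proof -
      \<comment> \<open>Additivity of the action is extended to finite sums. Membership of the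
        partial sum in the component is proved along with it, because \<open>act_add_left\<close>
        asks for it at each step.\<close>
      have "finprod (hc X (g \<otimes> k)) (\<lambda>i. act X g k (?t g v i) r) S = act X g k (finprod (hc X g) (?t g v) S) r
         \<and> finprod (hc X g) (?t g v) S \<in> carrier (hc X g)"
        if "finite S" "S \<subseteq> {..<n}" for S
        using that
      proof (induction S rule: finite_induct)
        case empty
        then show ?case using act_one_left[OF X g k r] by simp
      next
        case (insert i S)
        then have cl: "?t g v \<in> S \<rightarrow> carrier (hc X g)" "?t g v i \<in> carrier (hc X g)"
          "(\<lambda>i. act X g k (?t g v i) r) \<in> S \<rightarrow> carrier (hc X (g \<otimes> k))"
          "act X g k (?t g v i) r \<in> carrier (hc X (g \<otimes> k))"
          using tv act_closed[OF X g k tv r] by auto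
        then show ?case
          using insert act_add_left[OF X g k cl(2) _ r]
          by (simp add: g.finprod_insert gk.finprod_insert)
      qed
      then show ?thesis by blast
    qed
    finally show "?p (g \<otimes> k) (act ?F g k v r) = act X g k (?p g v) r"
      using g k v r by (simp add: act_closed[OF F])
  qed auto
  moreover have "?p (inv d i) (free_basis n i) = x i" if i: "i < n" for i
  proof -
    note di = free_degree[OF i]
    interpret g: comm_group "hc X (inv d i)" using hc_comm_group[OF X] di by simp
    have one: "?t (inv d i) (free_basis n i) i = x i"
      using act_one[OF X _ x[OF i]] di i by (simp add: free_basis_def)
    have zero: "?t (inv d i) (free_basis n i) j = \<one>\<^bsub>hc X (inv d i)\<^esub>" if "j < n" "j \<noteq> i" for j
      using act_zero[OF X _ _ x[OF that(1)], of "d j \<otimes> inv d i"] that di free_degree[OF that(1)]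
        cancel[OF that(1), of "inv d i"]
      by (simp add: free_basis_def)
    have "finprod (hc X (inv d i)) (?t (inv d i) (free_basis n i)) {..<n} =
      finprod (hc X (inv d i)) (\<lambda>j. if i = j then x j else \<one>\<^bsub>hc X (inv d i)\<^esub>) {..<n}"
      using one zero x[OF i] by (intro g.finprod_cong') auto
    \<comment> \<open>For j different from i the element \<open>x j\<close> belongs to another
      component. The constant family with value \<open>x i\<close> stays inside
      \<open>hc X (inv d i)\<close>, as the singleton rule demands.\<close>
    also have "\<dots> = finprod (hc X (inv d i)) (\<lambda>j. if i = j then (\<lambda>_. x i) j else \<one>\<^bsub>hc X (inv d i)\<^esub>) {..<n}"
      using x[OF i] by (intro g.finprod_cong') auto
    also have "\<dots> = x i" using i x[OF i] by (intro g.finprod_singleton) auto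
    finally show ?thesis using di free_basis_in[OF i] by simp
  qed
  ultimately show ?thesis by blast
qed

end

text \<open>The free module on E maps onto the span of E: its basis goes to E and generates it, so
  the image is the span of the images.\<close>

lemma free_cover:
  fixes X :: "('g, 'm, 'r) gmod"
  assumes X: "graded_module G R A X" and E: "finite E" "E \<subseteq> homogeneous_elements G X"
  shows "\<exists>n d p. d \<in> {..<n} \<rightarrow> carrier G \<and> p \<in> gmod_hom G A (free_gmod G R A n d) X \<and>
    (\<forall>g\<in>carrier G. p g ` carrier (hc (free_gmod G R A n d) g) = {x. gspan G A X E g x})"
proof -
  obtain n and e :: "nat \<Rightarrow> 'g \<times> 'm" where e: "E = e ` {..<n}"
    using finite_imp_nat_seg_image_inj_on[OF E(1)] by (auto simp: lessThan_def)
  \<comment> \<open>The inverse makes the i-th basis vector have the degree of the generator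
    \<open>e i\<close>.\<close>
  define d where "d i = inv fst (e i)" for i
  have ei: "fst (e i) \<in> carrier G" "snd (e i) \<in> carrier (hc X (fst (e i)))" if "i < n" for i
  proof -
    have "e i \<in> homogeneous_elements G X" using E(2) e that by auto
    then show "fst (e i) \<in> carrier G" "snd (e i) \<in> carrier (hc X (fst (e i)))"
      by (auto simp: homogeneous_elements_def)
  qed
  have di: "inv d i = fst (e i)" if "i < n" for i using ei(1)[OF that] by (simp add: d_def)
  have d: "d \<in> {..<n} \<rightarrow> carrier G" using ei by (auto simp: d_def)
  let ?F = "free_gmod G R A n d"
  note F = graded_module_free[OF d] and gen = free_generators_subset[OF d]
  obtain p where p: "p \<in> gmod_hom G A ?F X" and pe: "\<And>i. i < n \<Longrightarrow> p (inv d i) (free_basis n i) = snd (e i)"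
    using free_universal[OF d X, of "\<lambda>i. snd (e i)"] ei di by auto
  have "map_homogeneous p (free_generators n d) = E"
    unfolding map_homogeneous_def free_generators_def e image_image
    using pe di by (intro image_cong refl) (auto simp: prod_eq_iff)
  note im = gspan_image[OF F X p gen, unfolded this] and lift = gspan_lift[OF F X p gen, unfolded this]
  have "p g ` carrier (hc ?F g) = {x. gspan G A X E g x}" if g: "g \<in> carrier G" for g
  proof safe
    fix v assume "v \<in> carrier (hc ?F g)"
    then show "gspan G A X E g (p g v)" by (intro im free_generated[OF d g])
  next
    fix x assume "gspan G A X E g x"
    then obtain v where "gspan G A ?F (free_generators n d) g v" "p g v = x" using lift by blast
    then show "x \<in> p g ` carrier (hc ?F g)" using gspan_closed[OF F gen] by blast
  qed
  then show ?thesis using d p by blast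
qed

lemma fin_gen_free:
  assumes d: "d \<in> {..<n} \<rightarrow> carrier G"
  shows "fin_gen G A (free_gmod G R A n d) (\<lambda>g. carrier (hc (free_gmod G R A n d) g))"
  unfolding fin_gen_def
proof (intro exI[of _ "free_generators n d"] conjI ballI allI iffI)
  show "finite (free_generators n d)" by (simp add: free_generators_def)
  show "free_generators n d \<subseteq> homogeneous_elements G (free_gmod G R A n d)"
    by (rule free_generators_subset[OF d])
  show "v \<in> carrier (hc (free_gmod G R A n d) g)"
    if "gspan G A (free_gmod G R A n d) (free_generators n d) g v" for g v
    using gspan_closed[OF graded_module_free[OF d] free_generators_subset[OF d] that] by blast
qed (rule free_generated[OF d])

text \<open>The second free module enters only through its image, so it is replaced by a finite set:
  the images under q of its basis generate the kernel of p.\<close>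

lemma finitely_presentedE:
  assumes X: "graded_module G R A X" and fp: "finitely_presented G R A X"
  obtains n d p E where "d \<in> {..<n} \<rightarrow> carrier G" "p \<in> gmod_hom G A (free_gmod G R A n d) X"
    "\<And>g. g \<in> carrier G \<Longrightarrow> p g ` carrier (hc (free_gmod G R A n d) g) = carrier (hc X g)"
    "finite E" "E \<subseteq> homogeneous_elements G (free_gmod G R A n d)"
    "\<And>g v. g \<in> carrier G \<Longrightarrow>
      v \<in> kernel (hc (free_gmod G R A n d) g) (hc X g) (p g) \<longleftrightarrow> gspan G A (free_gmod G R A n d) E g v"
proof -
  obtain n d m e p q where d: "d \<in> {..<n} \<rightarrow> carrier G" and e: "e \<in> {..<m} \<rightarrow> carrier G"
    and p: "p \<in> gmod_hom G A (free_gmod G R A n d) X"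
    and q: "q \<in> gmod_hom G A (free_gmod G R A m e) (free_gmod G R A n d)"
    and surj: "\<And>g. g \<in> carrier G \<Longrightarrow> p g ` carrier (hc (free_gmod G R A n d) g) = carrier (hc X g)"
    and ker: "\<And>g. g \<in> carrier G \<Longrightarrow> q g ` carrier (hc (free_gmod G R A m e) g) =
           kernel (hc (free_gmod G R A n d) g) (hc X g) (p g)"
    using fp unfolding finitely_presented_def by metis
  note F = graded_module_free[OF d] and F' = graded_module_free[OF e]
    and gen = free_generators_subset[OF e]
  let ?E = "map_homogeneous q (free_generators m e)"
  show thesis
  proof (rule that[OF d p surj])
    show "finite ?E" by (simp add: map_homogeneous_def free_generators_def)
    show "?E \<subseteq> homogeneous_elements G (free_gmod G R A n d)" by (rule map_homogeneous_subset[OF q gen])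
    fix g v assume g: "g \<in> carrier G"
    show "v \<in> kernel (hc (free_gmod G R A n d) g) (hc X g) (p g) \<longleftrightarrow> gspan G A (free_gmod G R A n d) ?E g v"
      unfolding ker[OF g, symmetric]
      using gspan_image[OF F' F q gen free_generated[OF e g]] gspan_lift[OF F' F q gen, of g v]
        gspan_closed[OF F' gen] by blast
  qed
qed

text \<open>A second free module is recovered by applying \<open>free_cover\<close> to finitely many
  generators of the kernel.\<close>

lemma finitely_presentedI:
  assumes d: "d \<in> {..<n} \<rightarrow> carrier G" and p: "p \<in> gmod_hom G A (free_gmod G R A n d) X"
    and surj: "\<And>g. g \<in> carrier G \<Longrightarrow> p g ` carrier (hc (free_gmod G R A n d) g) = carrier (hc X g)"
    and fg: "fin_gen G A (free_gmod G R A n d) (\<lambda>g. kernel (hc (free_gmod G R A n d) g) (hc X g) (p g))"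
  shows "finitely_presented G R A X"
proof -
  obtain E where E: "finite E" "E \<subseteq> homogeneous_elements G (free_gmod G R A n d)"
    and ker: "\<And>g x. g \<in> carrier G \<Longrightarrow>
      x \<in> kernel (hc (free_gmod G R A n d) g) (hc X g) (p g) \<longleftrightarrow> gspan G A (free_gmod G R A n d) E g x"
    using fg unfolding fin_gen_def by blast
  obtain m e q where e: "e \<in> {..<m} \<rightarrow> carrier G"
    and q: "q \<in> gmod_hom G A (free_gmod G R A m e) (free_gmod G R A n d)"
    and im: "\<forall>g\<in>carrier G. q g ` carrier (hc (free_gmod G R A m e) g) = {x. gspan G A (free_gmod G R A n d) E g x}"
    using free_cover[OF graded_module_free[OF d] E] by blast
  have "\<forall>g\<in>carrier G. q g ` carrier (hc (free_gmod G R A m e) g) =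
           kernel (hc (free_gmod G R A n d) g) (hc X g) (p g)"
  proof
    fix g assume g: "g \<in> carrier G"
    have "q g ` carrier (hc (free_gmod G R A m e) g) = {x. gspan G A (free_gmod G R A n d) E g x}"
      using im g by (rule bspec)
    also have "\<dots> = kernel (hc (free_gmod G R A n d) g) (hc X g) (p g)" using ker[OF g] by blast
    finally show "q g ` carrier (hc (free_gmod G R A m e) g) = kernel (hc (free_gmod G R A n d) g) (hc X g) (p g)" .
  qed
  moreover have "\<forall>g\<in>carrier G. p g ` carrier (hc (free_gmod G R A n d) g) = carrier (hc X g)"
    by (intro ballI surj)
  ultimately show ?thesis
    unfolding finitely_presented_def
    by (intro exI[of _ n] exI[of _ d] exI[of _ m] exI[of _ e] exI[of _ p] exI[of _ q] conjI d e p q)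
qed

lemma finitely_presented_fin_gen:
  assumes X: "graded_module G R A X" and fp: "finitely_presented G R A X"
  shows "fin_gen G A X (\<lambda>g. carrier (hc X g))"
proof -
  obtain n d p where d: "d \<in> {..<n} \<rightarrow> carrier G" and p: "p \<in> gmod_hom G A (free_gmod G R A n d) X"
    and surj: "\<And>g. g \<in> carrier G \<Longrightarrow> p g ` carrier (hc (free_gmod G R A n d) g) = carrier (hc X g)"
    using finitely_presentedE[OF X fp] by metis
  note F = graded_module_free[OF d] and gen = free_generators_subset[OF d]
  let ?E = "map_homogeneous p (free_generators n d)"
  have E: "?E \<subseteq> homogeneous_elements G X" by (rule map_homogeneous_subset[OF p gen])
  show ?thesis unfolding fin_gen_def
  proof (intro exI[of _ ?E] conjI ballI allI)
    show "finite ?E" by (simp add: map_homogeneous_def free_generators_def)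
    fix g x assume g: "g \<in> carrier G"
    show "x \<in> carrier (hc X g) \<longleftrightarrow> gspan G A X ?E g x"
    proof
      assume "x \<in> carrier (hc X g)"
      then obtain v where "v \<in> carrier (hc (free_gmod G R A n d) g)" "x = p g v"
        using surj[OF g] by blast
      then show "gspan G A X ?E g x" using gspan_image[OF F X p gen free_generated[OF d g]] by simp
    qed (use gspan_closed[OF X E] in blast)
  qed (rule E)
qed

text \<open>Lifting generators of a free cover \<open>F \<rightarrow> X\<close> gives \<open>\<phi> : F \<rightarrow> M\<close> over \<open>X\<close>. If
  \<open>p m = p\<^sub>0 u\<close> then \<open>m\<close> and \<open>\<phi> u\<close> differ by an element of \<open>ker p\<close>, so \<open>ker p\<close> is
  generated by these differences for generators \<open>m\<close> of \<open>M\<close>, together with \<open>\<phi> (ker p\<^sub>0)\<close>.\<close>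

lemma fin_gen_kernel:
  assumes X: "graded_module G R A X" and fp: "finitely_presented G R A X"
    and M: "graded_module G R A M" and fg: "fin_gen G A M (\<lambda>g. carrier (hc M g))"
    and p: "p \<in> gmod_hom G A M X"
    and surj: "\<And>g. g \<in> carrier G \<Longrightarrow> p g ` carrier (hc M g) = carrier (hc X g)"
  shows "fin_gen G A M (\<lambda>g. kernel (hc M g) (hc X g) (p g))"
proof -
  obtain n d p0 W where d: "d \<in> {..<n} \<rightarrow> carrier G" and p0: "p0 \<in> gmod_hom G A (free_gmod G R A n d) X"
    and surj0: "\<And>g. g \<in> carrier G \<Longrightarrow> p0 g ` carrier (hc (free_gmod G R A n d) g) = carrier (hc X g)"
    and W: "finite W" "W \<subseteq> homogeneous_elements G (free_gmod G R A n d)"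
    and kerW: "\<And>g x. g \<in> carrier G \<Longrightarrow>
      x \<in> kernel (hc (free_gmod G R A n d) g) (hc X g) (p0 g) \<longleftrightarrow> gspan G A (free_gmod G R A n d) W g x"
    using finitely_presentedE[OF X fp] by metis
  obtain E where E: "finite E" "E \<subseteq> homogeneous_elements G M"
    and spanE: "\<And>g x. g \<in> carrier G \<Longrightarrow> x \<in> carrier (hc M g) \<longleftrightarrow> gspan G A M E g x"
    using fg unfolding fin_gen_def by blast
  let ?F = "free_gmod G R A n d"
  note F = graded_module_free[OF d] and gen = free_generators_subset[OF d]
  have "\<exists>m. m \<in> carrier (hc M (inv d i)) \<and> p (inv d i) m = p0 (inv d i) (free_basis n i)" if "i < n" for i
  proof -
    have di: "inv d i \<in> carrier G" using d that by auto
    show ?thesis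
      using gmod_hom_closed[OF p0 di free_basis_in[OF d that]] unfolding surj[OF di, symmetric] by auto
  qed
  then obtain m where m: "\<And>i. i < n \<Longrightarrow> m i \<in> carrier (hc M (inv d i))"
    "\<And>i. i < n \<Longrightarrow> p (inv d i) (m i) = p0 (inv d i) (free_basis n i)" by metis
  obtain \<phi> where \<phi>: "\<phi> \<in> gmod_hom G A ?F M" and \<phi>e: "\<And>i. i < n \<Longrightarrow> \<phi> (inv d i) (free_basis n i) = m i"
    using free_universal[OF d M, of m] m(1) by blast
  have p\<phi>: "p g (\<phi> g v) = p0 g v" if g: "g \<in> carrier G" and v: "v \<in> carrier (hc ?F g)" for g v
  proof -
    have "(\<lambda>g\<in>carrier G. compose (carrier (hc ?F g)) (p g) (\<phi> g)) g v = p0 g v"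
    proof (rule gmod_hom_eq_on_gspan[OF F X gmod_hom_compose[OF F \<phi> p] p0 gen _ free_generated[OF d g v]])
      fix k x assume "(k, x) \<in> free_generators n d"
      then obtain i where i: "i < n" "k = inv d i" "x = free_basis n i" by (auto simp: free_generators_def)
      then show "(\<lambda>g\<in>carrier G. compose (carrier (hc ?F g)) (p g) (\<phi> g)) k x = p0 k x"
        using free_degree[OF d i(1)] free_basis_in[OF d i(1)] by (simp add: compose_def \<phi>e m)
    qed
    then show ?thesis using g v by (simp add: compose_def)
  qed
  have Ein: "g \<in> carrier G \<and> y \<in> carrier (hc M g)" if "(g, y) \<in> E" for g y
    using E(2) that by (auto simp: homogeneous_elements_def)
  have "\<exists>u. (g, y) \<in> E \<longrightarrow> u \<in> carrier (hc ?F g) \<and> p0 g u = p g y" for g y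
    using surj0[of g] gmod_hom_closed[OF p, of g y] Ein[of g y] by (metis imageE)
  then obtain u where u: "\<And>g y. (g, y) \<in> E \<Longrightarrow> u g y \<in> carrier (hc ?F g)"
    "\<And>g y. (g, y) \<in> E \<Longrightarrow> p0 g (u g y) = p g y" by metis
  let ?\<delta> = "\<lambda>g y. y \<otimes>\<^bsub>hc M g\<^esub> inv\<^bsub>hc M g\<^esub> \<phi> g (u g y)"
  let ?S = "map_homogeneous ?\<delta> E \<union> map_homogeneous \<phi> W"
  have \<delta>: "?\<delta> g y \<in> carrier (hc M g)" "p g (?\<delta> g y) = \<one>\<^bsub>hc X g\<^esub>" "?\<delta> g y \<otimes>\<^bsub>hc M g\<^esub> \<phi> g (u g y) = y"
    if gy: "(g, y) \<in> E" for g y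
  proof -
    have g: "g \<in> carrier G" and y: "y \<in> carrier (hc M g)" using Ein[OF gy] by auto
    interpret Mg: group "hc M g" by (rule hc_group[OF M g])
    interpret Xg: group "hc X g" by (rule hc_group[OF X g])
    interpret pg: group_hom "hc M g" "hc X g" "p g"
      by unfold_locales (rule gmod_hom_hom[OF p g])
    have \<phi>u: "\<phi> g (u g y) \<in> carrier (hc M g)" by (rule gmod_hom_closed[OF \<phi> g u(1)[OF gy]])
    show "?\<delta> g y \<in> carrier (hc M g)" using y \<phi>u by simp
    show "p g (?\<delta> g y) = \<one>\<^bsub>hc X g\<^esub>" using y \<phi>u u[OF gy] p\<phi>[OF g u(1)[OF gy]] by simp
    show "?\<delta> g y \<otimes>\<^bsub>hc M g\<^esub> \<phi> g (u g y) = y" using y \<phi>u by (simp add: Mg.m_assoc)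
  qed
  have S: "finite ?S" "?S \<subseteq> homogeneous_elements G M"
  proof -
    show "finite ?S" using E(1) W(1) by (simp add: map_homogeneous_def)
    show "?S \<subseteq> homogeneous_elements G M"
      using map_homogeneous_subset[OF \<phi> W(2)] \<delta>(1) Ein
      by (auto simp: map_homogeneous_def homogeneous_elements_def)
  qed
  have Sker: "p g x = \<one>\<^bsub>hc X g\<^esub>" if "(g, x) \<in> ?S" for g x
  proof -
    have "p g (\<phi> g w) = \<one>\<^bsub>hc X g\<^esub>" if gw: "(g, w) \<in> W" for w
    proof -
      have g: "g \<in> carrier G" "w \<in> carrier (hc ?F g)" using W(2) gw by (auto simp: homogeneous_elements_def)
      have "w \<in> kernel (hc ?F g) (hc X g) (p0 g)" using kerW[OF g(1)] gspan.generator[OF gw] by blast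
      then show ?thesis using p\<phi>[OF g] by (simp add: kernel_def)
    qed
    then show ?thesis using that \<delta>(2) by (auto simp: map_homogeneous_def)
  qed
  have decomp: "\<exists>s v. gspan G A M ?S g s \<and> v \<in> carrier (hc ?F g) \<and> y = s \<otimes>\<^bsub>hc M g\<^esub> \<phi> g v"
    if "gspan G A M E g y" for g y
    using that
  proof (induction rule: gspan.induct)
    case (generator g y)
    then show ?case
      using \<delta>(3)[OF generator] u(1)[OF generator]
      by (intro exI[of _ "?\<delta> g y"] exI[of _ "u g y"])
        (auto simp: map_homogeneous_def intro!: gspan.generator)
  next
    case (one g)
    then show ?case
      using gmod_hom_one[OF F M \<phi> one] hc_one[OF F one] hc_one[OF M one] monoid.l_one[OF hc_monoid[OF M one]]
      by (intro exI[of _ "\<one>\<^bsub>hc M g\<^esub>"] exI[of _ "\<one>\<^bsub>hc ?F g\<^esub>"]) (auto intro: gspan.one)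
  next
    case (mult g y y')
    then obtain s v s' v' where sv: "gspan G A M ?S g s" "v \<in> carrier (hc ?F g)" "y = s \<otimes>\<^bsub>hc M g\<^esub> \<phi> g v"
      and sv': "gspan G A M ?S g s'" "v' \<in> carrier (hc ?F g)" "y' = s' \<otimes>\<^bsub>hc M g\<^esub> \<phi> g v'" by blast
    have g: "g \<in> carrier G" "s \<in> carrier (hc M g)" "s' \<in> carrier (hc M g)"
      using gspan_closed[OF M S(2) sv(1)] gspan_closed[OF M S(2) sv'(1)] by auto
    interpret Mg: comm_group "hc M g" by (rule hc_comm_group[OF M g(1)])
    have "y \<otimes>\<^bsub>hc M g\<^esub> y' = (s \<otimes>\<^bsub>hc M g\<^esub> s') \<otimes>\<^bsub>hc M g\<^esub> \<phi> g (v \<otimes>\<^bsub>hc ?F g\<^esub> v')"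
      using g gmod_hom_closed[OF \<phi> g(1) sv(2)] gmod_hom_closed[OF \<phi> g(1) sv'(2)]
      by (simp add: sv(3) sv'(3) gmod_hom_mult[OF \<phi> g(1) sv(2) sv'(2)] Mg.m_ac)
    then show ?case using gspan.mult[OF sv(1) sv'(1)] hc_mult[OF F g(1) sv(2) sv'(2)] by blast
  next
    case (act g y k r)
    then obtain s v where sv: "gspan G A M ?S g s" "v \<in> carrier (hc ?F g)" "y = s \<otimes>\<^bsub>hc M g\<^esub> \<phi> g v" by blast
    have g: "g \<in> carrier G" "s \<in> carrier (hc M g)" using gspan_closed[OF M S(2) sv(1)] by auto
    have "act M g k y r = act M g k s r \<otimes>\<^bsub>hc M (g \<otimes> k)\<^esub> \<phi> (g \<otimes> k) (act ?F g k v r)"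
      using act_add_left[OF M g(1) act(2) g(2) gmod_hom_closed[OF \<phi> g(1) sv(2)] act(3)]
        gmod_hom_act[OF \<phi> g(1) act(2) sv(2) act(3)] by (simp add: sv(3))
    then show ?case using gspan.act[OF sv(1) act(2,3)] act_closed[OF F g(1) act(2) sv(2) act(3)] by blast
  qed
  have "x \<in> kernel (hc M g) (hc X g) (p g) \<longleftrightarrow> gspan G A M ?S g x" if g: "g \<in> carrier G" for g x
  proof
    assume "gspan G A M ?S g x"
    then show "x \<in> kernel (hc M g) (hc X g) (p g)"
      using gspan_in_kernel[OF M X p S(2) Sker] gspan_closed[OF M S(2)] by (auto simp: kernel_def)
  next
    assume "x \<in> kernel (hc M g) (hc X g) (p g)"
    then have x: "x \<in> carrier (hc M g)" "p g x = \<one>\<^bsub>hc X g\<^esub>" by (auto simp: kernel_def)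
    obtain s v where sv: "gspan G A M ?S g s" "v \<in> carrier (hc ?F g)" "x = s \<otimes>\<^bsub>hc M g\<^esub> \<phi> g v"
      using decomp spanE[OF g] x(1) by blast
    have s: "s \<in> carrier (hc M g)" "p g s = \<one>\<^bsub>hc X g\<^esub>"
      using gspan_closed[OF M S(2) sv(1)] gspan_in_kernel[OF M X p S(2) Sker sv(1)] by auto
    have "p0 g v = \<one>\<^bsub>hc X g\<^esub>"
      using x(2) gmod_hom_mult[OF p g s(1) gmod_hom_closed[OF \<phi> g sv(2)]] s(2) p\<phi>[OF g sv(2)]
        monoid.l_one[OF hc_monoid[OF X g] gmod_hom_closed[OF p0 g sv(2)]] by (simp add: sv(3))
    then have "gspan G A ?F W g v" using kerW[OF g] sv(2) by (auto simp: kernel_def)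
    then have "gspan G A M (map_homogeneous \<phi> W) g (\<phi> g v)" by (rule gspan_image[OF F M \<phi> W(2)])
    then have "gspan G A M ?S g (\<phi> g v)" by (rule gspan_mono) blast
    then show "gspan G A M ?S g x" using gspan.mult[OF sv(1)] sv(3) by blast
  qed
  then show ?thesis unfolding fin_gen_def using S by blast
qed

text \<open>A free cover p0 of M composed with p covers X. Its kernel is an extension of the kernel
  of p by that of p0, hence generated by lifts along p0 of generators of the former together with
  generators of the latter.\<close>

lemma finitely_presented_quotient:
  assumes X: "graded_module G R A X" and M: "graded_module G R A M" and fp: "finitely_presented G R A M"
    and p: "p \<in> gmod_hom G A M X"
    and surj: "\<And>g. g \<in> carrier G \<Longrightarrow> p g ` carrier (hc M g) = carrier (hc X g)"
    and ker: "fin_gen G A M (\<lambda>g. kernel (hc M g) (hc X g) (p g))"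
  shows "finitely_presented G R A X"
proof -
  obtain n d p0 W where d: "d \<in> {..<n} \<rightarrow> carrier G" and p0: "p0 \<in> gmod_hom G A (free_gmod G R A n d) M"
    and surj0: "\<And>g. g \<in> carrier G \<Longrightarrow> p0 g ` carrier (hc (free_gmod G R A n d) g) = carrier (hc M g)"
    and W: "finite W" "W \<subseteq> homogeneous_elements G (free_gmod G R A n d)"
    and kerW: "\<And>g x. g \<in> carrier G \<Longrightarrow>
      x \<in> kernel (hc (free_gmod G R A n d) g) (hc M g) (p0 g) \<longleftrightarrow> gspan G A (free_gmod G R A n d) W g x"
    using finitely_presentedE[OF M fp] by metis
  obtain V where V: "finite V" "V \<subseteq> homogeneous_elements G M"
    and kerV: "\<And>g x. g \<in> carrier G \<Longrightarrow> x \<in> kernel (hc M g) (hc X g) (p g) \<longleftrightarrow> gspan G A M V g x"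
    using ker unfolding fin_gen_def by blast
  let ?F = "free_gmod G R A n d"
  note F = graded_module_free[OF d]
  let ?q = "\<lambda>g\<in>carrier G. compose (carrier (hc ?F g)) (p g) (p0 g)"
  have q: "?q \<in> gmod_hom G A ?F X" by (rule gmod_hom_compose[OF F p0 p])
  have qv: "?q g v = p g (p0 g v)" if "g \<in> carrier G" "v \<in> carrier (hc ?F g)" for g v
    using that by (simp add: compose_def)
  have Vin: "g \<in> carrier G \<and> y \<in> carrier (hc M g)" if "(g, y) \<in> V" for g y
    using V(2) that by (auto simp: homogeneous_elements_def)
  have "\<exists>u. (g, y) \<in> V \<longrightarrow> u \<in> carrier (hc ?F g) \<and> p0 g u = y" for g y
    using surj0[of g] Vin[of g y] by (metis imageE)
  then obtain u where u: "\<And>g y. (g, y) \<in> V \<Longrightarrow> u g y \<in> carrier (hc ?F g)"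
    "\<And>g y. (g, y) \<in> V \<Longrightarrow> p0 g (u g y) = y" by metis
  let ?V = "map_homogeneous u V" and ?S = "map_homogeneous u V \<union> W"
  have V': "?V \<subseteq> homogeneous_elements G ?F"
    using Vin u by (auto simp: map_homogeneous_def homogeneous_elements_def)
  have pV: "map_homogeneous p0 ?V = V"
  proof -
    have "map_homogeneous p0 ?V = (\<lambda>x. x) ` V"
      unfolding map_homogeneous_def image_image using u by (intro image_cong refl) auto
    then show ?thesis by simp
  qed
  have S: "finite ?S" "?S \<subseteq> homogeneous_elements G ?F"
    using V(1) W V' by (auto simp: map_homogeneous_def)
  have Sker: "?q g x = \<one>\<^bsub>hc X g\<^esub>" if gx: "(g, x) \<in> ?S" for g x
  proof -
    have g: "g \<in> carrier G" "x \<in> carrier (hc ?F g)" using S(2) gx by (auto simp: homogeneous_elements_def)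
    from gx have "p g (p0 g x) = \<one>\<^bsub>hc X g\<^esub>"
    proof
      assume "(g, x) \<in> ?V"
      then obtain y where y: "(g, y) \<in> V" "x = u g y" by (auto simp: map_homogeneous_def)
      then have "y \<in> kernel (hc M g) (hc X g) (p g)"
        using kerV[OF g(1)] gspan.generator[OF y(1)] by blast
      then show ?thesis using u(2)[OF y(1)] y(2) by (simp add: kernel_def)
    next
      assume gx: "(g, x) \<in> W"
      then have "x \<in> kernel (hc ?F g) (hc M g) (p0 g)"
        using kerW[OF g(1)] gspan.generator[OF gx] by blast
      then have "p0 g x = \<one>\<^bsub>hc M g\<^esub>" by (simp add: kernel_def)
      then show ?thesis using gmod_hom_one[OF M X p g(1)] by simp
    qed
    then show ?thesis using qv[OF g] by simp
  qed
  have "x \<in> kernel (hc ?F g) (hc X g) (?q g) \<longleftrightarrow> gspan G A ?F ?S g x" if g: "g \<in> carrier G" for g x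
  proof
    assume "gspan G A ?F ?S g x"
    then show "x \<in> kernel (hc ?F g) (hc X g) (?q g)"
      using gspan_in_kernel[OF F X q S(2) Sker] gspan_closed[OF F S(2)] unfolding kernel_def by blast
  next
    assume "x \<in> kernel (hc ?F g) (hc X g) (?q g)"
    then have x: "x \<in> carrier (hc ?F g)" "p g (p0 g x) = \<one>\<^bsub>hc X g\<^esub>"
      using qv[OF g] by (auto simp: kernel_def)
    have "gspan G A M V g (p0 g x)"
      using kerV[OF g] gmod_hom_closed[OF p0 g x(1)] x(2) by (auto simp: kernel_def)
    then obtain y where y: "gspan G A ?F ?V g y" "p0 g y = p0 g x"
      using gspan_lift[OF F M p0 V'] pV by metis
    have yF: "y \<in> carrier (hc ?F g)" using gspan_closed[OF F V' y(1)] by simp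
    interpret Fg: group "hc ?F g" by (rule hc_group[OF F g])
    interpret Mg: group "hc M g" by (rule hc_group[OF M g])
    interpret p0g: group_hom "hc ?F g" "hc M g" "p0 g"
      by unfold_locales (rule gmod_hom_hom[OF p0 g])
    \<comment> \<open>The lift y accounts for the image of x in M, so x and y differ by an element
      of the kernel of p0, which is spanned by W.\<close>
    have "x \<otimes>\<^bsub>hc ?F g\<^esub> inv\<^bsub>hc ?F g\<^esub> y \<in> kernel (hc ?F g) (hc M g) (p0 g)"
      using x(1) yF y(2) by (simp add: kernel_def del: mult_product_group)
    then have "gspan G A ?F W g (x \<otimes>\<^bsub>hc ?F g\<^esub> inv\<^bsub>hc ?F g\<^esub> y)" using kerW[OF g] by blast
    from gspan.mult[OF gspan_mono[OF this Un_upper2] gspan_mono[OF y(1) Un_upper1]]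
    have "gspan G A ?F ?S g (x \<otimes>\<^bsub>hc ?F g\<^esub> inv\<^bsub>hc ?F g\<^esub> y \<otimes>\<^bsub>hc ?F g\<^esub> y)" .
    then show "gspan G A ?F ?S g x" using x(1) yF by (simp add: Fg.m_assoc)
  qed
  then have "fin_gen G A ?F (\<lambda>g. kernel (hc ?F g) (hc X g) (?q g))"
    unfolding fin_gen_def using S by blast
  moreover have "?q g ` carrier (hc ?F g) = carrier (hc X g)" if g: "g \<in> carrier G" for g
  proof -
    have "?q g ` carrier (hc ?F g) = p g ` p0 g ` carrier (hc ?F g)"
      unfolding image_image by (intro image_cong refl qv[OF g])
    then show ?thesis using surj0[OF g] surj[OF g] by simp
  qed
  ultimately show ?thesis by (intro finitely_presentedI[OF d q])
qed

text \<open>Isomorphism invariance, obtained as a quotient whose kernel is generated by the empty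
  set. Source and target may be carried by different types.\<close>

lemma finitely_presented_bij:
  assumes X: "graded_module G R A X" and M: "graded_module G R A M" and fp: "finitely_presented G R A M"
    and p: "p \<in> gmod_hom G A M X"
    and bij: "\<And>g. g \<in> carrier G \<Longrightarrow> bij_betw (p g) (carrier (hc M g)) (carrier (hc X g))"
  shows "finitely_presented G R A X"
proof (rule finitely_presented_quotient[OF X M fp p])
  show "p g ` carrier (hc M g) = carrier (hc X g)" if "g \<in> carrier G" for g
    using bij[OF that] by (simp add: bij_betw_def)
  have "x \<in> kernel (hc M g) (hc X g) (p g) \<longleftrightarrow> gspan G A M {} g x" if g: "g \<in> carrier G" for g x
  proof
    assume "x \<in> kernel (hc M g) (hc X g) (p g)"
    then have "x = \<one>\<^bsub>hc M g\<^esub>"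
      using gmod_hom_one[OF M X p g] hc_one[OF M g]
        inj_onD[OF bij_betw_imp_inj_on[OF bij[OF g]], of x "\<one>\<^bsub>hc M g\<^esub>"]
      by (simp add: kernel_def)
    then show "gspan G A M {} g x" using gspan.one[OF g] by simp
  next
    assume "gspan G A M {} g x"
    then show "x \<in> kernel (hc M g) (hc X g) (p g)"
      using gspan_in_kernel[OF M X p, of "{}" g x] gspan_closed[OF M, of "{}" g x] by (simp add: kernel_def)
  qed
  then show "fin_gen G A M (\<lambda>g. kernel (hc M g) (hc X g) (p g))"
    unfolding fin_gen_def by (intro exI[of _ "{}"]) auto
qed

lemma finitely_presented_free:
  assumes d: "d \<in> {..<n} \<rightarrow> carrier G"
  shows "finitely_presented G R A (free_gmod G R A n d)"
proof -
  let ?F = "free_gmod G R A n d"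
  note F = graded_module_free[OF d]
  let ?i = "\<lambda>g\<in>carrier G. \<lambda>x\<in>carrier (hc ?F g). x"
  have "x \<in> kernel (hc ?F g) (hc ?F g) (?i g) \<longleftrightarrow> gspan G A ?F {} g x" if g: "g \<in> carrier G" for g x
  proof
    assume "x \<in> kernel (hc ?F g) (hc ?F g) (?i g)"
    then show "gspan G A ?F {} g x" using gspan.one[OF g] g by (auto simp: kernel_def)
  next
    assume "gspan G A ?F {} g x"
    then show "x \<in> kernel (hc ?F g) (hc ?F g) (?i g)"
      using gspan_in_kernel[OF F F gmod_hom_ide[OF F], of "{}" g x] gspan_closed[OF F, of "{}" g x]
      by (simp add: kernel_def)
  qed
  then have "fin_gen G A ?F (\<lambda>g. kernel (hc ?F g) (hc ?F g) (?i g))"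
    unfolding fin_gen_def by (intro exI[of _ "{}"]) auto
  moreover have "?i g ` carrier (hc ?F g) = carrier (hc ?F g)" if "g \<in> carrier G" for g
    using that by auto
  ultimately show ?thesis by (intro finitely_presentedI[OF d gmod_hom_ide[OF F]])
qed

end

section \<open>Finite presentation and restriction along \<open>\<pi>\<close>\<close>

context grading_hom
begin

lemma act_pullback:
  "\<lbrakk>g \<in> carrier G; k \<in> carrier G; y \<in> carrier (hc Y (\<pi> g)); r \<in> A k\<rbrakk> \<Longrightarrow>
   act (pullback G A \<pi> Y) g k y r = act Y (\<pi> g) (\<pi> k) y r"
  by (simp add: pullback_def)

definition push_elements :: "('g \<times> 'm) set \<Rightarrow> ('h \<times> 'm) set" where
  "push_elements E = (\<lambda>(g, x). (\<pi> g, x)) ` E"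

text \<open>Each generator is repeated in all G-degrees over its H-degree, because the span over G
  cannot move between degrees of one fibre by itself.\<close>

definition pull_elements :: "('h \<times> 'm) set \<Rightarrow> ('g \<times> 'm) set" where
  "pull_elements E = {(g, x). g \<in> carrier G \<and> (\<pi> g, x) \<in> E}"

lemma push_elements_subset:
  "E \<subseteq> homogeneous_elements G (pullback G A \<pi> Y) \<Longrightarrow> push_elements E \<subseteq> homogeneous_elements H Y"
  by (auto simp: push_elements_def homogeneous_elements_def pullback_hc \<pi>_closed)

lemma pull_elements_subset:
  "E \<subseteq> homogeneous_elements H Y \<Longrightarrow> pull_elements E \<subseteq> homogeneous_elements G (pullback G A \<pi> Y)"
  by (auto simp: pull_elements_def homogeneous_elements_def pullback_hc)

lemma gspan_push:
  assumes Y: "graded_module H R B Y" and E: "E \<subseteq> homogeneous_elements G (pullback G A \<pi> Y)"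
  shows "gspan G A (pullback G A \<pi> Y) E g x \<Longrightarrow> gspan H B Y (push_elements E) (\<pi> g) x"
proof (induction rule: gspan.induct)
  case (generator g x)
  then show ?case by (intro gspan.generator) (force simp: push_elements_def)
next
  case (one g)
  then show ?case using gspan.one[OF \<pi>_closed[OF one], of B Y] by (simp add: pullback_hc)
next
  case (mult g x y)
  have "g \<in> carrier G" using gspan_closed[OF graded_module_pullback[OF Y] E mult(1)] by simp
  then show ?case using gspan.mult[OF mult(3,4)] by (simp add: pullback_hc)
next
  case (act g x k r)
  have "g \<in> carrier G" "x \<in> carrier (hc Y (\<pi> g))"
    using gspan_closed[OF graded_module_pullback[OF Y] E act(1)] by (auto simp: pullback_hc)
  then show ?case
    using gspan.act[OF act(4) \<pi>_closed[OF act(2)] A_sub_B[OF act(2,3)]] act(2,3)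
    by (simp add: act_pullback \<pi>_mult)
qed

text \<open>The induction covers all lifts g of h at once. When a scalar of degree k acts on x of
  degree h, each of its G-homogeneous pieces, of degree l say, needs x in the lift g l^-1 of h,
  which varies with l.\<close>

lemma gspan_pull:
  assumes Y: "graded_module H R B Y" and E: "E \<subseteq> homogeneous_elements H Y"
    and x: "gspan H B Y E h x" and g: "g \<in> carrier G" "\<pi> g = h"
  shows "gspan G A (pullback G A \<pi> Y) (pull_elements E) g x"
  using x g
proof (induction arbitrary: g rule: gspan.induct)
  case (generator h x)
  then show ?case by (intro gspan.generator) (simp add: pull_elements_def)
next
  case (one h)
  then show ?case using gspan.one[OF one(2), of A "pullback G A \<pi> Y"] by (simp add: pullback_hc)
next
  case (mult h x y)
  then show ?case using gspan.mult[OF mult.IH(1)[OF mult.prems] mult.IH(2)[OF mult.prems]] by (simp add: pullback_hc)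
next
  case (act h x k r)
  note hx = grading.gspan_closed[OF grading_B Y E act.hyps(1)]
  note g = \<open>g \<in> carrier G\<close> and gk = \<open>\<pi> g = h \<otimes>\<^bsub>H\<^esub> k\<close>
  let ?S = "gspan G A (pullback G A \<pi> Y) (pull_elements E) g"
  from act.hyps(3) show ?case
  proof (induction rule: B_induct)
    case zero
    then show ?case
      using gspan.one[OF g, of A "pullback G A \<pi> Y"] g gk act.hyps(2) hx
        grading.act_zero[OF grading_B Y _ act.hyps(2)]
      by (simp add: pullback_hc)
  next
    case (homogeneous l r)
    have gl: "g \<otimes> inv l \<in> carrier G" "\<pi> (g \<otimes> inv l) = h"
      using g gk homogeneous hx act.hyps(2) by (auto simp: \<pi>_mult \<pi>_inv H.m_assoc)
    have "g \<otimes> inv l \<otimes> l = g" using g homogeneous(1) by (simp add: G.m_assoc)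
    then show ?case
      using gspan.act[OF act.IH[OF gl] homogeneous(1,3)] gl hx homogeneous
      by (simp add: act_pullback)
  next
    case (add r s)
    then show ?case
      using gspan.mult[OF add(3,4)] g gk hx act.hyps(2)
      by (simp add: pullback_hc B_add_right[OF Y])
  qed
qed

text \<open>Pushing generators to H and pulling them back adds copies in other degrees of the same
  fibre. The copies already lie in the span of E, because membership in \<open>K (\<pi> g)\<close>
  depends only on the fibre.\<close>

lemma fin_gen_push:
  assumes surj: "\<pi> ` carrier G = carrier H" and Y: "graded_module H R B Y"
    and fg: "fin_gen G A (pullback G A \<pi> Y) (\<lambda>g. K (\<pi> g))"
  shows "fin_gen H B Y K"
proof -
  obtain E where E: "finite E" "E \<subseteq> homogeneous_elements G (pullback G A \<pi> Y)"
    and K: "\<And>g x. g \<in> carrier G \<Longrightarrow> x \<in> K (\<pi> g) \<longleftrightarrow> gspan G A (pullback G A \<pi> Y) E g x"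
    using fg unfolding fin_gen_def by blast
  have "x \<in> K (\<pi> g) \<longleftrightarrow> gspan H B Y (push_elements E) (\<pi> g) x" if g: "g \<in> carrier G" for g x
  proof
    assume "x \<in> K (\<pi> g)"
    then have "gspan G A (pullback G A \<pi> Y) E g x" using K[OF g] by blast
    then show "gspan H B Y (push_elements E) (\<pi> g) x" by (rule gspan_push[OF Y E(2)])
  next
    assume "gspan H B Y (push_elements E) (\<pi> g) x"
    then have "gspan G A (pullback G A \<pi> Y) (pull_elements (push_elements E)) g x"
      by (rule gspan_pull[OF Y push_elements_subset[OF E(2)] _ g refl])
    then have "gspan G A (pullback G A \<pi> Y) E g x"
    proof (rule gspan_trans)
      fix k y assume "(k, y) \<in> pull_elements (push_elements E)"
      then obtain l where k: "k \<in> carrier G" "\<pi> k = \<pi> l" and l: "(l, y) \<in> E"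
        by (auto simp: pull_elements_def push_elements_def)
      have "l \<in> carrier G" using E(2) l by (auto simp: homogeneous_elements_def)
      then have "y \<in> K (\<pi> l)" using K gspan.generator[OF l] by blast
      then show "gspan G A (pullback G A \<pi> Y) E k y" using K[OF k(1)] k(2) by simp
    qed
    then show "x \<in> K (\<pi> g)" using K[OF g] by blast
  qed
  then have "\<forall>h\<in>\<pi> ` carrier G. \<forall>x. x \<in> K h \<longleftrightarrow> gspan H B Y (push_elements E) h x"
    by simp
  then show ?thesis
    unfolding fin_gen_def surj using E(1) push_elements_subset[OF E(2)]
    by (intro exI[of _ "push_elements E"]) (simp add: push_elements_def)
qed

text \<open>A nonempty fibre of \<pi> is a coset of the kernel, so each generator acquires only
  finitely many copies.\<close>

lemma finite_pull_elements:
  assumes fin: "finite (kernel G H \<pi>)" and E: "finite E"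
  shows "finite (pull_elements E)"
proof -
  have fibre: "finite {g \<in> carrier G. \<pi> g = h}" for h
  proof (cases "\<exists>a\<in>carrier G. \<pi> a = h")
    case True
    then obtain a where a: "a \<in> carrier G" "\<pi> a = h" by blast
    have "{g \<in> carrier G. \<pi> g = h} \<subseteq> (\<lambda>n. n \<otimes> a) ` kernel G H \<pi>"
    proof
      fix g assume "g \<in> {g \<in> carrier G. \<pi> g = h}"
      then have "g \<otimes> inv a \<in> kernel G H \<pi>" "g = g \<otimes> inv a \<otimes> a"
        using a \<pi>_closed[OF a(1)] by (auto simp: kernel_iff \<pi>_mult \<pi>_inv G.m_assoc)
      then show "g \<in> (\<lambda>n. n \<otimes> a) ` kernel G H \<pi>" by blast
    qed
    then show ?thesis using finite_subset fin by blast
  next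
    case False
    then have "{g \<in> carrier G. \<pi> g = h} = {}" by blast
    then show ?thesis by (simp only: finite.emptyI)
  qed
  have "pull_elements E \<subseteq> (\<Union>(h, x)\<in>E. {g \<in> carrier G. \<pi> g = h} \<times> {x})"
    by (auto simp: pull_elements_def)
  moreover have "finite (\<Union>(h, x)\<in>E. {g \<in> carrier G. \<pi> g = h} \<times> {x})"
    using E fibre by auto
  ultimately show ?thesis by (rule finite_subset)
qed

lemma fin_gen_pull:
  assumes fin: "finite (kernel G H \<pi>)" and Y: "graded_module H R B Y"
    and fg: "fin_gen H B Y K"
  shows "fin_gen G A (pullback G A \<pi> Y) (\<lambda>g. K (\<pi> g))"
proof -
  obtain E where E: "finite E" "E \<subseteq> homogeneous_elements H Y"
    and K: "\<And>h x. h \<in> carrier H \<Longrightarrow> x \<in> K h \<longleftrightarrow> gspan H B Y E h x"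
    using fg unfolding fin_gen_def by blast
  have "x \<in> K (\<pi> g) \<longleftrightarrow> gspan G A (pullback G A \<pi> Y) (pull_elements E) g x" if g: "g \<in> carrier G" for g x
  proof
    assume "x \<in> K (\<pi> g)"
    then have "gspan H B Y E (\<pi> g) x" using K[OF \<pi>_closed[OF g]] by blast
    then show "gspan G A (pullback G A \<pi> Y) (pull_elements E) g x" by (rule gspan_pull[OF Y E(2) _ g refl])
  next
    assume "gspan G A (pullback G A \<pi> Y) (pull_elements E) g x"
    then have "gspan H B Y (push_elements (pull_elements E)) (\<pi> g) x"
      by (rule gspan_push[OF Y pull_elements_subset[OF E(2)]])
    then have "gspan H B Y E (\<pi> g) x"
      by (rule gspan_mono) (auto simp: push_elements_def pull_elements_def)
    then show "x \<in> K (\<pi> g)" using K[OF \<pi>_closed[OF g]] by blast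
  qed
  then show ?thesis
    unfolding fin_gen_def using finite_pull_elements[OF fin E(1)] pull_elements_subset[OF E(2)] by blast
qed

text \<open>Choose c_i over d_i. The piece of the pushforward ring in degree d_i \<pi>(g) is the
  direct sum of the R_(t c_i g) with t in the kernel. So the restriction of the shift by d_i is the
  direct sum of the shifts R(t c_i), and the rank is multiplied by the order of the kernel.\<close>

lemma finitely_presented_pullback_free:
  assumes surj: "\<pi> ` carrier G = carrier H" and fin: "finite (kernel G H \<pi>)"
    and d: "d \<in> {..<n} \<rightarrow> carrier H"
  shows "finitely_presented G R A (pullback G A \<pi> (free_gmod H R B n d))"
proof -
  let ?K = "kernel G H \<pi>" and ?Y = "free_gmod H R B n d"
  have Y: "graded_module H R B ?Y" by (rule grading.graded_module_free[OF grading_B d])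
  have "\<exists>a. i < n \<longrightarrow> a \<in> carrier G \<and> \<pi> a = d i" for i using d surj by (metis PiE image_iff lessThan_iff)
  then obtain c where c: "\<And>i. i < n \<Longrightarrow> c i \<in> carrier G" "\<And>i. i < n \<Longrightarrow> \<pi> (c i) = d i" by metis
  have "finite ({..<n} \<times> ?K)" using fin by simp
  then obtain b where "bij_betw b {0..<card ({..<n} \<times> ?K)} ({..<n} \<times> ?K)"
    using ex_bij_betw_nat_finite by blast
  \<comment> \<open>Free modules are indexed by initial segments of the naturals, so the pairs (i,
    t) are enumerated by b, with inverse b'.\<close>
  then obtain M where b: "bij_betw b {..<M} ({..<n} \<times> ?K)" by (metis atLeast0LessThan)
  define b' where "b' = inv_into {..<M} b"
  have b': "b' (i, t) < M" "b (b' (i, t)) = (i, t)" if "i < n" "t \<in> ?K" for i t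
  proof -
    have "(i, t) \<in> b ` {..<M}" using b that by (simp add: bij_betw_def)
    then show "b' (i, t) < M" "b (b' (i, t)) = (i, t)"
      using inv_into_into[of "(i, t)" b "{..<M}"] f_inv_into_f[of "(i, t)" b "{..<M}"] by (auto simp: b'_def)
  qed
  have bb: "fst (b j) < n" "snd (b j) \<in> ?K" "b' (b j) = j" if "j < M" for j
  proof -
    have "b j \<in> {..<n} \<times> ?K" using b that by (auto simp: bij_betw_def)
    then show "fst (b j) < n" "snd (b j) \<in> ?K" by auto
    show "b' (b j) = j" using b that by (simp add: b'_def bij_betw_def inv_into_f_f)
  qed
  define D where "D j = snd (b j) \<otimes> c (fst (b j))" for j
  have KG: "t \<in> carrier G" "\<pi> t = \<one>\<^bsub>H\<^esub>" if "t \<in> ?K" for t using that by (auto simp: kernel_iff)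
  have D: "D \<in> {..<M} \<rightarrow> carrier G" using bb c KG by (auto simp: D_def)
  let ?F = "free_gmod G R A M D"
  note F = graded_module_free[OF D]
  have P: "graded_module G R A (pullback G A \<pi> ?Y)" by (rule graded_module_pullback[OF Y])
  have Ycarr: "carrier (hc (pullback G A \<pi> ?Y) g) = (\<Pi>\<^sub>E i\<in>{..<n}. B (d i \<otimes>\<^bsub>H\<^esub> \<pi> g))"
    "x \<otimes>\<^bsub>hc (pullback G A \<pi> ?Y) g\<^esub> y = (\<lambda>i\<in>{..<n}. x i \<oplus>\<^bsub>R\<^esub> y i)" if "g \<in> carrier G" for g x y
    using that grading.hc_free[OF grading_B \<pi>_closed[OF that]] by (simp_all add: pullback_hc)
  have cg: "c i \<otimes> g \<in> carrier G" "\<pi> (c i \<otimes> g) = d i \<otimes>\<^bsub>H\<^esub> \<pi> g" if "i < n" "g \<in> carrier G" for i g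
    using c that by (auto simp: \<pi>_mult)
  have tcg: "t \<otimes> (c i \<otimes> g) \<in> carrier G" "\<pi> (t \<otimes> (c i \<otimes> g)) = d i \<otimes>\<^bsub>H\<^esub> \<pi> g"
    if "i < n" "g \<in> carrier G" "t \<in> ?K" for i g t
  proof -
    note t = KG[OF that(3)] and a = cg[OF that(1,2)]
    show "t \<otimes> (c i \<otimes> g) \<in> carrier G" using t a by simp
    have "\<pi> (t \<otimes> (c i \<otimes> g)) = \<one>\<^bsub>H\<^esub> \<otimes>\<^bsub>H\<^esub> \<pi> (c i \<otimes> g)"
      using \<pi>_mult[OF t(1) a(1)] by (simp add: t(2))
    also have "\<dots> = d i \<otimes>\<^bsub>H\<^esub> \<pi> g" using \<pi>_closed[OF a(1)] a(2) by simp
    finally show "\<pi> (t \<otimes> (c i \<otimes> g)) = d i \<otimes>\<^bsub>H\<^esub> \<pi> g" .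
  qed
  have vA: "v (b' (i, t)) \<in> A (t \<otimes> (c i \<otimes> g))" "v (b' (i, t)) \<in> carrier R"
    if "g \<in> carrier G" "v \<in> carrier (hc ?F g)" "i < n" "t \<in> ?K" for g v i t
  proof -
    show *: "v (b' (i, t)) \<in> A (t \<otimes> (c i \<otimes> g))"
      using free_component[OF D that(1,2) b'(1)[OF that(3,4)]] that c KG
      by (simp add: D_def b'(2) G.m_assoc)
    show "v (b' (i, t)) \<in> carrier R" by (rule A_subset[OF tcg(1)[OF that(3,1,4)] *])
  qed
  \<comment> \<open>The i-th coordinate of the image collects the coordinates with index (i, t),
    which lie in distinct G-degrees over one H-degree.\<close>
  let ?\<phi> = "\<lambda>g\<in>carrier G. \<lambda>v\<in>carrier (hc ?F g). \<lambda>i\<in>{..<n}. \<Oplus>\<^bsub>R\<^esub>t\<in>?K. v (b' (i, t))"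
  have \<phi>B: "(\<Oplus>\<^bsub>R\<^esub>t\<in>?K. v (b' (i, t))) \<in> B (d i \<otimes>\<^bsub>H\<^esub> \<pi> g)"
    if "g \<in> carrier G" "v \<in> carrier (hc ?F g)" "i < n" for g v i
  proof (rule grading.A_finsum[OF grading_B])
    show "d i \<otimes>\<^bsub>H\<^esub> \<pi> g \<in> carrier H" using \<pi>_closed[OF cg(1)[OF that(3,1)]] cg(2)[OF that(3,1)] by simp
    show "v (b' (i, t)) \<in> B (d i \<otimes>\<^bsub>H\<^esub> \<pi> g)" if t: "t \<in> ?K" for t
      using A_sub_B[OF tcg(1) vA(1)] tcg(2) that \<open>g \<in> carrier G\<close> \<open>v \<in> carrier (hc ?F g)\<close> \<open>i < n\<close> by metis
  qed
  have \<phi>: "?\<phi> \<in> gmod_hom G A ?F (pullback G A \<pi> ?Y)"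
  proof (rule gmod_homI)
    fix g v assume g: "g \<in> carrier G" and v: "v \<in> carrier (hc ?F g)"
    show \<phi>v: "?\<phi> g v \<in> carrier (hc (pullback G A \<pi> ?Y) g)"
      using g v \<phi>B[OF g v] by (simp add: Ycarr)
    {
      fix w assume w: "w \<in> carrier (hc ?F g)"
      have "(\<Oplus>\<^bsub>R\<^esub>t\<in>?K. (v \<otimes>\<^bsub>hc ?F g\<^esub> w) (b' (i, t))) = (\<Oplus>\<^bsub>R\<^esub>t\<in>?K. v (b' (i, t))) \<oplus>\<^bsub>R\<^esub> (\<Oplus>\<^bsub>R\<^esub>t\<in>?K. w (b' (i, t)))"
        if i: "i < n" for i
      proof -
        have "(\<Oplus>\<^bsub>R\<^esub>t\<in>?K. (v \<otimes>\<^bsub>hc ?F g\<^esub> w) (b' (i, t))) = (\<Oplus>\<^bsub>R\<^esub>t\<in>?K. v (b' (i, t)) \<oplus>\<^bsub>R\<^esub> w (b' (i, t)))"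
          using vA(2)[OF g v i] vA(2)[OF g w i] b'(1)[OF i]
          by (intro R.add.finprod_cong') (auto simp: hc_free[OF g])
        also have "\<dots> = (\<Oplus>\<^bsub>R\<^esub>t\<in>?K. v (b' (i, t))) \<oplus>\<^bsub>R\<^esub> (\<Oplus>\<^bsub>R\<^esub>t\<in>?K. w (b' (i, t)))"
          using vA(2)[OF g v i] vA(2)[OF g w i] by (intro R.finsum_addf) auto
        finally show ?thesis .
      qed
      then show "?\<phi> g (v \<otimes>\<^bsub>hc ?F g\<^esub> w) = ?\<phi> g v \<otimes>\<^bsub>hc (pullback G A \<pi> ?Y) g\<^esub> ?\<phi> g w"
        using g v w hc_mult[OF F g v w] by (simp add: Ycarr cong: restrict_cong)
    }
    fix k r assume k: "k \<in> carrier G" and r: "r \<in> A k"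
    have "(\<Oplus>\<^bsub>R\<^esub>t\<in>?K. act ?F g k v r (b' (i, t))) = (\<Oplus>\<^bsub>R\<^esub>t\<in>?K. v (b' (i, t))) \<otimes>\<^bsub>R\<^esub> r"
      if i: "i < n" for i
    proof -
      have "(\<Oplus>\<^bsub>R\<^esub>t\<in>?K. act ?F g k v r (b' (i, t))) = (\<Oplus>\<^bsub>R\<^esub>t\<in>?K. v (b' (i, t)) \<otimes>\<^bsub>R\<^esub> r)"
        using vA(2)[OF g v i] b'(1)[OF i] A_subset[OF k r]
        by (intro R.add.finprod_cong') (auto simp: act_free[OF g k v r])
      also have "\<dots> = (\<Oplus>\<^bsub>R\<^esub>t\<in>?K. v (b' (i, t))) \<otimes>\<^bsub>R\<^esub> r"
        using vA(2)[OF g v i] A_subset[OF k r] fin by (intro R.finsum_ldistr[symmetric]) auto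
      finally show ?thesis .
    qed
    moreover have "act (pullback G A \<pi> ?Y) g k (?\<phi> g v) r = (\<lambda>i\<in>{..<n}. ?\<phi> g v i \<otimes>\<^bsub>R\<^esub> r)"
    proof -
      have y: "?\<phi> g v \<in> carrier (hc ?Y (\<pi> g))" using \<phi>v g by (simp add: pullback_hc)
      show ?thesis
        unfolding act_pullback[OF g k y r]
        by (rule grading.act_free[OF grading_B \<pi>_closed[OF g] \<pi>_closed[OF k] y A_sub_B[OF k r]])
    qed
    ultimately show "?\<phi> (g \<otimes> k) (act ?F g k v r) = act (pullback G A \<pi> ?Y) g k (?\<phi> g v) r"
      using g k v act_closed[OF F g k v r] by (simp cong: restrict_cong)
  qed auto
  have "bij_betw (?\<phi> g) (carrier (hc ?F g)) (carrier (hc (pullback G A \<pi> ?Y) g))" if g: "g \<in> carrier G" for g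
  proof -
    \<comment> \<open>The degrees t c_i g are distinct for distinct t, so taking the component in
      degree s c_i g recovers the coordinate at (i, s). This gives injectivity.\<close>
    have comp: "component (\<Oplus>\<^bsub>R\<^esub>t\<in>?K. v (b' (i, t))) (s \<otimes> (c i \<otimes> g)) = v (b' (i, s))"
      if v: "v \<in> carrier (hc ?F g)" and i: "i < n" and s: "s \<in> ?K" for v i s
    proof -
      have "component (\<Oplus>\<^bsub>R\<^esub>t\<in>?K. v (b' (i, t))) (s \<otimes> (c i \<otimes> g)) =
         (\<Oplus>\<^bsub>R\<^esub>t\<in>?K. component (v (b' (i, t))) (s \<otimes> (c i \<otimes> g)))"
        by (intro component_finsum vA(2)[OF g v i] tcg(1)[OF i g s])
      also have "\<dots> = (\<Oplus>\<^bsub>R\<^esub>t\<in>?K. if s = t then v (b' (i, t)) else \<zero>\<^bsub>R\<^esub>)"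
      proof (intro R.add.finprod_cong' refl)
        fix t assume t: "t \<in> ?K"
        have "s \<otimes> (c i \<otimes> g) = t \<otimes> (c i \<otimes> g) \<longleftrightarrow> s = t"
          using KG(1)[OF s] KG(1)[OF t] cg(1)[OF i g] by (simp only: G.right_cancel)
        then show "component (v (b' (i, t))) (s \<otimes> (c i \<otimes> g)) = (if s = t then v (b' (i, t)) else \<zero>\<^bsub>R\<^esub>)"
          using component_homogeneous[OF tcg(1)[OF i g t] vA(1)[OF g v i t] tcg(1)[OF i g s]] by simp
      qed (use vA(2)[OF g v i] in auto)
      also have "\<dots> = v (b' (i, s))"
        using s fin vA(2)[OF g v i] by (intro R.add.finprod_singleton) auto
      finally show ?thesis .
    qed
    have "inj_on (?\<phi> g) (carrier (hc ?F g))"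
    proof (rule inj_onI)
      fix v w assume v: "v \<in> carrier (hc ?F g)" and w: "w \<in> carrier (hc ?F g)" and eq: "?\<phi> g v = ?\<phi> g w"
      show "v = w"
      proof (rule PiE_ext[OF v[unfolded hc_free(1)[OF g]] w[unfolded hc_free(1)[OF g]]])
        fix j assume "j \<in> {..<M}"
        then have j: "j < M" by simp
        obtain i t where it: "b j = (i, t)" by fastforce
        have i: "i < n" and t: "t \<in> ?K" and jt: "b' (i, t) = j" using bb[OF j] it by auto
        have "(\<Oplus>\<^bsub>R\<^esub>t\<in>?K. v (b' (i, t))) = (\<Oplus>\<^bsub>R\<^esub>t\<in>?K. w (b' (i, t)))"
          using fun_cong[OF eq, of i] g v w i by simp
        then show "v j = w j" using comp[OF v i t] comp[OF w i t] jt by simp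
      qed
    qed
    moreover have "?\<phi> g ` carrier (hc ?F g) = carrier (hc (pullback G A \<pi> ?Y) g)"
    proof
      show "?\<phi> g ` carrier (hc ?F g) \<subseteq> carrier (hc (pullback G A \<pi> ?Y) g)"
        using gmod_hom_closed[OF \<phi> g] by blast
      show "carrier (hc (pullback G A \<pi> ?Y) g) \<subseteq> ?\<phi> g ` carrier (hc ?F g)"
      proof
        fix w assume w: "w \<in> carrier (hc (pullback G A \<pi> ?Y) g)"
        have wB: "w i \<in> B (d i \<otimes>\<^bsub>H\<^esub> \<pi> g)" if "i < n" for i using w that by (auto simp: Ycarr[OF g])
        \<comment> \<open>The preimage splits each coordinate of w into its G-components. None is
          lost, because the support of \<open>w i\<close> lies in the coset of the kernel through
          c_i g.\<close>
        define v where "v = (\<lambda>j\<in>{..<M}. component (w (fst (b j))) (D j \<otimes> g))"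
        have v: "v \<in> carrier (hc ?F g)"
          unfolding hc_free(1)[OF g] v_def
          using component_in[OF B_subset[OF wB[OF bb(1)]]] funcset_mem[OF D] g by auto
        have "(\<Oplus>\<^bsub>R\<^esub>t\<in>?K. v (b' (i, t))) = w i" if i: "i < n" for i
        proof -
          note wR = B_subset[OF wB[OF i]]
          let ?a = "c i \<otimes> g"
          let ?T = "(\<lambda>t. t \<otimes> ?a) ` ?K"
          have T: "finite ?T" "?T \<subseteq> carrier G" using fin tcg(1)[OF i g] by auto
          have "support (w i) \<subseteq> ?T"
          proof
            fix k assume "k \<in> support (w i)"
            then have k: "k \<in> carrier G" "\<pi> k = \<pi> ?a" using support_B[OF wB[OF i]] cg(2)[OF i g] by auto
            have "k \<otimes> inv ?a \<in> ?K"
              using k cg(1)[OF i g] \<pi>_closed[OF cg(1)[OF i g]] by (simp add: kernel_iff \<pi>_mult[OF k(1)] \<pi>_inv del: cg(2))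
            moreover have "k = k \<otimes> inv ?a \<otimes> ?a" using k(1) cg(1)[OF i g] by (simp add: G.m_assoc)
            ultimately show "k \<in> ?T" by blast
          qed
          then have "w i = (\<Oplus>\<^bsub>R\<^esub>s\<in>?T. component (w i) s)"
            using component_sum[OF wR T(1) _ T(2)] by simp
          also have "\<dots> = (\<Oplus>\<^bsub>R\<^esub>t\<in>?K. component (w i) (t \<otimes> ?a))"
          proof (rule R.add.finprod_reindex)
            show "component (w i) \<in> ?T \<rightarrow> carrier R" using T(2) component_closed[OF wR] by blast
            show "inj_on (\<lambda>t. t \<otimes> ?a) ?K" using cg(1)[OF i g] KG(1) by (auto intro!: inj_onI)
          qed
          also have "\<dots> = (\<Oplus>\<^bsub>R\<^esub>t\<in>?K. v (b' (i, t)))"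
          proof (intro R.add.finprod_cong' refl)
            fix t assume t: "t \<in> ?K"
            show "component (w i) (t \<otimes> ?a) = v (b' (i, t))"
              using b'[OF i t] KG(1)[OF t] c(1)[OF i] g by (simp add: v_def D_def G.m_assoc)
          qed (use vA(2)[OF g v i] in auto)
          finally show ?thesis by (rule sym)
        qed
        then have "?\<phi> g v = w"
          using g v w by (auto simp: Ycarr[OF g] fun_eq_iff PiE_iff extensional_def)
        then show "w \<in> ?\<phi> g ` carrier (hc ?F g)" using v by blast
      qed
    qed
    ultimately show ?thesis unfolding bij_betw_def by (rule conjI)
  qed
  then show ?thesis by (rule finitely_presented_bij[OF P F finitely_presented_free[OF D] \<phi>])
qed

section \<open>Transfer of finite presentation in both directions\<close>

lemma kernel_pullback:
  "g \<in> carrier G \<Longrightarrow> kernel (hc (pullback G A \<pi> Y) g) (hc (pullback G A \<pi> Z) g) ((\<lambda>g\<in>carrier G. p (\<pi> g)) g) =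
    kernel (hc Y (\<pi> g)) (hc Z (\<pi> g)) (p (\<pi> g))"
  by (simp add: pullback_hc)

lemma fin_gen_cong:
  assumes "\<And>g. g \<in> carrier G \<Longrightarrow> K g = L g"
  shows "fin_gen G A X K \<longleftrightarrow> fin_gen G A X L"
  unfolding fin_gen_def using assms by simp

text \<open>Kernels and images are computed degreewise, so restricting a free cover of Y gives a
  cover of the restriction with finitely generated kernel. Its source is finitely presented, and
  \<open>finitely_presented_quotient\<close> applies.\<close>

lemma finitely_presented_pullback:
  assumes surj: "\<pi> ` carrier G = carrier H" and fin: "finite (kernel G H \<pi>)"
    and Y: "graded_module H R B Y" and fp: "finitely_presented H R B Y"
  shows "finitely_presented G R A (pullback G A \<pi> Y)"
proof -
  obtain n d p E where d: "d \<in> {..<n} \<rightarrow> carrier H" and p: "p \<in> gmod_hom H B (free_gmod H R B n d) Y"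
    and psurj: "\<And>h. h \<in> carrier H \<Longrightarrow> p h ` carrier (hc (free_gmod H R B n d) h) = carrier (hc Y h)"
    and E: "finite E" "E \<subseteq> homogeneous_elements H (free_gmod H R B n d)"
    and ker: "\<And>h v. h \<in> carrier H \<Longrightarrow>
      v \<in> kernel (hc (free_gmod H R B n d) h) (hc Y h) (p h) \<longleftrightarrow> gspan H B (free_gmod H R B n d) E h v"
    using grading.finitely_presentedE[OF grading_B Y fp] by metis
  let ?F = "free_gmod H R B n d"
  note F = grading.graded_module_free[OF grading_B d]
  have "fin_gen H B ?F (\<lambda>h. kernel (hc ?F h) (hc Y h) (p h))"
    unfolding fin_gen_def using E ker by blast
  from fin_gen_pull[OF fin F this]
  have "fin_gen G A (pullback G A \<pi> ?F) (\<lambda>g. kernel (hc (pullback G A \<pi> ?F) g) (hc (pullback G A \<pi> Y) g)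
     ((\<lambda>g\<in>carrier G. p (\<pi> g)) g))"
    by (subst fin_gen_cong[OF kernel_pullback])
  moreover have "(\<lambda>g\<in>carrier G. p (\<pi> g)) g ` carrier (hc (pullback G A \<pi> ?F) g) = carrier (hc (pullback G A \<pi> Y) g)"
    if "g \<in> carrier G" for g
    using psurj[OF \<pi>_closed[OF that]] that by (simp add: pullback_hc)
  ultimately show ?thesis
    by (intro finitely_presented_quotient[OF graded_module_pullback[OF Y] graded_module_pullback[OF F]
          finitely_presented_pullback_free[OF surj fin d] gmod_hom_pullback[OF F p]])
qed

text \<open>Finite generation of Y is pushed forward from G and yields a free cover. Whether its
  kernel is finitely generated is decided after restriction, where \<open>fin_gen_kernel\<close>
  applies to this particular cover, and the answer is pushed forward again.\<close>

lemma finitely_presented_of_pullback: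
  assumes surj: "\<pi> ` carrier G = carrier H" and fin: "finite (kernel G H \<pi>)"
    and Y: "graded_module H R B Y" and fp: "finitely_presented G R A (pullback G A \<pi> Y)"
  shows "finitely_presented H R B Y"
proof -
  note P = graded_module_pullback[OF Y]
  have "fin_gen G A (pullback G A \<pi> Y) (\<lambda>g. carrier (hc Y (\<pi> g)))"
    using finitely_presented_fin_gen[OF P fp]
    by (subst (asm) fin_gen_cong[of _ "\<lambda>g. carrier (hc Y (\<pi> g))"]) (simp_all add: pullback_hc)
  then have "fin_gen H B Y (\<lambda>h. carrier (hc Y h))" by (rule fin_gen_push[OF surj Y])
  then obtain E where E: "finite E" "E \<subseteq> homogeneous_elements H Y"
    and spanE: "\<And>h x. h \<in> carrier H \<Longrightarrow> x \<in> carrier (hc Y h) \<longleftrightarrow> gspan H B Y E h x"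
    unfolding fin_gen_def by blast
  obtain n d p where d: "d \<in> {..<n} \<rightarrow> carrier H" and p: "p \<in> gmod_hom H B (free_gmod H R B n d) Y"
    and im: "\<forall>h\<in>carrier H. p h ` carrier (hc (free_gmod H R B n d) h) = {x. gspan H B Y E h x}"
    using grading.free_cover[OF grading_B Y E] by blast
  let ?F = "free_gmod H R B n d"
  note F = grading.graded_module_free[OF grading_B d]
  have psurj: "p h ` carrier (hc ?F h) = carrier (hc Y h)" if h: "h \<in> carrier H" for h
  proof -
    have "p h ` carrier (hc ?F h) = {x. gspan H B Y E h x}" using im h by (rule bspec)
    also have "\<dots> = carrier (hc Y h)" using spanE[OF h] by blast
    finally show ?thesis .
  qed
  have "fin_gen G A (pullback G A \<pi> ?F) (\<lambda>g. carrier (hc ?F (\<pi> g)))"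
    by (rule fin_gen_pull[OF fin F grading.fin_gen_free[OF grading_B d]])
  then have fgF: "fin_gen G A (pullback G A \<pi> ?F) (\<lambda>g. carrier (hc (pullback G A \<pi> ?F) g))"
    by (subst fin_gen_cong[of _ "\<lambda>g. carrier (hc ?F (\<pi> g))"]) (simp_all add: pullback_hc)
  have "fin_gen G A (pullback G A \<pi> ?F) (\<lambda>g. kernel (hc (pullback G A \<pi> ?F) g) (hc (pullback G A \<pi> Y) g)
     ((\<lambda>g\<in>carrier G. p (\<pi> g)) g))"
  proof (rule fin_gen_kernel[OF P fp graded_module_pullback[OF F] fgF gmod_hom_pullback[OF F p]])
    show "(\<lambda>g\<in>carrier G. p (\<pi> g)) g ` carrier (hc (pullback G A \<pi> ?F) g) = carrier (hc (pullback G A \<pi> Y) g)"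
      if "g \<in> carrier G" for g
      using psurj[OF \<pi>_closed[OF that]] that by (simp add: pullback_hc)
  qed
  then have "fin_gen G A (pullback G A \<pi> ?F) (\<lambda>g. kernel (hc ?F (\<pi> g)) (hc Y (\<pi> g)) (p (\<pi> g)))"
    by (subst (asm) fin_gen_cong[OF kernel_pullback])
  then have "fin_gen H B ?F (\<lambda>h. kernel (hc ?F h) (hc Y h) (p h))"
    by (rule fin_gen_push[OF surj F])
  then show ?thesis by (intro grading.finitely_presentedI[OF grading_B d p psurj])
qed

end

theorem proposition5p2:
  fixes G :: "('g, 'z) monoid_scheme" and H :: "('h, 'y) monoid_scheme"
    and \<pi> :: "'g \<Rightarrow> 'h" and R :: "('r, 'w) ring_scheme" and A :: "'g \<Rightarrow> 'r set"
  defines "N \<equiv> G\<lparr>carrier := kernel G H \<pi>\<rparr>"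
    and "B \<equiv> pushforward_grading G R A \<pi>"
  assumes hom: "group_hom G H \<pi>"
    and grading: "graded_ring G R A"
    and nonzero: "\<one>\<^bsub>R\<^esub> \<noteq> \<zero>\<^bsub>R\<^esub>"
    and universe: "carrier R \<lesssim> (UNIV :: 'm set)"
  shows "strict_action N (Mod_cat TYPE('m) G R A) (shift_action G) \<and>
    is_functor (Mod_cat TYPE('m) H R B)
      (equivariant_cat N (Mod_cat TYPE('m) G R A) (shift_action G)) (Theta G H A \<pi>) \<and>
    (is_equivalence (Mod_cat TYPE('m) H R B)
      (equivariant_cat N (Mod_cat TYPE('m) G R A) (shift_action G)) (Theta G H A \<pi>)
      \<longleftrightarrow> \<pi> ` carrier G = carrier H) \<and>
    (\<pi> ` carrier G = carrier H \<and> finite (carrier N) \<longrightarrow>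
      is_equivalence (mod_cat TYPE('m) H R B)
        (equivariant_cat N (mod_cat TYPE('m) G R A) (shift_action G)) (Theta G H A \<pi>))"
proof -
  interpret \<pi>: grading_hom G R A H \<pi>
    using hom grading
    by (simp add: grading_hom_def grading_hom_axioms_def grading_def grading_axioms_def
        group_hom_def group_hom_axioms_def graded_ring_def)
  let ?C = "Mod_cat TYPE('m) H R B"
  let ?D = "equivariant_cat N (Mod_cat TYPE('m) G R A) (shift_action G)"
  let ?\<Theta> = "Theta G H A \<pi>"
  have "strict_action N (Mod_cat TYPE('m) G R A) (shift_action G)"
    unfolding N_def by (rule \<pi>.strict_action_shift[OF \<pi>.subgroup_kernel])
  moreover have Theta: "is_functor ?C ?D ?\<Theta>"
    unfolding N_def B_def by (rule \<pi>.is_functor_Theta)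
  moreover have "is_equivalence ?C ?D ?\<Theta>" if surj: "\<pi> ` carrier G = carrier H"
  proof (rule is_equivalenceI[OF Theta])
    fix X Y f assume "X \<in> Obj ?C" "Y \<in> Obj ?C" "f \<in> Arr ?D (fob ?\<Theta> X) (fob ?\<Theta> Y)"
    then show "\<exists>f'\<in>Arr ?C X Y. far ?\<Theta> X Y f' = f"
      unfolding N_def B_def Mod_cat_simps mem_Collect_eq by (rule \<pi>.Theta_full[OF surj])
  next
    fix X Y f f' assume "f \<in> Arr ?C X Y" "f' \<in> Arr ?C X Y" "far ?\<Theta> X Y f = far ?\<Theta> X Y f'"
    then show "f = f'"
      unfolding N_def B_def Mod_cat_simps mem_Collect_eq by (rule \<pi>.Theta_faithful[OF surj])
  next
    fix X assume "X \<in> Obj ?D"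
    then show "\<exists>Y\<in>Obj ?C. \<exists>e. is_iso ?D (fob ?\<Theta> Y) X e"
      using \<pi>.Theta_essentially_surjective[OF surj, of X] unfolding N_def B_def by auto
  qed
  moreover have "\<pi> ` carrier G = carrier H" if "is_equivalence ?C ?D ?\<Theta>"
    using \<pi>.surjective_of_equivalence[OF that[unfolded N_def B_def] nonzero universe] .
  moreover have "is_equivalence (mod_cat TYPE('m) H R B)
        (equivariant_cat N (mod_cat TYPE('m) G R A) (shift_action G)) ?\<Theta>"
    if surj: "\<pi> ` carrier G = carrier H" and "finite (carrier N)"
  proof -
    have fin: "finite (kernel G H \<pi>)" using that(2) by (simp add: N_def)
    \<comment> \<open>Both categories of finitely presented objects are full subcategories of the
      large ones, so fullness and faithfulness are inherited; what remains is that objects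
      correspond.\<close>
    let ?C' = "full_subcategory ?C (finitely_presented H R B)"
    let ?D' = "full_subcategory ?D (\<lambda>X. finitely_presented G R A (fst X))"
    have "is_equivalence ?C' ?D' ?\<Theta>"
    proof (rule is_equivalenceI)
      show "is_functor ?C' ?D' ?\<Theta>"
        using \<pi>.finitely_presented_pullback[OF surj fin]
        by (intro is_functor_full_subcategory[OF Theta]) (simp add: B_def)
    next
      fix X Y f assume "X \<in> Obj ?C'" "Y \<in> Obj ?C'" "f \<in> Arr ?D' (fob ?\<Theta> X) (fob ?\<Theta> Y)"
      then have "graded_module H R \<pi>.B X" "graded_module H R \<pi>.B Y"
        "f \<in> Arr (equivariant_cat \<pi>.N (Mod_cat TYPE('m) G R A) (shift_action G)) (fob ?\<Theta> X) (fob ?\<Theta> Y)"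
        by (simp_all add: N_def B_def del: equivariant_cat_simps)
      then show "\<exists>f'\<in>Arr ?C' X Y. far ?\<Theta> X Y f' = f"
        unfolding full_subcategory_simps B_def Mod_cat_simps by (rule \<pi>.Theta_full[OF surj])
    next
      fix X Y f f' assume "f \<in> Arr ?C' X Y" "f' \<in> Arr ?C' X Y" "far ?\<Theta> X Y f = far ?\<Theta> X Y f'"
      then show "f = f'"
        unfolding full_subcategory_simps B_def Mod_cat_simps by (rule \<pi>.Theta_faithful[OF surj])
    next
      fix X assume "X \<in> Obj ?D'"
      then have X: "X \<in> Obj ?D" and fp: "finitely_presented G R A (fst X)" by auto
      have M: "graded_module G R A (fst X)" using equivariant_objD(1)[OF X] by simp
      obtain Y e i where Y: "graded_module H R B Y" and e: "is_iso ?D (fob ?\<Theta> Y) X e"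
        and i: "is_iso (Mod_cat TYPE('m) G R A) (pullback G A \<pi> Y) (fst X) i"
        using \<pi>.Theta_essentially_surjective[OF surj, of X] X unfolding N_def B_def by blast
      \<comment> \<open>The isomorphism is reversed because finite presentation is known for the
        underlying module of X and has to pass to the restriction of Y.\<close>
      obtain j where j: "is_iso (Mod_cat TYPE('m) G R A) (fst X) (pullback G A \<pi> Y) j"
        using i unfolding is_iso_def by blast
      have "finitely_presented G R A (pullback G A \<pi> Y)"
        using \<pi>.is_iso_Mod_catD[OF j] j Y[unfolded B_def]
        by (intro \<pi>.finitely_presented_bij[OF \<pi>.graded_module_pullback M fp]) (auto simp: is_iso_def)
      then have "finitely_presented H R B Y"
        using \<pi>.finitely_presented_of_pullback[OF surj fin] Y by (simp add: B_def)
      then show "\<exists>Y\<in>Obj ?C'. \<exists>e. is_iso ?D' (fob ?\<Theta> Y) X e"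
        using Y e by (intro bexI[of _ Y] exI[of _ e]) simp_all
    qed
    then show ?thesis by (simp add: mod_cat_def equivariant_cat_full_subcategory)
  qed
  ultimately show ?thesis by blast
qed

end
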